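(* Let $P(\lambda)=\sum_{i=0}^m\lambda^iA_i$ with $A_i\in\mathbb{C}^{n\times n}$, $A_m\neq 0$, $m\ge 2$, be regular and let $\mu\in\mathbb{C}$ be an eigenvalue of $P(\lambda)$. Let $$L(\lambda)=M_{\tau_1}(Y_1)\,M_{\sigma_1}(X_1)\,(\lambda M^P_\tau-M^P_\sigma)\,M_{\sigma_2}(X_2)\,M_{\tau_2}(Y_2)$$ be an extended generalized Fiedler pencil (EGFP) of $P(\lambda)$, and $\omega=-\tau$. Let $Z$ be an $mn\times p$ matrix with $\mathrm{rank}(Z)=p$. Define the $n\times mn$ matrix $F$ by: (F1) $F=e^T_{m-c_0(\sigma,\sigma_2)}\otimes I_n$ if $0\in\sigma$ and $c_0(\sigma)<m$; (F2) $F=A_m^{-1}(e_1^T\otimes I_n)$ if $0\in\sigma$ and $c_0(\sigma)=m$; (F3) $F=e^T_{m-q}\otimes I_n$ with $q=i_0(\omega)+c_{i_0(\omega)+1}(\sigma,\sigma_2)+1$, if $0\in\omega$, $i_0(\omega)+1\in\sigma$ and $i_0(\omega)+c_{i_0(\omega)+1}(\sigma)+1<m$; (F4) $F=A_m^{-1}(e_q^T\otimes I_n)$ with $q=c_{-(m-1)}(\tau_2)+2$, if $0\in\omega$, $i_0(\omega)+1\in\sigma$ and $i_0(\omega)+c_{i_0(\omega)+1}(\sigma)+1=m$; (F5) $F=e^T_{m-q}\otimes I_n$ with $q=i_0(\omega)-c_{-i_0(\omega)}(\tau_2)-1$, if $0\in\omega$, $i_0(\omega)<m$ and $i_0(\omega)+1\notin\sigma$;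 (F6) $F=A_0^{-1}(e_m^T\otimes I_n)$ if $0\in\omega$ and $i_0(\omega)=m$. Define the $n\times mn$ matrix $K$ by: (K1) $K=e^T_{m-i_0(\sigma_1,\sigma)}\otimes I_n$ if $0\in\sigma$ and $i_0(\sigma)<m$; (K2) $K=A_m^{-T}(e_1^T\otimes I_n)$ if $0\in\sigma$ and $i_0(\sigma)=m$; (K3) $K=e^T_{m-q}\otimes I_n$ with $q=c_0(\omega)+i_{c_0(\omega)+1}(\sigma_1,\sigma)+1$, if $0\in\omega$, $c_0(\omega)+1\in\sigma$ and $c_0(\omega)+i_{c_0(\omega)+1}(\sigma)+1<m$; (K4) $K=A_m^{-T}(e_q^T\otimes I_n)$ with $q=i_{-(m-1)}(\tau_1)+2$, if $0\in\omega$, $c_0(\omega)+1\in\sigma$ and $c_0(\omega)+i_{c_0(\omega)+1}(\sigma)+1=m$; (K5) $K=e^T_{m-q}\otimes I_n$ with $q=c_0(\omega)-i_{-c_0(\omega)}(\tau_1)-1$, if $0\in\omega$, $c_0(\omega)<m$ and $c_0(\omega)+1\notin\sigma$; (K6) $K=A_0^{-T}(e_m^T\otimes I_n)$ if $0\in\omega$ and $c_0(\omega)=m$. Then the maps $\mathcal N_r(L(\mu))\to\mathcal N_r(P(\mu))$, $x\mapsto Fx$, and $\mathcal N_l(L(\mu))\to\mathcal N_l(P(\mu))$, $y\mapsto Ky$, are linear isomorphisms. Thus, if the columns of $Z$ form a basis of $\mathcal N_r(L(\mu))$ (resp., $\mathcal N_l(L(\mu))$), then the columns of $FZ$ (resp.,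 $KZ$) form a basis of $\mathcal N_r(P(\mu))$ (resp., $\mathcal N_l(P(\mu))$).
   Context: Notation: $\{0:m\}=\{0,1,\dots,m\}$, $-\{0:m\}=\{-m,\dots,-1,-0\}$, where $-0$ is a formal index different from $0$ (the successor of $-1$). $e_j$ is the $j$-th column of $I_m$; $\otimes$ is the Kronecker product. For a constant matrix $A$, $\mathcal N_r(A)=\{x:Ax=0\}$, $\mathcal N_l(A)=\{x:x^TA=0\}$. $P$ is regular if $\det P\not\equiv0$; then $\mu$ is an eigenvalue if $\det P(\mu)=0$. Index tuples: an index tuple is a finite, possibly empty, tuple of indices. $(\alpha,\beta)$ denotes concatenation and $-\alpha$ negates all entries. A subtuple is obtained by deleting some entries. A tuple $(i_1,\dots,i_t)$ satisfies the Successor Infix Property (SIP) if whenever $a<b$ and $i_a=i_b$ there is $c$ with $a<c<b$ and $i_c=i_a+1$ (for tuples from $-\{0:m\}$ this is understood after shifting by $m$, so $-0$ is the successor of $-1$). For $t\in\alpha$, $c_t(\alpha)=p$ (consecutions at $t$) if $(t,t+1,\dots,t+p)$ is a subtuple of $\alpha$ but $(t,\dots,t+p+1)$ is not; $i_t(\alpha)=q$ (inversions at $t$) if $(t+q,\dots,t+1,t)$ is a subtuple of $\alpha$ but $(t+q+1,t+q,\dots,t)$ is not. If $t\notin\alpha$, $c_t(\alpha)=i_t(\alpha)=-1$. When $i_0(\omega)=0$ (or $c_0(\omega)=0$), the index $-i_0(\omega)$ (or $-c_0(\omega)$) means $-0$. Elementary matrices (of size $mn\times mn$): for $X\in\mathbb{C}^{n\times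 n}$, $M_0(X)=\mathrm{diag}(I_{(m-1)n},X)$, $M_{-m}(X)=\mathrm{diag}(X,I_{(m-1)n})$, and for $i=1,\dots,m-1$ $$M_i(X)=\mathrm{diag}\Big(I_{(m-i-1)n},\begin{bmatrix}X & I_n \\ I_n & 0\end{bmatrix},I_{(i-1)n}\Big),\quad M_{-i}(X)=\mathrm{diag}\Big(I_{(m-i-1)n},\begin{bmatrix}0 & I_n \\ I_n & X\end{bmatrix},I_{(i-1)n}\Big).$$ $M_i^P=M_i(-A_i)$ for $0\le i\le m-1$, $M_{-i}^P=M_{-i}(A_i)$ for $1\le i\le m$, $M_{-0}^P=(M_0^P)^{-1}$, $M_m^P=(M_{-m}^P)^{-1}$ (the last two are used only when $A_0$, respectively $A_m$, is invertible). For a tuple $\mathbf t=(t_1,\dots,t_r)$, $M_{\mathbf t}^P=M_{t_1}^P\cdots M_{t_r}^P$; a matrix assignment for $\mathbf t$ is a tuple $X=(X_1,\dots,X_r)$ of $n\times n$ complex matrices, and $M_{\mathbf t}(X)=M_{t_1}(X_1)\cdots M_{t_r}(X_r)$. Empty products equal $I_{mn}$. An assignment is nonsingular if the matrices assigned to positions occupied by indices $\pm0,\pm m$ are nonsingular. EGFP: let $(\sigma,\omega)$ be a permutation of $\{0:m\}$ and $\tau=-\omega$. Let $\sigma_1,\sigma_2$ be index tuples with indices from $\sigma\setminus\{m-1,m\}$ such that $(\sigma_1,\sigma,\sigma_2)$ satisfies the SIP, and $\tau_1,\tau_2$ index tuples with indices from $\tau\setminus\{-1,-0\}$ such that $(\tau_1,\tau,\tau_2)$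 satisfies the SIP. Let $X_1,X_2,Y_1,Y_2$ be arbitrary nonsingular matrix assignments for $\sigma_1,\sigma_2,\tau_1,\tau_2$. Then $M_{\tau_1}(Y_1)M_{\sigma_1}(X_1)(\lambda M^P_\tau-M^P_\sigma)M_{\sigma_2}(X_2)M_{\tau_2}(Y_2)$ is an EGFP of $P(\lambda)$. *)

theory Defs
  imports
    "Jordan_Normal_Form.DL_Rank"
    "Jordan_Normal_Form.Gauss_Jordan_Elimination"
    "Jordan_Normal_Form.Matrix_Kernel"
    "HOL-Library.Sublist"
begin

section \<open>Index tuples\<close>

text \<open>Signed indices: \<open>Pos i\<close> stands for \<open>i\<close> and \<open>Neg i\<close> for \<open>-i\<close>; in particular
  \<open>Neg 0\<close> is the formal index \<open>-0\<close>, which is different from \<open>Pos 0\<close>.\<close>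

datatype idx = Pos nat | Neg nat

fun idx_neg :: "idx \<Rightarrow> idx" where
  "idx_neg (Pos i) = Neg i"
| "idx_neg (Neg i) = Pos i"

text \<open>\<open>is_succ s t\<close> means \<open>t = s + 1\<close>. On \<open>-{0:m}\<close> the order is the one obtained after shifting
  by \<open>m\<close>: \<open>-m, \<dots>, -1, -0\<close>, so that \<open>-0\<close> is the successor of \<open>-1\<close> and has no successor itself.\<close>

fun is_succ :: "idx \<Rightarrow> idx \<Rightarrow> bool" where
  "is_succ (Pos i) (Pos j) \<longleftrightarrow> j = Suc i"
| "is_succ (Neg i) (Neg j) \<longleftrightarrow> i = Suc j"
| "is_succ _ _ \<longleftrightarrow> False"

definition SIP :: "idx list \<Rightarrow> bool" where
  "SIP \<alpha> \<longleftrightarrow> (\<forall>a b. a < b \<and> b < length \<alpha> \<and> \<alpha> ! a = \<alpha> ! b \<longrightarrow>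
     (\<exists>c. a < c \<and> c < b \<and> is_succ (\<alpha> ! a) (\<alpha> ! c)))"

text \<open>\<open>idx_run t p \<beta>\<close> means \<open>\<beta> = (t, t+1, \<dots>, t+p)\<close>.\<close>

definition idx_run :: "idx \<Rightarrow> nat \<Rightarrow> idx list \<Rightarrow> bool" where
  "idx_run t p \<beta> \<longleftrightarrow> length \<beta> = Suc p \<and> hd \<beta> = t \<and> successively is_succ \<beta>"

text \<open>The numbers \<open>c_t(\<alpha>)\<close> and \<open>i_t(\<alpha>)\<close>. The number described by \<open>THE\<close> exists and is unique
  for \<open>t \<in> set \<alpha>\<close>, because the lengths of runs starting at \<open>t\<close> are closed downwards and bounded.\<close>

definition consecutions :: "idx \<Rightarrow> idx list \<Rightarrow> int" where
  "consecutions t \<alpha> = (if t \<in> set \<alpha>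
     then int (THE p. (\<exists>\<beta>. idx_run t p \<beta> \<and> subseq \<beta> \<alpha>) \<and>
                      \<not> (\<exists>\<beta>. idx_run t (Suc p) \<beta> \<and> subseq \<beta> \<alpha>))
     else - 1)"

definition inversions :: "idx \<Rightarrow> idx list \<Rightarrow> int" where
  "inversions t \<alpha> = (if t \<in> set \<alpha>
     then int (THE q. (\<exists>\<beta>. idx_run t q \<beta> \<and> subseq (rev \<beta>) \<alpha>) \<and>
                      \<not> (\<exists>\<beta>. idx_run t (Suc q) \<beta> \<and> subseq (rev \<beta>) \<alpha>))
     else - 1)"


section \<open>Matrices\<close>

abbreviation mat_inv :: "complex mat \<Rightarrow> complex mat" where
  "mat_inv B \<equiv> the (mat_inverse B)"

definition kron :: "complex mat \<Rightarrow> complex mat \<Rightarrow> complex mat" where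
  "kron B C = mat (dim_row B * dim_row C) (dim_col B * dim_col C)
     (\<lambda>(i, j). B $$ (i div dim_row C, j div dim_col C) * C $$ (i mod dim_row C, j mod dim_col C))"

text \<open>The matrix \<open>e_j^T \<otimes> I_n\<close>, where \<open>e_j\<close> is the \<open>j\<close>-th column of \<open>I_m\<close>. The index \<open>j\<close> counts
  from 1, whereas vectors are indexed from 0.\<close>

definition block_row :: "nat \<Rightarrow> nat \<Rightarrow> int \<Rightarrow> complex mat" where
  "block_row m n j = kron (mat_of_row (unit_vec m (nat (j - 1)))) (1\<^sub>m n)"

definition mat_prod :: "nat \<Rightarrow> complex mat list \<Rightarrow> complex mat" where
  "mat_prod d Bs = foldr (*) Bs (1\<^sub>m d)"

text \<open>The value \<open>P(z)\<close> of the matrix polynomial \<open>P(\<lambda>) = \<Sum>i=0..m. \<lambda>^i A_i\<close>.\<close>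

definition matpoly :: "nat \<Rightarrow> nat \<Rightarrow> (nat \<Rightarrow> complex mat) \<Rightarrow> complex \<Rightarrow> complex mat" where
  "matpoly m n A z = mat n n (\<lambda>(r, c). \<Sum>i\<le>m. z ^ i * A i $$ (r, c))"

definition regular_matpoly :: "nat \<Rightarrow> nat \<Rightarrow> (nat \<Rightarrow> complex mat) \<Rightarrow> bool" where
  "regular_matpoly m n A \<longleftrightarrow> (\<exists>z. det (matpoly m n A z) \<noteq> 0)"

definition matpoly_eigenvalue :: "nat \<Rightarrow> nat \<Rightarrow> (nat \<Rightarrow> complex mat) \<Rightarrow> complex \<Rightarrow> bool" where
  "matpoly_eigenvalue m n A z \<longleftrightarrow> det (matpoly m n A z) = 0"


section \<open>Elementary matrices and extended generalized Fiedler pencils\<close>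

text \<open>\<open>M_t(X)\<close>, of size \<open>mn \<times> mn\<close>, for \<open>t\<close> among \<open>0, \<dots>, m-1, -1, \<dots>, -m\<close>. The values at
  \<open>Pos m\<close> and \<open>Neg 0\<close> are meaningless; these indices never occur in a tuple that receives a
  matrix assignment.\<close>

fun elem_mat :: "nat \<Rightarrow> nat \<Rightarrow> idx \<Rightarrow> complex mat \<Rightarrow> complex mat" where
  "elem_mat m n (Pos i) X =
     (if i = 0 then diag_block_mat [1\<^sub>m ((m - 1) * n), X]
      else diag_block_mat [1\<^sub>m ((m - i - 1) * n),
             four_block_mat X (1\<^sub>m n) (1\<^sub>m n) (0\<^sub>m n n), 1\<^sub>m ((i - 1) * n)])"
| "elem_mat m n (Neg i) X =
     (if i = m then diag_block_mat [X, 1\<^sub>m ((m - 1) * n)]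
      else diag_block_mat [1\<^sub>m ((m - i - 1) * n),
             four_block_mat (0\<^sub>m n n) (1\<^sub>m n) (1\<^sub>m n) X, 1\<^sub>m ((i - 1) * n)])"

text \<open>\<open>M_t^P\<close>; the inverses at \<open>t = m\<close> and \<open>t = -0\<close> are meaningful only if \<open>A_m\<close>,
  respectively \<open>A_0\<close>, is invertible.\<close>

fun fiedler_mat :: "nat \<Rightarrow> nat \<Rightarrow> (nat \<Rightarrow> complex mat) \<Rightarrow> idx \<Rightarrow> complex mat" where
  "fiedler_mat m n A (Pos i) =
     (if i = m then mat_inv (elem_mat m n (Neg m) (A m)) else elem_mat m n (Pos i) (- A i))"
| "fiedler_mat m n A (Neg i) =
     (if i = 0 then mat_inv (elem_mat m n (Pos 0) (- A 0)) else elem_mat m n (Neg i) (A i))"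

definition elem_prod :: "nat \<Rightarrow> nat \<Rightarrow> idx list \<Rightarrow> complex mat list \<Rightarrow> complex mat" where
  "elem_prod m n t X = mat_prod (m * n) (map2 (elem_mat m n) t X)"

definition fiedler_prod :: "nat \<Rightarrow> nat \<Rightarrow> (nat \<Rightarrow> complex mat) \<Rightarrow> idx list \<Rightarrow> complex mat" where
  "fiedler_prod m n A t = mat_prod (m * n) (map (fiedler_mat m n A) t)"

definition matrix_assignment :: "nat \<Rightarrow> idx list \<Rightarrow> complex mat list \<Rightarrow> bool" where
  "matrix_assignment n t X \<longleftrightarrow> length X = length t \<and> set X \<subseteq> carrier_mat n n"

definition nonsingular_assignment :: "nat \<Rightarrow> nat \<Rightarrow> idx list \<Rightarrow> complex mat list \<Rightarrow> bool" where
  "nonsingular_assignment m n t X \<longleftrightarrow> matrix_assignment n t X \<and>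
     (\<forall>k < length t. t ! k \<in> {Pos 0, Neg 0, Pos m, Neg m} \<longrightarrow> invertible_mat (X ! k))"

text \<open>The conditions on the data of an EGFP. The last two conjuncts express that \<open>M_m^P\<close> and
  \<open>M_{-0}^P\<close> are used only when \<open>A_m\<close>, respectively \<open>A_0\<close>, is invertible.\<close>

definition egfp_data ::
  "nat \<Rightarrow> nat \<Rightarrow> (nat \<Rightarrow> complex mat) \<Rightarrow> idx list \<Rightarrow> idx list \<Rightarrow> idx list \<Rightarrow>
   idx list \<Rightarrow> idx list \<Rightarrow> idx list \<Rightarrow> idx list \<Rightarrow>
   complex mat list \<Rightarrow> complex mat list \<Rightarrow> complex mat list \<Rightarrow> complex mat list \<Rightarrow> bool" where
  "egfp_data m n A \<sigma> \<omega> \<tau> \<sigma>1 \<sigma>2 \<tau>1 \<tau>2 X1 X2 Y1 Y2 \<longleftrightarrow>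
     distinct (\<sigma> @ \<omega>) \<and> set (\<sigma> @ \<omega>) = Pos ` {0..m} \<and>
     \<tau> = map idx_neg \<omega> \<and>
     set \<sigma>1 \<subseteq> set \<sigma> - {Pos (m - 1), Pos m} \<and> set \<sigma>2 \<subseteq> set \<sigma> - {Pos (m - 1), Pos m} \<and>
     SIP (\<sigma>1 @ \<sigma> @ \<sigma>2) \<and>
     set \<tau>1 \<subseteq> set \<tau> - {Neg 1, Neg 0} \<and> set \<tau>2 \<subseteq> set \<tau> - {Neg 1, Neg 0} \<and>
     SIP (\<tau>1 @ \<tau> @ \<tau>2) \<and>
     nonsingular_assignment m n \<sigma>1 X1 \<and> nonsingular_assignment m n \<sigma>2 X2 \<and>
     nonsingular_assignment m n \<tau>1 Y1 \<and> nonsingular_assignment m n \<tau>2 Y2 \<and>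
     (Pos m \<in> set \<sigma> \<longrightarrow> invertible_mat (A m)) \<and>
     (Neg 0 \<in> set \<tau> \<longrightarrow> invertible_mat (A 0))"

definition egfp ::
  "nat \<Rightarrow> nat \<Rightarrow> (nat \<Rightarrow> complex mat) \<Rightarrow> idx list \<Rightarrow> idx list \<Rightarrow>
   idx list \<Rightarrow> idx list \<Rightarrow> idx list \<Rightarrow> idx list \<Rightarrow>
   complex mat list \<Rightarrow> complex mat list \<Rightarrow> complex mat list \<Rightarrow> complex mat list \<Rightarrow>
   complex \<Rightarrow> complex mat" where
  "egfp m n A \<sigma> \<tau> \<sigma>1 \<sigma>2 \<tau>1 \<tau>2 X1 X2 Y1 Y2 z =
     elem_prod m n \<tau>1 Y1 * elem_prod m n \<sigma>1 X1 *
     (z \<cdot>\<^sub>m fiedler_prod m n A \<tau> - fiedler_prod m n A \<sigma>) *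
     elem_prod m n \<sigma>2 X2 * elem_prod m n \<tau>2 Y2"


section \<open>Null spaces, isomorphisms, bases\<close>

definition left_kernel :: "complex mat \<Rightarrow> complex vec set" where
  "left_kernel B = {x \<in> carrier_vec (dim_row B). mat_of_row x * B = 0\<^sub>m 1 (dim_col B)}"

text \<open>The null spaces \<open>N_r(B)\<close> and \<open>N_l(B)\<close> as vector spaces over the complex numbers.\<close>

definition right_null_space :: "complex mat \<Rightarrow> (complex, complex vec) module" where
  "right_null_space B = module_vec TYPE(complex) (dim_col B) \<lparr>carrier := mat_kernel B\<rparr>"

definition left_null_space :: "complex mat \<Rightarrow> (complex, complex vec) module" where
  "left_null_space B = module_vec TYPE(complex) (dim_row B) \<lparr>carrier := left_kernel B\<rparr>"

definition linear_iso ::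
  "(complex, complex vec) module \<Rightarrow> (complex, complex vec) module \<Rightarrow>
   (complex vec \<Rightarrow> complex vec) \<Rightarrow> bool" where
  "linear_iso V W f \<longleftrightarrow> linear_map class_ring V W f \<and> bij_betw f (carrier V) (carrier W)"

definition columns_form_basis :: "complex mat \<Rightarrow> (complex, complex vec) module \<Rightarrow> bool" where
  "columns_form_basis B V \<longleftrightarrow>
     distinct (cols B) \<and> vectorspace.basis class_ring V (set (cols B))"

end

theory Submission
  imports Defs
begin

text \<open>
  Read a product of elementary matrices as a network. A block vector is a family of \<open>m\<close> wires,
  wire \<open>k\<close> carrying the block row \<open>m - k + 1\<close>, and the elementary matrix with index \<open>\<plusminus>i\<close> is a gate on
  the wires \<open>i\<close> and \<open>i + 1\<close>. The gates of \<open>i\<close> and of \<open>-i\<close> obey the same law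
  \<open>a\<^sub>i = b\<^sub>i + A\<^sub>i c\<^sub>i\<close> between their port values: the gate of \<open>i\<close> turns the pair \<open>(c\<^sub>i, a\<^sub>i)\<close> on
  its upper and lower wire into \<open>(b\<^sub>i, c\<^sub>i)\<close>, the gate of \<open>-i\<close> turns \<open>(b\<^sub>i, c\<^sub>i)\<close> into
  \<open>(c\<^sub>i, a\<^sub>i)\<close>. The gates of \<open>\<plusminus>0\<close> and \<open>\<plusminus>m\<close> fit the same law with \<open>a\<^sub>0 = 0\<close> and \<open>b\<^sub>m = 0\<close>.

  A vector \<open>y\<close> lies in the kernel of \<open>\<mu> M\<^sub>\<tau> - M\<^sub>\<sigma>\<close> iff on every wire the output of \<open>M\<^sub>\<sigma>\<close> is \<open>\<mu>\<close> times
  the output of \<open>M\<^sub>\<tau>\<close>. Whatever the distribution of the indices \<open>j\<close>, \<open>j + 1\<close> over \<open>\<sigma>\<close> and \<open>\<tau>\<close> and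
  their order, this condition on wire \<open>j + 1\<close> is one of the two alternatives
  \<open>c\<^bsub>j+1\<^esub> = c\<^sub>j, b\<^sub>j = \<mu> a\<^bsub>j+1\<^esub>\<close> or \<open>c\<^bsub>j+1\<^esub> = \<mu> c\<^sub>j, b\<^sub>j = a\<^bsub>j+1\<^esub>\<close> (lemma \<open>fits_states_iff\<close>). Either way
  one factor \<open>\<mu>\<close> is spent per wire, so that eliminating all \<open>a\<^sub>i\<close> and \<open>b\<^sub>i\<close> is a Horner scheme and
  yields \<open>a\<^sub>0 = P(\<mu>) c\<^sub>0\<close> (lemma \<open>ports_telescope\<close>). Hence \<open>y \<mapsto> c\<^sub>0\<close> is a bijection between the kernel
  of the pencil and that of \<open>P(\<mu>)\<close> (lemmas \<open>pencil_kernel_iff\<close>, \<open>ports_of_matpoly\<close>, \<open>ports_of_zero\<close>,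
  \<open>ports_of_exists\<close>).

  It remains to find a wire of \<open>x\<close>, where \<open>y = N x\<close> and \<open>N = M\<^bsub>\<sigma>2\<^esub>(X\<^sub>2) M\<^bsub>\<tau>2\<^esub>(Y\<^sub>2)\<close>, on which \<open>c\<^sub>0\<close> can be
  read off up to a nonzero factor. Along the consecutions of \<open>0\<close> in \<open>\<sigma>\<close>, or the inversions of \<open>0\<close> in
  \<open>\<omega>\<close>, the value \<open>c\<^sub>0\<close> is handed on unchanged until the run ends, and there it appears on a wire of
  \<open>y\<close>. Following that wire through \<open>\<sigma>2\<close> and \<open>\<tau>2\<close>, the value moves by one wire with each further
  letter of the run; the successor infix property excludes exactly the letters that would add
  something to it (lemmas \<open>wire_elem_prod_Pos\<close>, \<open>wire_elem_prod_Neg\<close>). The cases in the definition of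
  \<open>F\<close> are the possible ends of this journey (lemma \<open>recovery_mat_scales\<close>). When the run leaves \<open>\<omega>\<close>
  the value becomes \<open>\<mu> c\<^sub>0\<close>; this is harmless, since \<open>0 \<in> \<omega>\<close> forces \<open>A\<^sub>0\<close> to be invertible, and then
  either \<open>\<mu> \<noteq> 0\<close> or \<open>P(\<mu>) = A\<^sub>0\<close> has trivial kernel.

  The left null space of a matrix is the right null space of its transpose. Transposing an EGFP
  reverses all tuples and exchanges the roles of \<open>(\<sigma>1, \<tau>1)\<close> and \<open>(\<sigma>2, \<tau>2)\<close>, and reversal exchanges
  consecutions with inversions; so the claim on \<open>K\<close> is the claim on \<open>F\<close> for the transposed data.
\<close>

section \<open>Consecutions by greedy matching\<close>

text \<open>Length of the run \<open>t, t + 1, \<dots>\<close> obtained by always taking the first possible letter; it is one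
  more than the number of consecutions, and \<open>0\<close> if \<open>t\<close> does not occur. Unlike the number of
  consecutions it is computed by recursion on the tuple.\<close>
fun run_len :: "idx \<Rightarrow> idx list \<Rightarrow> nat" where
  "run_len t [] = 0"
| "run_len (Pos k) (x # xs) = (if x = Pos k then Suc (run_len (Pos (Suc k)) xs) else run_len (Pos k) xs)"
| "run_len (Neg 0) (x # xs) = (if x = Neg 0 then 1 else run_len (Neg 0) xs)"
| "run_len (Neg (Suc k)) (x # xs) =
    (if x = Neg (Suc k) then Suc (run_len (Neg k) xs) else run_len (Neg (Suc k)) xs)"

lemma idx_run_0: "idx_run t 0 \<beta> \<longleftrightarrow> \<beta> = [t]"
  unfolding idx_run_def by (cases \<beta>) auto

lemma idx_run_Suc:
  "idx_run t (Suc p) \<beta> \<longleftrightarrow> (\<exists>s \<beta>'. \<beta> = t # \<beta>' \<and> is_succ t s \<and> idx_run s p \<beta>')"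
proof (cases \<beta>)
  case (Cons x \<gamma>)
  then show ?thesis by (cases \<gamma>) (auto simp: idx_run_def)
qed (auto simp: idx_run_def)

lemma idx_run_Cons: "idx_run t p \<beta> \<Longrightarrow> \<exists>\<beta>'. \<beta> = t # \<beta>'"
  by (cases \<beta>) (auto simp: idx_run_def)

lemma is_succ_Pos: "is_succ (Pos k) s \<longleftrightarrow> s = Pos (Suc k)"
  by (cases s) auto

lemma is_succ_Neg: "is_succ (Neg k) s \<longleftrightarrow> (\<exists>j. k = Suc j \<and> s = Neg j)"
  by (cases s) auto

text \<open>Greedy matching is optimal: if the first letter is \<open>t\<close>, a run starting at \<open>t\<close> may as well use it.\<close>
lemma run_subseq_iff_run_len: "(\<exists>\<beta>. idx_run t p \<beta> \<and> subseq \<beta> \<alpha>) \<longleftrightarrow> p < run_len t \<alpha>"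
proof (induction \<alpha> arbitrary: t p)
  case Nil
  then show ?case by (auto simp: idx_run_def)
next
  case (Cons x xs)
  show ?case
  proof (cases "x = t")
    case False
    have "idx_run t p \<beta> \<and> subseq \<beta> (x # xs) \<longleftrightarrow> idx_run t p \<beta> \<and> subseq \<beta> xs" for \<beta>
      using False idx_run_Cons[of t p \<beta>] by (auto simp: subseq_Cons2_iff)
    moreover have "run_len t (x # xs) = run_len t xs"
      using False by (cases t; cases "case t of Neg j \<Rightarrow> j | _ \<Rightarrow> 0") auto
    ultimately show ?thesis using Cons.IH by simp
  next
    case True
    show ?thesis
    proof (cases p)
      case 0
      have "0 < run_len t (t # xs)" by (cases t; cases "case t of Neg j \<Rightarrow> j | _ \<Rightarrow> 0") auto
      then show ?thesis using True 0 by (auto simp: idx_run_0)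
    next
      case (Suc p')
      have "(\<exists>\<beta>. idx_run t p \<beta> \<and> subseq \<beta> (x # xs)) \<longleftrightarrow>
        (\<exists>s \<beta>'. is_succ t s \<and> idx_run s p' \<beta>' \<and> subseq (t # \<beta>') (x # xs))"
        unfolding Suc idx_run_Suc by blast
      also have "\<dots> \<longleftrightarrow> (\<exists>s. is_succ t s \<and> (\<exists>\<beta>'. idx_run s p' \<beta>' \<and> subseq \<beta>' xs))"
        using True by simp
      also have "\<dots> \<longleftrightarrow> (\<exists>s. is_succ t s \<and> p' < run_len s xs)" using Cons.IH by simp
      also have "\<dots> \<longleftrightarrow> p < run_len t (x # xs)"
      proof (cases t)
        case (Neg k)
        then show ?thesis using True Suc by (cases k) (auto simp: is_succ_Neg)
      qed (use True Suc in \<open>auto simp: is_succ_Pos\<close>)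
      finally show ?thesis .
    qed
  qed
qed

lemma run_len_eq_0_iff: "run_len t \<alpha> = 0 \<longleftrightarrow> t \<notin> set \<alpha>"
  using run_subseq_iff_run_len[of t 0 \<alpha>] by (auto simp: idx_run_0 subseq_singleton_left)

lemma consecutions_run_len: "consecutions t \<alpha> = int (run_len t \<alpha>) - 1"
proof (cases "t \<in> set \<alpha>")
  case True
  then have pos: "run_len t \<alpha> > 0" using run_len_eq_0_iff by auto
  have "(THE p. p < run_len t \<alpha> \<and> \<not> Suc p < run_len t \<alpha>) = run_len t \<alpha> - 1"
    by (rule the_equality) (use pos in auto)
  then show ?thesis unfolding consecutions_def run_subseq_iff_run_len using True pos by auto
next
  case False
  then show ?thesis unfolding consecutions_def using run_len_eq_0_iff by auto
qed

lemma subseq_rev: "subseq \<beta> \<alpha> \<Longrightarrow> subseq (rev \<beta>) (rev \<alpha>)"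
  by (induction rule: list_emb.induct)
    (auto intro: list_emb_append_mono list_emb_append2 subseq_rev_drop_many)

lemma inversions_rev: "inversions t \<alpha> = consecutions t (rev \<alpha>)"
proof -
  have "subseq (rev \<beta>) \<alpha> \<longleftrightarrow> subseq \<beta> (rev \<alpha>)" for \<beta>
    using subseq_rev[of "rev \<beta>" \<alpha>] subseq_rev[of \<beta> "rev \<alpha>"] by auto
  then show ?thesis unfolding inversions_def consecutions_def by simp
qed

text \<open>The greedy run in a concatenation continues in the second tuple where it stopped in the first.
  This is why the numbers \<open>c\<^sub>t(\<sigma>, \<sigma>2)\<close> locate the wire that is reached after passing through \<open>\<sigma>2\<close>.\<close>
lemma run_len_Pos_append: "run_len (Pos k) (\<alpha> @ \<beta>) = run_len (Pos k) \<alpha> + run_len (Pos (k + run_len (Pos k) \<alpha>)) \<beta>"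
  by (induction \<alpha> arbitrary: k) auto

lemma set_of_run_len_Pos: "j < run_len (Pos k) \<alpha> \<Longrightarrow> Pos (k + j) \<in> set \<alpha>"
proof (induction \<alpha> arbitrary: k j)
  case (Cons x xs)
  then show ?case by (cases j) (force split: if_splits)+
qed simp

lemma subseq_of_run_len_Pos:
  "Suc j < run_len (Pos k) \<alpha> \<Longrightarrow> subseq [Pos (k + j), Pos (Suc (k + j))] \<alpha>"
proof (induction \<alpha> arbitrary: k j)
  case (Cons x xs)
  show ?case
  proof (cases "x = Pos k")
    case True
    show ?thesis
    proof (cases j)
      case 0
      then show ?thesis using True Cons.prems
        by (simp add: subseq_singleton_left) (metis run_len_eq_0_iff neq0_conv)
    next
      case (Suc i)
      then have "subseq [Pos (k + j), Pos (Suc (k + j))] xs"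
        using True Cons.prems Cons.IH[of i "Suc k"] by simp
      then show ?thesis by (rule list_emb_Cons)
    qed
  next
    case False
    then have "subseq [Pos (k + j), Pos (Suc (k + j))] xs"
      using Cons.prems Cons.IH[of j k] by simp
    then show ?thesis by (rule list_emb_Cons)
  qed
qed simp

text \<open>Where a run in a tuple without repetitions ends, the next index does not come later: it would
  prolong the run, because the last letter of the run occurs only once.\<close>
lemma not_subseq_of_run_len_Pos:
  "distinct \<alpha> \<Longrightarrow> run_len (Pos k) \<alpha> = Suc j \<Longrightarrow> \<not> subseq [Pos (k + j), Pos (Suc (k + j))] \<alpha>"
proof (induction \<alpha> arbitrary: k j)
  case (Cons x xs)
  show ?case
  proof (cases "x = Pos k")
    case True
    then have c: "run_len (Pos (Suc k)) xs = j" using Cons.prems by simp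
    show ?thesis
    proof (cases j)
      case 0
      then show ?thesis using True c run_len_eq_0_iff by (simp add: subseq_singleton_left)
    next
      case (Suc i)
      then show ?thesis using True c Cons.prems Cons.IH[of "Suc k" i]
        by (simp add: subseq_Cons2_iff)
    qed
  next
    case False
    have "run_len (Pos k) xs = Suc j" using False Cons.prems by simp
    moreover from this have "Pos (k + j) \<in> set xs" by (simp add: set_of_run_len_Pos)
    ultimately show ?thesis using Cons.prems Cons.IH[of k j] by (auto simp: subseq_Cons2_iff)
  qed
qed simp

section \<open>The successor infix property\<close>

lemma SIP_infix:
  assumes "SIP (\<alpha> @ \<beta> @ \<gamma>)" shows "SIP \<beta>"
  unfolding SIP_def
proof (intro allI impI)
  fix a b assume ab: "a < b \<and> b < length \<beta> \<and> \<beta> ! a = \<beta> ! b"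
  let ?l = "length \<alpha>"
  have n: "(\<alpha> @ \<beta> @ \<gamma>) ! (?l + i) = \<beta> ! i" if "i < length \<beta>" for i
    using that by (simp add: nth_append)
  obtain c where c: "?l + a < c" "c < ?l + b" "is_succ (\<beta> ! a) ((\<alpha> @ \<beta> @ \<gamma>) ! c)"
    using assms[unfolded SIP_def, rule_format, of "?l + a" "?l + b"] ab n[of a] n[of b] by auto
  define d where "d = c - ?l"
  have "c = ?l + d" "d < length \<beta>" using c ab by (auto simp: d_def)
  then show "\<exists>c. a < c \<and> c < b \<and> is_succ (\<beta> ! a) (\<beta> ! c)"
    using c n[of d] by (intro exI[of _ d]) auto
qed

lemma SIP_between:
  assumes "SIP (t # \<gamma> @ t # \<delta>)" shows "\<exists>s \<in> set \<gamma>. is_succ t s"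
proof -
  from assms[unfolded SIP_def, rule_format, of 0 "Suc (length \<gamma>)"]
  obtain c where "0 < c" "c < Suc (length \<gamma>)" "is_succ t ((t # \<gamma> @ t # \<delta>) ! c)"
    by (auto simp: nth_append)
  then show ?thesis by (cases c) (auto simp: nth_append)
qed

lemma SIP_rev: assumes "SIP \<alpha>" shows "SIP (rev \<alpha>)"
  unfolding SIP_def
proof (intro allI impI)
  fix a b assume ab: "a < b \<and> b < length (rev \<alpha>) \<and> rev \<alpha> ! a = rev \<alpha> ! b"
  let ?l = "length \<alpha>"
  have "?l - Suc b < ?l - Suc a \<and> ?l - Suc a < ?l" using ab by auto
  then have "\<exists>c. ?l - Suc b < c \<and> c < ?l - Suc a \<and> is_succ (\<alpha> ! (?l - Suc b)) (\<alpha> ! c)"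
    using assms[unfolded SIP_def, rule_format, of "?l - Suc b" "?l - Suc a"] ab
    by (auto simp: rev_nth)
  then obtain c where "?l - Suc b < c" "c < ?l - Suc a" "is_succ (\<alpha> ! (?l - Suc b)) (\<alpha> ! c)"
    by auto
  then show "\<exists>c. a < c \<and> c < b \<and> is_succ (rev \<alpha> ! a) (rev \<alpha> ! c)"
    using ab by (intro exI[of _ "?l - Suc c"]) (auto simp: rev_nth)
qed

lemma SIP_fresh_Cons: assumes "SIP \<alpha>" "t \<notin> set \<alpha>" shows "SIP (t # \<alpha>)"
  unfolding SIP_def
proof (intro allI impI)
  fix a b assume ab: "a < b \<and> b < length (t # \<alpha>) \<and> (t # \<alpha>) ! a = (t # \<alpha>) ! b"
  then obtain a' b' where "a = Suc a'" "b = Suc b'"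
    using assms(2) by (cases a; cases b) auto
  with ab assms(1) obtain c where "a' < c" "c < b'" "is_succ (\<alpha> ! a') (\<alpha> ! c)"
    unfolding SIP_def by auto
  then show "\<exists>c. a < c \<and> c < b \<and> is_succ ((t # \<alpha>) ! a) ((t # \<alpha>) ! c)"
    using \<open>a = Suc a'\<close> \<open>b = Suc b'\<close> by (intro exI[of _ "Suc c"]) auto
qed

text \<open>This is how an index missing from \<open>\<tau>\<close> keeps its predecessor out of \<open>\<tau>2\<close>.\<close>
lemma SIP_later_needs_succ:
  assumes "SIP (\<alpha> @ \<beta>)" "t \<in> set \<alpha>" "t \<in> set \<beta>"
  shows "\<exists>s \<in> set \<alpha> \<union> set \<beta>. is_succ t s"
proof -
  obtain a1 a2 b1 b2 where "\<alpha> = a1 @ t # a2" "\<beta> = b1 @ t # b2"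
    using assms by (metis split_list)
  then have "SIP (t # (a2 @ b1) @ t # b2)"
    using assms(1) SIP_infix[of a1 "t # (a2 @ b1) @ t # b2" "[]"] by simp
  from SIP_between[OF this] show ?thesis using \<open>\<alpha> = _\<close> \<open>\<beta> = _\<close> by auto
qed


section \<open>Block vectors as wires\<close>

text \<open>Wire \<open>k\<close> is block row \<open>m - k + 1\<close> counted from 1. With this numbering, running from the bottom block
  to the top block, the index \<open>\<plusminus>i\<close> acts on the wires \<open>i\<close> and \<open>i + 1\<close>.\<close>
definition wire :: "nat \<Rightarrow> nat \<Rightarrow> complex vec \<Rightarrow> nat \<Rightarrow> complex vec" where
  "wire m n x k = vec n (\<lambda>r. x $ ((m - k) * n + r))"

definition of_wires :: "nat \<Rightarrow> nat \<Rightarrow> (nat \<Rightarrow> complex vec) \<Rightarrow> complex vec" where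
  "of_wires m n u = vec (m * n) (\<lambda>j. u (m - j div n) $ (j mod n))"

lemma wire_carrier [simp, intro]: "wire m n x k \<in> carrier_vec n"
  by (simp add: wire_def)

lemma of_wires_carrier [simp, intro]: "of_wires m n u \<in> carrier_vec (m * n)"
  by (simp add: of_wires_def)

lemma wire_index_less:
  fixes m n k r :: nat
  assumes "1 \<le> k" "k \<le> m" "r < n" shows "(m - k) * n + r < m * n"
proof -
  have "(m - k) * n + r < Suc (m - k) * n" using assms by simp
  also have "\<dots> \<le> m * n" using assms by (intro mult_right_mono) auto
  finally show ?thesis .
qed

lemma wire_of_wires:
  assumes "1 \<le> k" "k \<le> m" "u k \<in> carrier_vec n"
  shows "wire m n (of_wires m n u) k = u k"
proof (rule eq_vecI)
  fix r assume "r < dim_vec (u k)"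
  then have r: "r < n" using assms by simp
  have "((m - k) * n + r) div n = m - k" "((m - k) * n + r) mod n = r" using r by auto
  then show "wire m n (of_wires m n u) k $ r = u k $ r"
    using wire_index_less[OF assms(1,2) r] r assms by (simp add: wire_def of_wires_def)
qed (use assms in \<open>simp add: wire_def\<close>)

lemma wire_eqI:
  assumes x: "x \<in> carrier_vec (m * n)" and y: "y \<in> carrier_vec (m * n)"
    and eq: "\<And>k. 1 \<le> k \<Longrightarrow> k \<le> m \<Longrightarrow> wire m n x k = wire m n y k"
  shows "x = y"
proof (rule eq_vecI)
  fix j assume "j < dim_vec y"
  then have j: "j < m * n" using y by simp
  then have n: "0 < n" by (cases n) auto
  define k where "k = m - j div n"
  have d: "j div n < m" using j n by (simp add: div_less_iff_less_mult)
  have k: "1 \<le> k" "k \<le> m" "m - k = j div n" using d by (auto simp: k_def)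
  have "wire m n x k $ (j mod n) = wire m n y k $ (j mod n)" using eq k by simp
  then show "x $ j = y $ j" using n k by (simp add: wire_def)
qed (use x y in simp)

lemma wire_smult:
  assumes "x \<in> carrier_vec (m * n)" "1 \<le> k" "k \<le> m"
  shows "wire m n (a \<cdot>\<^sub>v x) k = a \<cdot>\<^sub>v wire m n x k"
  using assms wire_index_less[of k m _ n] by (intro eq_vecI) (auto simp: wire_def)

lemma wire_zero: "1 \<le> k \<Longrightarrow> k \<le> m \<Longrightarrow> wire m n (0\<^sub>v (m * n)) k = 0\<^sub>v n"
  using wire_index_less[of k m _ n] by (intro eq_vecI) (auto simp: wire_def)

section \<open>The action of an elementary matrix\<close>

lemma two_blocks_mult_vec:
  assumes "C \<in> carrier_mat a a" "D \<in> carrier_mat b b" "x \<in> carrier_vec (a + b)"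
  shows "four_block_mat C (0\<^sub>m a b) (0\<^sub>m b a) D *\<^sub>v x
    = (C *\<^sub>v vec_first x a) @\<^sub>v (D *\<^sub>v vec_last x b)"
proof -
  have "four_block_mat C (0\<^sub>m a b) (0\<^sub>m b a) D *\<^sub>v (vec_first x a @\<^sub>v vec_last x b)
    = (C *\<^sub>v vec_first x a + 0\<^sub>m a b *\<^sub>v vec_last x b) @\<^sub>v
      (0\<^sub>m b a *\<^sub>v vec_first x a + D *\<^sub>v vec_last x b)"
    by (rule four_block_mat_mult_vec) (use assms in auto)
  moreover have "0\<^sub>m a b *\<^sub>v vec_last x b = 0\<^sub>v a" "0\<^sub>m b a *\<^sub>v vec_first x a = 0\<^sub>v b"
    by (auto intro!: eq_vecI simp: scalar_prod_def)
  ultimately show ?thesis using assms by simp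
qed

lemma diag_block_mat_2:
  "C \<in> carrier_mat a a \<Longrightarrow> D \<in> carrier_mat b b \<Longrightarrow>
   diag_block_mat [C, D] = four_block_mat C (0\<^sub>m a b) (0\<^sub>m b a) D"
  by (subst diag_block_mat.simps(2), subst diag_block_mat_singleton) (auto simp: Let_def)

lemma elem_index_cases:
  assumes "t \<in> Pos ` {0..<m} \<union> Neg ` {1..m}"
  obtains "t = Pos 0" "0 < m" | i where "t = Pos i" "1 \<le> i" "i < m"
    | "t = Neg m" "0 < m" | i where "t = Neg i" "1 \<le> i" "i < m"
proof (cases t)
  case (Pos i)
  then have "i < m" using assms by auto
  then show thesis using Pos that(1,2) by (cases "i = 0") auto
next
  case (Neg i)
  then have "1 \<le> i" "i \<le> m" using assms by auto
  then show thesis using Neg that(3,4) by (cases "i = m") auto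
qed

lemma elem_mat_carrier [simp]:
  assumes "X \<in> carrier_mat n n" "t \<in> Pos ` {0..<m} \<union> Neg ` {1..m}"
  shows "elem_mat m n t X \<in> carrier_mat (m * n) (m * n)"
proof -
  have inner: "(m - i - 1) * n + (n + n + (i - 1) * n) = m * n" if i: "1 \<le> i" "i < m" for i
  proof -
    obtain j where "i = Suc j" using i by (cases i) auto
    moreover obtain d where "m = Suc (i + d)" using i less_iff_Suc_add by auto
    ultimately show ?thesis by (simp add: algebra_simps)
  qed
  have outer: "(m - 1) * n + n = m * n" "n + (m - 1) * n = m * n" if "0 < m"
    using that by (cases m; simp)+
  show ?thesis
    using assms(2)
  proof (cases rule: elem_index_cases)
    case 1
    then have "elem_mat m n t X = diag_block_mat [1\<^sub>m ((m - 1) * n), X]" by simp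
    then show ?thesis using assms(1) outer(1)[OF 1(2)]
      by (intro carrier_matI) (simp_all only: dim_diag_block_mat, auto)
  next
    case (2 i)
    then have "elem_mat m n t X = diag_block_mat [1\<^sub>m ((m - i - 1) * n),
      four_block_mat X (1\<^sub>m n) (1\<^sub>m n) (0\<^sub>m n n), 1\<^sub>m ((i - 1) * n)]" by simp
    then show ?thesis using assms(1) inner[OF 2(2,3)]
      by (intro carrier_matI) (simp_all only: dim_diag_block_mat, auto)
  next
    case 3
    then have "elem_mat m n t X = diag_block_mat [X, 1\<^sub>m ((m - 1) * n)]" by simp
    then show ?thesis using assms(1) outer(2)[OF 3(2)]
      by (intro carrier_matI) (simp_all only: dim_diag_block_mat, auto)
  next
    case (4 i)
    then have "elem_mat m n t X = diag_block_mat [1\<^sub>m ((m - i - 1) * n),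
      four_block_mat (0\<^sub>m n n) (1\<^sub>m n) (1\<^sub>m n) X, 1\<^sub>m ((i - 1) * n)]" by simp
    then show ?thesis using assms(1) inner[OF 4(2,3)]
      by (intro carrier_matI) (simp_all only: dim_diag_block_mat, auto)
  qed
qed

text \<open>All elementary matrices of inner indices have this shape; only the \<open>2n \<times> 2n\<close> block in the middle
  depends on the sign.\<close>
lemma wire_mult_inner:
  assumes x: "x \<in> carrier_vec (m * n)" and i: "1 \<le> i" "i < m"
    and B: "B \<in> carrier_mat (n + n) (n + n)"
    and Bx: "B *\<^sub>v (wire m n x (Suc i) @\<^sub>v wire m n x i) = p @\<^sub>v q"
    and p: "p \<in> carrier_vec n" and q: "q \<in> carrier_vec n"
    and k: "1 \<le> k" "k \<le> m"
  shows "wire m n (diag_block_mat [1\<^sub>m ((m - i - 1) * n), B, 1\<^sub>m ((i - 1) * n)] *\<^sub>v x) k =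
    (if k = Suc i then p else if k = i then q else wire m n x k)"
proof -
  define a where "a = (m - i - 1) * n"
  define b where "b = (i - 1) * n"
  obtain j where j: "i = Suc j" using i by (cases i) auto
  obtain d where d: "m = Suc (i + d)" using i less_iff_Suc_add by auto
  have ab: "m * n = a + ((n + n) + b)"
    unfolding a_def b_def j d by (simp add: algebra_simps)
  let ?D = "four_block_mat B (0\<^sub>m (n + n) b) (0\<^sub>m b (n + n)) (1\<^sub>m b)"
  have D: "?D \<in> carrier_mat (n + n + b) (n + n + b)" using B by auto
  have M: "diag_block_mat [1\<^sub>m a, B, 1\<^sub>m b]
    = four_block_mat (1\<^sub>m a) (0\<^sub>m a (n + n + b)) (0\<^sub>m (n + n + b) a) ?D"
    using B by (subst diag_block_mat.simps(2), subst diag_block_mat_2) (auto simp: Let_def)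
  have x': "x \<in> carrier_vec (a + (n + n + b))" using x ab by simp
  define y where "y = vec_last x (n + n + b)"
  have y: "y \<in> carrier_vec (n + n + b)" by (simp add: y_def)
  have "vec_first y (n + n) = wire m n x (Suc i) @\<^sub>v wire m n x i"
  proof (rule eq_vecI)
    fix r assume "r < dim_vec (wire m n x (Suc i) @\<^sub>v wire m n x i)"
    then have r: "r < n + n" by (simp add: wire_def)
    have 1: "(m - Suc i) * n = a" "(m - i) * n = a + n" unfolding a_def d by auto
    have "vec_first y (n + n) $ r = x $ (a + r)"
      using r x' by (simp add: y_def vec_first_def vec_last_def)
    then show "vec_first y (n + n) $ r = (wire m n x (Suc i) @\<^sub>v wire m n x i) $ r"
      using r 1 by (auto simp: wire_def)
  qed (simp add: wire_def)
  then have Dy: "?D *\<^sub>v y = (p @\<^sub>v q) @\<^sub>v vec_last y b"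
    using two_blocks_mult_vec[OF B, of "1\<^sub>m b" b y] y Bx by simp
  have Mx: "diag_block_mat [1\<^sub>m a, B, 1\<^sub>m b] *\<^sub>v x = vec_first x a @\<^sub>v ((p @\<^sub>v q) @\<^sub>v vec_last y b)"
    unfolding M using two_blocks_mult_vec[OF _ D x', of "1\<^sub>m a"] Dy by (simp add: y_def)
  have idx: "(vec_first x a @\<^sub>v ((p @\<^sub>v q) @\<^sub>v vec_last y b)) $ s =
     (if s < a then x $ s else if s < a + n then p $ (s - a)
      else if s < a + n + n then q $ (s - a - n) else x $ s)" if "s < m * n" for s
  proof -
    have "vec_last y b $ (s - a - (n + n)) = x $ s" if "\<not> s < a + n + n"
      using that \<open>s < m * n\<close> ab x'
      by (auto simp: vec_last_def y_def intro!: arg_cong[of _ _ "vec_index x"])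
    then show ?thesis using that ab p q by (auto simp: vec_first_def diff_diff_left add.assoc)
  qed
  show ?thesis
  proof (rule eq_vecI)
    show "dim_vec (wire m n (diag_block_mat [1\<^sub>m ((m - i - 1) * n), B, 1\<^sub>m ((i - 1) * n)] *\<^sub>v x) k) =
      dim_vec (if k = Suc i then p else if k = i then q else wire m n x k)"
      using p q by (simp add: wire_def)
    fix r assume "r < dim_vec (if k = Suc i then p else if k = i then q else wire m n x k)"
    then have r: "r < n" using p q by (auto simp: wire_def split: if_splits)
    define s where "s = (m - k) * n + r"
    have s: "s < m * n" using wire_index_less[OF k r] by (simp add: s_def)
    have "wire m n (diag_block_mat [1\<^sub>m a, B, 1\<^sub>m b] *\<^sub>v x) k $ r =
      (if s < a then x $ s else if s < a + n then p $ (s - a)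
      else if s < a + n + n then q $ (s - a - n) else x $ s)"
      unfolding Mx using idx[OF s] r by (simp add: wire_def s_def)
    moreover consider "k > Suc i" | "k = Suc i" | "k = i" | "k < i" by linarith
    then have "(if s < a then x $ s else if s < a + n then p $ (s - a)
      else if s < a + n + n then q $ (s - a - n) else x $ s)
      = (if k = Suc i then p else if k = i then q else wire m n x k) $ r"
    proof cases
      case 1
      have "s < Suc (m - k) * n" using r by (simp add: s_def)
      also have "\<dots> \<le> a" unfolding a_def using 1 k by (intro mult_right_mono) auto
      finally show ?thesis using 1 r by (simp add: wire_def s_def)
    next
      case 2
      then have "s = a + r" by (simp add: s_def a_def)
      then show ?thesis using 2 r by simp
    next
      case 3
      then have "s = a + n + r" unfolding s_def a_def d by simp
      then show ?thesis using 3 r by simp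
    next
      case 4
      have "a + n + n = (m - i + 1) * n" unfolding a_def d by simp
      also have "\<dots> \<le> (m - k) * n" using 4 i by (intro mult_right_mono) auto
      also have "\<dots> \<le> s" by (simp add: s_def)
      finally show ?thesis using 4 r by (simp add: wire_def s_def)
    qed
    ultimately show "wire m n (diag_block_mat [1\<^sub>m ((m - i - 1) * n), B, 1\<^sub>m ((i - 1) * n)] *\<^sub>v x) k $ r =
      (if k = Suc i then p else if k = i then q else wire m n x k) $ r"
      by (simp add: a_def b_def)
  qed
qed

lemma mult_one_zero_vec:
  assumes "u \<in> carrier_vec n"
  shows "1\<^sub>m n *\<^sub>v u = (u :: complex vec)" "0\<^sub>m n n *\<^sub>v u = 0\<^sub>v n"
  using assms by (auto intro!: eq_vecI simp: scalar_prod_def)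

lemma wire_elem_Pos:
  assumes x: "x \<in> carrier_vec (m * n)" and X: "X \<in> carrier_mat n n"
    and i: "1 \<le> i" "i < m" and k: "1 \<le> k" "k \<le> m"
  shows "wire m n (elem_mat m n (Pos i) X *\<^sub>v x) k =
    (if k = Suc i then X *\<^sub>v wire m n x (Suc i) + wire m n x i
     else if k = i then wire m n x (Suc i) else wire m n x k)"
proof -
  let ?B = "four_block_mat X (1\<^sub>m n) (1\<^sub>m n) (0\<^sub>m n n)"
  have "?B *\<^sub>v (wire m n x (Suc i) @\<^sub>v wire m n x i) =
    (X *\<^sub>v wire m n x (Suc i) + wire m n x i) @\<^sub>v wire m n x (Suc i)"
    using X by (subst four_block_mat_mult_vec) (auto simp: mult_one_zero_vec)
  from wire_mult_inner[OF x i _ this _ _ k] show ?thesis using X i by simp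
qed

lemma wire_elem_Neg:
  assumes x: "x \<in> carrier_vec (m * n)" and X: "X \<in> carrier_mat n n"
    and i: "1 \<le> i" "i < m" and k: "1 \<le> k" "k \<le> m"
  shows "wire m n (elem_mat m n (Neg i) X *\<^sub>v x) k =
    (if k = Suc i then wire m n x i
     else if k = i then wire m n x (Suc i) + X *\<^sub>v wire m n x i else wire m n x k)"
proof -
  let ?B = "four_block_mat (0\<^sub>m n n) (1\<^sub>m n) (1\<^sub>m n) X"
  have "?B *\<^sub>v (wire m n x (Suc i) @\<^sub>v wire m n x i) =
    wire m n x i @\<^sub>v (wire m n x (Suc i) + X *\<^sub>v wire m n x i)"
    using X by (subst four_block_mat_mult_vec) (auto simp: mult_one_zero_vec)
  from wire_mult_inner[OF x i _ this _ _ k] show ?thesis using X i by simp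
qed

lemma wire_elem_Pos_0:
  assumes x: "x \<in> carrier_vec (m * n)" and X: "X \<in> carrier_mat n n"
    and k: "1 \<le> k" "k \<le> m"
  shows "wire m n (elem_mat m n (Pos 0) X *\<^sub>v x) k =
    (if k = 1 then X *\<^sub>v wire m n x 1 else wire m n x k)"
proof -
  define a where "a = (m - 1) * n"
  have mn: "m * n = a + n" using k by (cases m) (auto simp: a_def)
  have Mx: "elem_mat m n (Pos 0) X *\<^sub>v x = vec_first x a @\<^sub>v (X *\<^sub>v vec_last x n)"
    using two_blocks_mult_vec[of "1\<^sub>m a" a X n x] x X mn diag_block_mat_2[of "1\<^sub>m a" a X n]
    by (simp add: a_def del: diag_block_mat.simps)
  have last: "vec_last x n = wire m n x 1"
    using x mn by (intro eq_vecI) (auto simp: vec_last_def wire_def a_def)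
  show ?thesis
  proof (cases "k = 1")
    case True
    then show ?thesis unfolding Mx last using X
      by (intro eq_vecI) (auto simp: wire_def vec_first_def a_def)
  next
    case False
    have "(m - k) * n + r < a" if "r < n" for r
    proof -
      have "(m - k) * n + r < Suc (m - k) * n" using that by simp
      also have "\<dots> \<le> a" unfolding a_def using False k by (intro mult_right_mono) auto
      finally show ?thesis .
    qed
    then show ?thesis unfolding Mx using X False
      by (intro eq_vecI) (auto simp: wire_def vec_first_def trans_less_add1)
  qed
qed

lemma wire_elem_Neg_m:
  assumes x: "x \<in> carrier_vec (m * n)" and X: "X \<in> carrier_mat n n"
    and k: "1 \<le> k" "k \<le> m"
  shows "wire m n (elem_mat m n (Neg m) X *\<^sub>v x) k =
    (if k = m then X *\<^sub>v wire m n x m else wire m n x k)"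
proof -
  define a where "a = (m - 1) * n"
  have mn: "m * n = n + a" using k by (cases m) (auto simp: a_def)
  have Mx: "elem_mat m n (Neg m) X *\<^sub>v x = (X *\<^sub>v vec_first x n) @\<^sub>v vec_last x a"
    using two_blocks_mult_vec[of X n "1\<^sub>m a" a x] x X mn diag_block_mat_2[of X n "1\<^sub>m a" a]
    by (simp add: a_def del: diag_block_mat.simps)
  have first: "vec_first x n = wire m n x m"
    by (intro eq_vecI) (auto simp: vec_first_def wire_def)
  show ?thesis
  proof (cases "k = m")
    case True
    then show ?thesis unfolding Mx first using X
      by (intro eq_vecI) (auto simp: wire_def)
  next
    case False
    obtain d where d: "m - k = Suc d" using False k by (cases "m - k") auto
    have "d * n + r < a" if "r < n" for r
      using wire_index_less[OF k that] mn d by simp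
    then show ?thesis unfolding Mx using X False x mn d
      by (intro eq_vecI) (auto simp: wire_def vec_last_def add.assoc)
  qed
qed


text \<open>Up to the section on transposition, elementary matrices are used only through their action on
  wires.\<close>
declare elem_mat.simps [simp del] fiedler_mat.simps [simp del] diag_block_mat.simps [simp del]

section \<open>Inverses of elementary products\<close>

lemma mat_inv_invertible:
  assumes B: "B \<in> carrier_mat n n" and inv: "invertible_mat B"
  shows "mat_inv B \<in> carrier_mat n n" "B * mat_inv B = 1\<^sub>m n" "mat_inv B * B = 1\<^sub>m n"
proof -
  obtain C where C: "B * C = 1\<^sub>m n" "C * B = 1\<^sub>m (dim_row C)"
    using B inv unfolding invertible_mat_def inverts_mat_def by auto
  have "dim_col C = n" "dim_row C = n"
    using arg_cong[OF C(1), of dim_col] arg_cong[OF C(2), of dim_col] B by auto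
  then have "B \<in> Units (ring_mat TYPE(complex) n ())"
    using B C unfolding Units_def by (auto simp: ring_mat_simps intro!: bexI[of _ C])
  then obtain D where D: "mat_inverse B = Some D"
    using mat_inverse(1)[OF B, of "()"] by (cases "mat_inverse B") auto
  from mat_inverse(2)[OF B D] D
  show "mat_inv B \<in> carrier_mat n n" "B * mat_inv B = 1\<^sub>m n" "mat_inv B * B = 1\<^sub>m n" by auto
qed

lemma mat_eq_of_mult_vec:
  assumes B: "(B :: complex mat) \<in> carrier_mat d e" and C: "C \<in> carrier_mat d e"
    and eq: "\<And>x. x \<in> carrier_vec e \<Longrightarrow> B *\<^sub>v x = C *\<^sub>v x"
  shows "B = C"
proof (rule eq_matI)
  fix i j assume "i < dim_row C" "j < dim_col C"
  then have ij: "i < d" "j < e" using C by auto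
  have "(B *\<^sub>v unit_vec e j) $ i = (C *\<^sub>v unit_vec e j) $ i" using eq by simp
  then show "B $$ (i, j) = C $$ (i, j)" using B C ij by simp
qed (use B C in auto)

lemma mat_inv_eqI:
  assumes B: "B \<in> carrier_mat d d" and C: "C \<in> carrier_mat d d"
    and BC: "B * C = 1\<^sub>m d" and CB: "C * B = 1\<^sub>m d"
  shows "mat_inv B = C"
proof -
  have "invertible_mat B"
    unfolding invertible_mat_def inverts_mat_def using B C BC CB by (auto intro!: exI[of _ C])
  note inv = mat_inv_invertible[OF B this]
  have "mat_inv B = mat_inv B * (B * C)" using inv(1) BC by simp
  also have "\<dots> = (mat_inv B * B) * C" using B C inv(1) by (simp add: assoc_mult_mat[of _ d d _ d _ d])
  finally show ?thesis using inv(3) C by simp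
qed

text \<open>Invertibility in a fixed size, in a form that does not mention the dimensions of the inverse.\<close>
definition has_inverse :: "nat \<Rightarrow> complex mat \<Rightarrow> bool" where
  "has_inverse d B \<longleftrightarrow> B \<in> carrier_mat d d \<and> (\<exists>C \<in> carrier_mat d d. B * C = 1\<^sub>m d \<and> C * B = 1\<^sub>m d)"

lemma has_inverse_one: "has_inverse d (1\<^sub>m d)"
  unfolding has_inverse_def by (auto intro!: bexI[of _ "1\<^sub>m d"])

lemma has_inverse_mult:
  assumes "has_inverse d B" "has_inverse d C" shows "has_inverse d (B * C)"
proof -
  obtain B' C' where B: "B \<in> carrier_mat d d" "B' \<in> carrier_mat d d" "B * B' = 1\<^sub>m d" "B' * B = 1\<^sub>m d"
    and C: "C \<in> carrier_mat d d" "C' \<in> carrier_mat d d" "C * C' = 1\<^sub>m d" "C' * C = 1\<^sub>m d"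
    using assms unfolding has_inverse_def by auto
  have "C * (C' * B') = B'" using B C assoc_mult_mat[of C d d C' d B' d] by simp
  then have 1: "(B * C) * (C' * B') = 1\<^sub>m d"
    using B C assoc_mult_mat[of B d d C d "C' * B'" d] by simp
  have "B' * (B * C) = C" using B C assoc_mult_mat[of B' d d B d C d] by simp
  then have "(C' * B') * (B * C) = 1\<^sub>m d"
    using B C assoc_mult_mat[of C' d d B' d "B * C" d] by simp
  moreover have "B * C \<in> carrier_mat d d" "C' * B' \<in> carrier_mat d d" using B C by auto
  ultimately show ?thesis unfolding has_inverse_def using 1 by blast
qed

lemma has_inverse_mult_vec_eq_0:
  assumes "has_inverse d B" "x \<in> carrier_vec d" shows "B *\<^sub>v x = 0\<^sub>v d \<longleftrightarrow> x = 0\<^sub>v d"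
proof
  obtain C where C: "B \<in> carrier_mat d d" "C \<in> carrier_mat d d" "C * B = 1\<^sub>m d"
    using assms(1) unfolding has_inverse_def by auto
  assume "B *\<^sub>v x = 0\<^sub>v d"
  then have "(C * B) *\<^sub>v x = 0\<^sub>v d" using C assms(2) assoc_mult_mat_vec[of C d d B d x] by auto
  then show "x = 0\<^sub>v d" unfolding C(3) using assms(2) by simp
next
  assume "x = 0\<^sub>v d" then show "B *\<^sub>v x = 0\<^sub>v d" using assms(1) unfolding has_inverse_def by auto
qed

lemma has_inverse_mult_vec_surj:
  assumes "has_inverse d B" "y \<in> carrier_vec d" shows "\<exists>x \<in> carrier_vec d. B *\<^sub>v x = y"
proof -
  obtain C where C: "B \<in> carrier_mat d d" "C \<in> carrier_mat d d" "B * C = 1\<^sub>m d"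
    using assms(1) unfolding has_inverse_def by auto
  then have "B *\<^sub>v (C *\<^sub>v y) = y"
    using assms(2) assoc_mult_mat_vec[of B d d C d y] by auto
  then show ?thesis using C assms(2) by (intro bexI[of _ "C *\<^sub>v y"]) auto
qed

lemma vec_cancel:
  assumes "u \<in> carrier_vec n" "v \<in> carrier_vec n" shows "u + (v + - u) = (v :: complex vec)"
    "(u + v) + - u = (v :: complex vec)" "v + (u + - v) = (u :: complex vec)"
    "- u + (u + v) = (v :: complex vec)"
  using assms by (auto intro!: eq_vecI)

lemma uminus_mult_vec:
  "M \<in> carrier_mat n n \<Longrightarrow> v \<in> carrier_vec n \<Longrightarrow> (- M) *\<^sub>v v = - (M *\<^sub>v v)"
  for M :: "complex mat"
  by (intro eq_vecI) (auto simp: scalar_prod_def sum_negf)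

text \<open>\<open>M\<^bsub>-i\<^esub>(-X)\<close> undoes \<open>M\<^sub>i(X)\<close> for every \<open>X\<close>. This is why only the indices \<open>\<plusminus>0, \<plusminus>m\<close> require nonsingular
  matrices in an assignment.\<close>
lemma elem_mat_inverse_inner:
  assumes X: "X \<in> carrier_mat n n" and i: "1 \<le> i" "i < m"
  shows "elem_mat m n (Pos i) X * elem_mat m n (Neg i) (- X) = 1\<^sub>m (m * n)"
    and "elem_mat m n (Neg i) (- X) * elem_mat m n (Pos i) X = 1\<^sub>m (m * n)"
proof -
  let ?M = "elem_mat m n (Pos i) X" and ?N = "elem_mat m n (Neg i) (- X)"
  have c: "?M \<in> carrier_mat (m * n) (m * n)" "?N \<in> carrier_mat (m * n) (m * n)"
    using X i elem_mat_carrier[of X n "Pos i" m] elem_mat_carrier[of "- X" n "Neg i" m] by auto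
  have X': "- X \<in> carrier_mat n n" using X by simp
  have i': "1 \<le> Suc i" "Suc i \<le> m" "1 \<le> i" "i \<le> m" using i by auto
  show "?M * ?N = 1\<^sub>m (m * n)"
  proof (rule mat_eq_of_mult_vec)
    fix x :: "complex vec" assume x: "x \<in> carrier_vec (m * n)"
    have Nx: "?N *\<^sub>v x \<in> carrier_vec (m * n)" using c x by auto
    have "?M *\<^sub>v (?N *\<^sub>v x) = x"
    proof (rule wire_eqI)
      fix k assume k: "1 \<le> k" "k \<le> m"
      show "wire m n (?M *\<^sub>v (?N *\<^sub>v x)) k = wire m n x k"
        unfolding wire_elem_Pos[OF Nx X i k] wire_elem_Neg[OF x X' i k]
          wire_elem_Neg[OF x X' i i'(1,2)] wire_elem_Neg[OF x X' i i'(3,4)]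
        using X vec_cancel(1)[of "X *\<^sub>v wire m n x i" n "wire m n x (Suc i)"]
        by (auto simp: uminus_mult_vec)
    qed (use c x Nx in \<open>auto\<close>)
    then show "(?M * ?N) *\<^sub>v x = 1\<^sub>m (m * n) *\<^sub>v x"
      using c x by (simp add: assoc_mult_mat_vec[OF c x])
  qed (use c in \<open>auto\<close>)
  show "?N * ?M = 1\<^sub>m (m * n)"
  proof (rule mat_eq_of_mult_vec)
    fix x :: "complex vec" assume x: "x \<in> carrier_vec (m * n)"
    have Mx: "?M *\<^sub>v x \<in> carrier_vec (m * n)" using c x by auto
    have "?N *\<^sub>v (?M *\<^sub>v x) = x"
    proof (rule wire_eqI)
      fix k assume k: "1 \<le> k" "k \<le> m"
      show "wire m n (?N *\<^sub>v (?M *\<^sub>v x)) k = wire m n x k"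
        unfolding wire_elem_Neg[OF Mx X' i k] wire_elem_Pos[OF x X i k]
          wire_elem_Pos[OF x X i i'(1,2)] wire_elem_Pos[OF x X i i'(3,4)]
        using X vec_cancel(2)[of "X *\<^sub>v wire m n x (Suc i)" n "wire m n x i"]
        by (auto simp: uminus_mult_vec)
    qed (use c x Mx in \<open>auto\<close>)
    then show "(?N * ?M) *\<^sub>v x = 1\<^sub>m (m * n) *\<^sub>v x"
      using c x by (simp add: assoc_mult_mat_vec[OF c(2,1) x])
  qed (use c in \<open>auto\<close>)
qed

lemma elem_mat_inverse_boundary:
  assumes X: "X \<in> carrier_mat n n" and Y: "Y \<in> carrier_mat n n" and XY: "X * Y = 1\<^sub>m n"
    and t: "t = Pos 0 \<or> t = Neg m" and m: "1 \<le> m"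
  shows "elem_mat m n t X * elem_mat m n t Y = 1\<^sub>m (m * n)"
proof (rule mat_eq_of_mult_vec)
  have c: "elem_mat m n t X \<in> carrier_mat (m * n) (m * n)" "elem_mat m n t Y \<in> carrier_mat (m * n) (m * n)"
    using X Y t m elem_mat_carrier[of _ n t m] by auto
  then show "elem_mat m n t X * elem_mat m n t Y \<in> carrier_mat (m * n) (m * n)" by auto
  fix x :: "complex vec" assume x: "x \<in> carrier_vec (m * n)"
  have Yx: "elem_mat m n t Y *\<^sub>v x \<in> carrier_vec (m * n)" using c x by auto
  have 1: "X *\<^sub>v (Y *\<^sub>v u) = u" if "u \<in> carrier_vec n" for u
    using that by (simp add: assoc_mult_mat_vec[OF X Y, symmetric] XY)
  have "elem_mat m n t X *\<^sub>v (elem_mat m n t Y *\<^sub>v x) = x"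
  proof (rule wire_eqI)
    fix k assume k: "1 \<le> k" "k \<le> m"
    show "wire m n (elem_mat m n t X *\<^sub>v (elem_mat m n t Y *\<^sub>v x)) k = wire m n x k"
      using t
    proof
      assume t: "t = Pos 0"
      show ?thesis
        using wire_elem_Pos_0[OF Yx[unfolded t] X] wire_elem_Pos_0[OF x Y] k m 1
        unfolding t by simp
    next
      assume t: "t = Neg m"
      show ?thesis
        using wire_elem_Neg_m[OF Yx[unfolded t] X] wire_elem_Neg_m[OF x Y] k m 1
        unfolding t by simp
    qed
  qed (use c x in auto)
  then show "(elem_mat m n t X * elem_mat m n t Y) *\<^sub>v x = 1\<^sub>m (m * n) *\<^sub>v x"
    using c x by (simp add: assoc_mult_mat_vec[OF c x])
qed auto

lemma has_inverse_elem_mat: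
  assumes X: "X \<in> carrier_mat n n" and t: "t \<in> Pos ` {0..<m} \<union> Neg ` {1..m}"
    and inv: "t \<in> {Pos 0, Neg m} \<Longrightarrow> invertible_mat X"
  shows "has_inverse (m * n) (elem_mat m n t X)"
proof -
  have m: "1 \<le> m" using t by auto
  have c: "elem_mat m n t X \<in> carrier_mat (m * n) (m * n)" by (rule elem_mat_carrier[OF X t])
  consider "t \<in> {Pos 0, Neg m}" | i where "t = Pos i" "1 \<le> i" "i < m" | i where "t = Neg i" "1 \<le> i" "i < m"
    using t by fastforce
  then show ?thesis
  proof cases
    case 1
    note X' = mat_inv_invertible[OF X inv[OF 1]]
    have t': "t = Pos 0 \<or> t = Neg m" using 1 by auto
    show ?thesis unfolding has_inverse_def
      using c elem_mat_carrier[OF X'(1) t] elem_mat_inverse_boundary[OF X X'(1,2) t' m]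
        elem_mat_inverse_boundary[OF X'(1) X X'(3) t' m]
      by auto
  next
    case 2
    then show ?thesis unfolding has_inverse_def
      using c elem_mat_carrier[of "- X" n "Neg i" m] X elem_mat_inverse_inner[OF X 2(2,3)]
      by auto
  next
    case 3
    have "- (- X) = X" using X by auto
    then show ?thesis unfolding has_inverse_def
      using 3 c elem_mat_carrier[of "- X" n "Pos i" m] X elem_mat_inverse_inner[of "- X" n i m]
      by auto
  qed
qed

lemma mat_prod_Cons: "mat_prod d (B # Bs) = B * mat_prod d Bs"
  by (simp add: mat_prod_def)

lemma mat_prod_Nil [simp]: "mat_prod d [] = 1\<^sub>m d"
  by (simp add: mat_prod_def)

lemma mat_prod_carrier: "set Bs \<subseteq> carrier_mat d d \<Longrightarrow> mat_prod d Bs \<in> carrier_mat d d"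
  by (induction Bs) (auto simp: mat_prod_Cons)

lemma has_inverse_mat_prod: "(\<And>B. B \<in> set Bs \<Longrightarrow> has_inverse d B) \<Longrightarrow> has_inverse d (mat_prod d Bs)"
  by (induction Bs) (auto simp: mat_prod_Cons has_inverse_one has_inverse_mult)

lemma has_inverse_elem_prod:
  assumes t: "set t \<subseteq> Pos ` {0..<m} \<union> Neg ` {1..m}" and X: "nonsingular_assignment m n t X"
  shows "has_inverse (m * n) (elem_prod m n t X)"
  unfolding elem_prod_def
proof (rule has_inverse_mat_prod)
  fix B assume "B \<in> set (map2 (elem_mat m n) t X)"
  then obtain k where k: "k < length t" "k < length X" "B = elem_mat m n (t ! k) (X ! k)"
    by (auto simp: set_zip)
  then show "has_inverse (m * n) B"
    using X t unfolding nonsingular_assignment_def matrix_assignment_def k(3)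
    by (intro has_inverse_elem_mat) (auto dest: nth_mem)
qed


section \<open>Ports and wire states\<close>

fun num :: "idx \<Rightarrow> nat" where
  "num (Pos i) = i"
| "num (Neg i) = i"

type_synonym ports = "nat \<Rightarrow> complex vec"

text \<open>The values that the gate of an index takes from and puts on its upper wire (\<open>i + 1\<close>) and its lower
  wire (\<open>i\<close>), in terms of the three port values \<open>a\<^sub>i, b\<^sub>i, c\<^sub>i\<close>. Passing from \<open>i\<close> to \<open>-i\<close> reverses the
  direction: inputs of one are outputs of the other, on the same wire.\<close>
fun up_in :: "ports \<Rightarrow> ports \<Rightarrow> ports \<Rightarrow> idx \<Rightarrow> complex vec" where
  "up_in a b c (Pos i) = c i"
| "up_in a b c (Neg i) = b i"

fun up_out :: "ports \<Rightarrow> ports \<Rightarrow> ports \<Rightarrow> idx \<Rightarrow> complex vec" where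
  "up_out a b c (Pos i) = b i"
| "up_out a b c (Neg i) = c i"

fun low_in :: "ports \<Rightarrow> ports \<Rightarrow> ports \<Rightarrow> idx \<Rightarrow> complex vec" where
  "low_in a b c (Pos i) = a i"
| "low_in a b c (Neg i) = c i"

fun low_out :: "ports \<Rightarrow> ports \<Rightarrow> ports \<Rightarrow> idx \<Rightarrow> complex vec" where
  "low_out a b c (Pos i) = c i"
| "low_out a b c (Neg i) = a i"

text \<open>The contents of the wires after the gates of a tuple, applied from right to left to \<open>u\<close>, if each gate
  puts out its prescribed port values. The entries at \<open>0\<close> and \<open>m + 1\<close> are written by the boundary
  gates and never read.\<close>
fun state :: "ports \<Rightarrow> ports \<Rightarrow> ports \<Rightarrow> ports \<Rightarrow> idx list \<Rightarrow> ports" where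
  "state a b c u [] = u"
| "state a b c u (t # \<beta>) = (state a b c u \<beta>)(Suc (num t) := up_out a b c t, num t := low_out a b c t)"

text \<open>The prescribed inputs of every gate agree with the contents of its wires at the moment when it is
  reached; the guards omit the nonexistent wires \<open>0\<close> and \<open>m + 1\<close>.\<close>
fun fits :: "nat \<Rightarrow> ports \<Rightarrow> ports \<Rightarrow> ports \<Rightarrow> ports \<Rightarrow> idx list \<Rightarrow> bool" where
  "fits m a b c u [] \<longleftrightarrow> True"
| "fits m a b c u (t # \<beta>) \<longleftrightarrow> fits m a b c u \<beta> \<and>
     (num t < m \<longrightarrow> state a b c u \<beta> (Suc (num t)) = up_in a b c t) \<and>
     (0 < num t \<longrightarrow> state a b c u \<beta> (num t) = low_in a b c t)"

lemma ports_cong: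
  assumes "a i = a' i" "b i = b' i" "c i = c' i" "num t = i"
  shows "up_in a b c t = up_in a' b' c' t" "up_out a b c t = up_out a' b' c' t"
    "low_in a b c t = low_in a' b' c' t" "low_out a b c t = low_out a' b' c' t"
  using assms by (cases t; simp)+

lemma state_fits_cong:
  assumes "\<And>t. t \<in> set \<beta> \<Longrightarrow> a (num t) = a' (num t) \<and> b (num t) = b' (num t) \<and> c (num t) = c' (num t)"
  shows "state a b c u \<beta> = state a' b' c' u \<beta> \<and> fits m a b c u \<beta> = fits m a' b' c' u \<beta>"
  using assms
proof (induction \<beta>)
  case (Cons t \<beta>)
  then show ?case using ports_cong[of a "num t" a' b b' c c' t] by simp
qed simp

lemma subseq_set: "subseq xs ys \<Longrightarrow> set xs \<subseteq> set ys"
  by (induction rule: list_emb.induct) auto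

text \<open>The content of wire \<open>j + 1\<close> is determined by the leftmost of the two letters \<open>j, j + 1\<close> that touch it.
  The parameter \<open>f\<close> is \<open>Pos\<close> or \<open>Neg\<close>.\<close>
lemma state_cases:
  assumes f: "\<And>i. num (f i) = i" and "distinct \<beta>" "set \<beta> \<subseteq> range f"
  shows "state a b c u \<beta> (Suc j) =
    (if f j \<in> set \<beta> \<and> \<not> subseq [f (Suc j), f j] \<beta> then up_out a b c (f j)
     else if f (Suc j) \<in> set \<beta> then low_out a b c (f (Suc j)) else u (Suc j))"
  using assms(2,3)
proof (induction \<beta>)
  case (Cons t \<beta>)
  then obtain i where i: "t = f i" by auto
  have inj: "f x = f y \<longleftrightarrow> x = y" for x y by (metis f)
  consider "i = j" | "i = Suc j" | "i \<noteq> j" "i \<noteq> Suc j" by blast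
  then show ?case
  proof cases
    case 1
    then have "\<not> subseq [f (Suc j), f j] (t # \<beta>)"
      using Cons.prems i inj by (auto simp: subseq_Cons2_iff dest!: subseq_set)
    then show ?thesis using 1 i f by simp
  next
    case 2
    then have "subseq [f (Suc j), f j] (t # \<beta>) \<longleftrightarrow> f j \<in> set \<beta>"
      using i by (simp add: subseq_singleton_left)
    then show ?thesis using 2 i f inj by simp
  next
    case 3
    then have "subseq [f (Suc j), f j] (t # \<beta>) \<longleftrightarrow> subseq [f (Suc j), f j] \<beta>"
      using i inj by (auto simp: subseq_Cons2_iff)
    then show ?thesis using 3 i f inj Cons by simp
  qed
qed simp

text \<open>Compatibility is local: a letter reads the wire either from the other letter touching it, if that one
  stands further right, or from the input.\<close>
lemma fits_iff:
  assumes f: "\<And>i. num (f i) = i" and "distinct \<beta>" "set \<beta> \<subseteq> f ` {..m}"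
  shows "fits m a b c u \<beta> \<longleftrightarrow> (\<forall>j<m.
     (f j \<in> set \<beta> \<longrightarrow> up_in a b c (f j) =
        (if subseq [f j, f (Suc j)] \<beta> then low_out a b c (f (Suc j)) else u (Suc j))) \<and>
     (f (Suc j) \<in> set \<beta> \<longrightarrow> low_in a b c (f (Suc j)) =
        (if subseq [f (Suc j), f j] \<beta> then up_out a b c (f j) else u (Suc j))))"
  (is "_ \<longleftrightarrow> (\<forall>j<m. ?U j \<beta> \<and> ?L j \<beta>)")
  using assms(2,3)
proof (induction \<beta>)
  case (Cons t \<beta>)
  then obtain i where i: "t = f i" "i \<le> m" by auto
  have inj: "f x = f y \<longleftrightarrow> x = y" for x y by (metis f)
  have fresh: "f i \<notin> set \<beta>" using Cons.prems i by simp
  have sub1: "subseq [f i, y] (t # \<beta>) \<longleftrightarrow> y \<in> set \<beta>" for y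
    using i by (simp add: subseq_singleton_left)
  have sub2: "subseq [x, y] (t # \<beta>) \<longleftrightarrow> subseq [x, y] \<beta>" if "x \<noteq> f i" for x y
    using i that by (simp add: subseq_Cons2_iff)
  have sub3: "\<not> subseq [x, f i] \<beta>" "\<not> subseq [f i, x] \<beta>" for x
    using fresh by (auto dest!: subseq_set)
  have st: "state a b c u \<beta> (Suc j) =
    (if f j \<in> set \<beta> \<and> \<not> subseq [f (Suc j), f j] \<beta> then up_out a b c (f j)
     else if f (Suc j) \<in> set \<beta> then low_out a b c (f (Suc j)) else u (Suc j))" for j
    by (rule state_cases[OF f]) (use Cons.prems in auto)
  have U: "?U j (t # \<beta>) \<longleftrightarrow> ?U j \<beta> \<and> (j = i \<longrightarrow> state a b c u \<beta> (Suc i) = up_in a b c t)" for j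
    using fresh sub1 sub2 sub3 inj i st[of i] by auto
  have L: "?L j (t # \<beta>) \<longleftrightarrow> ?L j \<beta> \<and> (Suc j = i \<longrightarrow> state a b c u \<beta> i = low_in a b c t)" for j
    using fresh sub1 sub2 sub3 inj i st[of j] by auto
  have "fits m a b c u (t # \<beta>) \<longleftrightarrow> (\<forall>j<m. ?U j \<beta> \<and> ?L j \<beta>) \<and>
     (i < m \<longrightarrow> state a b c u \<beta> (Suc i) = up_in a b c t) \<and>
     (0 < i \<longrightarrow> state a b c u \<beta> i = low_in a b c t)"
    using Cons i f by simp
  also have "(0 < i \<longrightarrow> state a b c u \<beta> i = low_in a b c t) \<longleftrightarrow>
    (\<forall>j<m. Suc j = i \<longrightarrow> state a b c u \<beta> i = low_in a b c t)"
    using i(2) by (cases i) auto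
  also have "(i < m \<longrightarrow> state a b c u \<beta> (Suc i) = up_in a b c t) \<longleftrightarrow>
    (\<forall>j<m. j = i \<longrightarrow> state a b c u \<beta> (Suc i) = up_in a b c t)" by auto
  finally show ?case unfolding U L by blast
qed auto

section \<open>Products of Fiedler matrices\<close>

lemma mult_zero_vec: "M \<in> carrier_mat n n \<Longrightarrow> M *\<^sub>v 0\<^sub>v n = 0\<^sub>v n" for M :: "complex mat"
  by (intro eq_vecI) (auto simp: scalar_prod_def)

lemma mult_uminus_vec:
  "M \<in> carrier_mat n n \<Longrightarrow> v \<in> carrier_vec n \<Longrightarrow> M *\<^sub>v (- v) = - (M *\<^sub>v v)"
  for M :: "complex mat"
  by (intro eq_vecI) (auto simp: scalar_prod_def sum_negf)

locale matrix_poly =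
  fixes m n :: nat and A :: "nat \<Rightarrow> complex mat"
  assumes m2: "2 \<le> m" and A: "\<And>i. i \<le> m \<Longrightarrow> A i \<in> carrier_mat n n"
begin

definition legal :: "idx \<Rightarrow> bool" where
  "legal t \<longleftrightarrow> num t \<le> m \<and> (t = Pos m \<longrightarrow> invertible_mat (A m)) \<and> (t = Neg 0 \<longrightarrow> invertible_mat (A 0))"

text \<open>The law of a gate. The conditions at \<open>0\<close> and \<open>m\<close> make up for the missing lower, respectively upper,
  wire.\<close>
definition port :: "nat \<Rightarrow> complex vec \<Rightarrow> complex vec \<Rightarrow> complex vec \<Rightarrow> bool" where
  "port i p q r \<longleftrightarrow> p \<in> carrier_vec n \<and> q \<in> carrier_vec n \<and> r \<in> carrier_vec n \<and>
     p = q + A i *\<^sub>v r \<and> (i = 0 \<longrightarrow> p = 0\<^sub>v n) \<and> (i = m \<longrightarrow> q = 0\<^sub>v n)"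

lemma fiedler_Pos_m:
  assumes "invertible_mat (A m)"
  shows "fiedler_mat m n A (Pos m) = elem_mat m n (Neg m) (mat_inv (A m))"
proof -
  note i = mat_inv_invertible[OF A[OF order.refl] assms]
  have "mat_inv (elem_mat m n (Neg m) (A m)) = elem_mat m n (Neg m) (mat_inv (A m))"
    using i A[of m] m2 elem_mat_carrier[of _ n "Neg m" m]
    by (intro mat_inv_eqI[of _ "m * n"] elem_mat_inverse_boundary) auto
  then show ?thesis by (simp add: fiedler_mat.simps)
qed

lemma fiedler_mat_Pos [simp]: "i < m \<Longrightarrow> fiedler_mat m n A (Pos i) = elem_mat m n (Pos i) (- A i)"
  and fiedler_mat_Neg [simp]: "0 < i \<Longrightarrow> fiedler_mat m n A (Neg i) = elem_mat m n (Neg i) (A i)"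
  by (simp_all add: fiedler_mat.simps)

lemma fiedler_Neg_0:
  assumes "invertible_mat (A 0)"
  shows "fiedler_mat m n A (Neg 0) = elem_mat m n (Pos 0) (- mat_inv (A 0))"
proof -
  have A0: "A 0 \<in> carrier_mat n n" using A by simp
  note i = mat_inv_invertible[OF A0 assms]
  have "mat_inv (elem_mat m n (Pos 0) (- A 0)) = elem_mat m n (Pos 0) (- mat_inv (A 0))"
    using i A0 m2 elem_mat_carrier[of _ n "Pos 0" m]
    by (intro mat_inv_eqI[of _ "m * n"] elem_mat_inverse_boundary) auto
  then show ?thesis by (simp add: fiedler_mat.simps)
qed

lemma fiedler_carrier: "legal t \<Longrightarrow> fiedler_mat m n A t \<in> carrier_mat (m * n) (m * n)"
proof -
  assume l: "legal t"
  consider "t = Pos m" | "t = Neg 0" | i where "t = Pos i" "i < m" | i where "t = Neg i" "1 \<le> i" "i \<le> m"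
    using l unfolding legal_def by (cases t) force+
  then show ?thesis
  proof cases
    case 1
    then show ?thesis using l fiedler_Pos_m elem_mat_carrier[of "mat_inv (A m)" n "Neg m" m] m2
       mat_inv_invertible[OF A, of m] unfolding legal_def by auto
  next
    case 2
    then show ?thesis using l fiedler_Neg_0 elem_mat_carrier[of "- mat_inv (A 0)" n "Pos 0" m] m2
       mat_inv_invertible[OF A, of 0] unfolding legal_def by auto
  next
    case (3 i)
    then show ?thesis using elem_mat_carrier[of "- A i" n "Pos i" m] A[of i] by auto
  next
    case (4 i)
    then show ?thesis using elem_mat_carrier[of "A i" n "Neg i" m] A[of i] by auto
  qed
qed

lemma mat_inv_mult_vec:
  assumes "M \<in> carrier_mat n n" "invertible_mat M" "v \<in> carrier_vec n"
  shows "mat_inv M *\<^sub>v (M *\<^sub>v v) = v" "M *\<^sub>v (mat_inv M *\<^sub>v v) = v" "mat_inv M *\<^sub>v v \<in> carrier_vec n"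
  using mat_inv_invertible[OF assms(1,2)] assms(1,3)
  by (auto simp: assoc_mult_mat_vec[of _ n n _ n, symmetric])

lemma legal_cases:
  assumes "legal t"
  obtains "t = Pos 0" | "t = Pos m" "invertible_mat (A m)" | i where "t = Pos i" "1 \<le> i" "i < m"
  | "t = Neg m" | "t = Neg 0" "invertible_mat (A 0)" | i where "t = Neg i" "1 \<le> i" "i < m"
  using assms unfolding legal_def by (cases t) (force simp: not_less_eq_eq)+

text \<open>Both signs and all boundary cases follow the same law: for \<open>i = 0\<close> it says \<open>b\<^sub>0 = -A\<^sub>0 c\<^sub>0\<close>, for
  \<open>i = m\<close> it says \<open>a\<^sub>m = A\<^sub>m c\<^sub>m\<close>, and the sign of the index decides which side is the input.\<close>
lemma fiedler_step:
  assumes t: "legal t" and x: "x \<in> carrier_vec (m * n)"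
    and p: "port (num t) (a (num t)) (b (num t)) (c (num t))"
    and up: "num t < m \<Longrightarrow> wire m n x (Suc (num t)) = up_in a b c t"
    and low: "0 < num t \<Longrightarrow> wire m n x (num t) = low_in a b c t"
    and k: "1 \<le> k" "k \<le> m"
  shows "wire m n (fiedler_mat m n A t *\<^sub>v x) k =
    (if k = num t then low_out a b c t else if k = Suc (num t) then up_out a b c t else wire m n x k)"
  using t
proof (cases rule: legal_cases)
  case 1
  have A0: "A 0 \<in> carrier_mat n n" using A by simp
  have "b 0 = - A 0 *\<^sub>v c 0"
  proof -
    have c: "c 0 \<in> carrier_vec n" "b 0 \<in> carrier_vec n" "0\<^sub>v n = b 0 + A 0 *\<^sub>v c 0"
      using p 1 unfolding port_def by auto
    then have "b 0 = (b 0 + A 0 *\<^sub>v c 0) + - (A 0 *\<^sub>v c 0)" using A0 by (auto intro!: eq_vecI)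
    also have "\<dots> = - (A 0 *\<^sub>v c 0)" using c(1) A0 c(3)[symmetric] by simp
    finally show ?thesis using uminus_mult_vec[OF A0 c(1)] by simp
  qed
  then show ?thesis using 1 up m2 k wire_elem_Pos_0[OF x _ k, of "- A 0"] A0
    by auto
next
  case 2
  have "mat_inv (A m) *\<^sub>v a m = c m"
    using p 2 mat_inv_mult_vec[OF A[of m] 2(2), of "c m"] A[of m] unfolding port_def by simp
  then show ?thesis using 2 low m2 k fiedler_Pos_m wire_elem_Neg_m[OF x _ k, of "mat_inv (A m)"]
      mat_inv_invertible[OF A[of m] 2(2)]
    by auto
next
  case (3 i)
  have Ai: "A i \<in> carrier_mat n n" using A 3 by simp
  have "- A i *\<^sub>v c i + a i = b i"
    using p 3 Ai unfolding port_def by (auto simp: uminus_mult_vec intro!: eq_vecI)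
  then show ?thesis using 3 up low k wire_elem_Pos[OF x _ 3(2,3) k, of "- A i"] Ai
    by auto
next
  case 4
  then have "A m *\<^sub>v c m = a m" using p A[of m] unfolding port_def by simp
  then show ?thesis using 4 low m2 k wire_elem_Neg_m[OF x A k] by auto
next
  case 5
  have A0: "A 0 \<in> carrier_mat n n" using A by simp
  note i = mat_inv_invertible[OF A0 5(2)]
  have c: "c 0 \<in> carrier_vec n" "b 0 \<in> carrier_vec n" "0\<^sub>v n = b 0 + A 0 *\<^sub>v c 0"
    using p 5 unfolding port_def by auto
  have "mat_inv (A 0) *\<^sub>v b 0 + c 0 = mat_inv (A 0) *\<^sub>v (b 0 + A 0 *\<^sub>v c 0)"
    using c i A0 mat_inv_mult_vec[OF A0 5(2) c(1)] by (simp add: mult_add_distrib_mat_vec[of _ n n])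
  also have "\<dots> = 0\<^sub>v n" using c(3)[symmetric] mult_zero_vec[OF i(1)] by simp
  finally have z: "mat_inv (A 0) *\<^sub>v b 0 + c 0 = 0\<^sub>v n" .
  have "(- mat_inv (A 0)) *\<^sub>v b 0 = - (mat_inv (A 0) *\<^sub>v b 0)"
    using c i uminus_mult_vec by simp
  also have "\<dots> = - (mat_inv (A 0) *\<^sub>v b 0) + (mat_inv (A 0) *\<^sub>v b 0 + c 0)" using c(1,2) i(1) z by simp
  also have "\<dots> = c 0" using c(1,2) i(1) vec_cancel(4)[of "mat_inv (A 0) *\<^sub>v b 0" n "c 0"] by simp
  finally have "(- mat_inv (A 0)) *\<^sub>v b 0 = c 0" .
  then show ?thesis using 5 up m2 k fiedler_Neg_0 wire_elem_Pos_0[OF x _ k, of "- mat_inv (A 0)"] i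
    by auto
next
  case (6 i)
  have Ai: "A i \<in> carrier_mat n n" using A 6 by simp
  have "b i + A i *\<^sub>v c i = a i" using p 6 unfolding port_def by simp
  then show ?thesis using 6 up low k wire_elem_Neg[OF x Ai 6(2,3) k] by auto
qed

text \<open>Two of the three port values are the inputs and the law gives the third one.\<close>
lemma fiedler_ports_exist:
  assumes t: "legal t" and u: "\<And>k. u k \<in> carrier_vec n"
  obtains p q r where "port (num t) p q r"
    "num t < m \<Longrightarrow> u (Suc (num t)) = up_in (\<lambda>_. p) (\<lambda>_. q) (\<lambda>_. r) t"
    "0 < num t \<Longrightarrow> u (num t) = low_in (\<lambda>_. p) (\<lambda>_. q) (\<lambda>_. r) t"
  using t
proof (cases rule: legal_cases)
  case 1
  have A0: "A 0 \<in> carrier_mat n n" using A by simp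
  then have "- (A 0 *\<^sub>v u 1) + A 0 *\<^sub>v u 1 = 0\<^sub>v n" using u[of 1] by (auto intro!: eq_vecI)
  then show thesis using 1 that[of "0\<^sub>v n" "- (A 0 *\<^sub>v u 1)" "u 1"] A0 u[of 1] m2
    by (auto simp: port_def)
next
  case 2
  then show thesis using that[of "u m" "0\<^sub>v n" "mat_inv (A m) *\<^sub>v u m"] A[of m] u[of m] m2
      mat_inv_mult_vec[OF A[of m] 2(2) u[of m]] by (auto simp: port_def)
next
  case (3 i)
  then have "A i \<in> carrier_mat n n" using A by simp
  then have "u i = (u i + - (A i *\<^sub>v u (Suc i))) + A i *\<^sub>v u (Suc i)"
    using u[of i] u[of "Suc i"] by (auto intro!: eq_vecI)
  then show thesis using that[of "u i" "u i + - (A i *\<^sub>v u (Suc i))" "u (Suc i)"] 3 A[of i] u[of i] u[of "Suc i"]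
    by (auto simp: port_def)
next
  case 4
  then show thesis using that[of "A m *\<^sub>v u m" "0\<^sub>v n" "u m"] A[of m] u[of m] m2
    by (auto simp: port_def)
next
  case 5
  have A0: "A 0 \<in> carrier_mat n n" using A by simp
  note i = mat_inv_invertible[OF A0 5(2)]
  have "A 0 *\<^sub>v (- mat_inv (A 0) *\<^sub>v u 1) = - (A 0 *\<^sub>v (mat_inv (A 0) *\<^sub>v u 1))"
    using A0 i u[of 1] by (simp add: uminus_mult_vec mult_uminus_vec)
  also have "\<dots> = - u 1" using mat_inv_mult_vec[OF A0 5(2) u] by simp
  finally have "A 0 *\<^sub>v (- mat_inv (A 0) *\<^sub>v u 1) = - u 1" .
  then show thesis using that[of "0\<^sub>v n" "u 1" "- mat_inv (A 0) *\<^sub>v u 1"] 5 A0 u[of 1] m2 i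
    by (auto simp: port_def)
next
  case (6 i)
  then have "A i \<in> carrier_mat n n" using A by simp
  then show thesis using that[of "u (Suc i) + A i *\<^sub>v u i" "u (Suc i)" "u i"] 6 u[of i] u[of "Suc i"]
    by (auto simp: port_def)
qed

lemma fiedler_prod_Cons: "fiedler_prod m n A (t # \<beta>) = fiedler_mat m n A t * fiedler_prod m n A \<beta>"
  by (simp add: fiedler_prod_def mat_prod_Cons)

lemma fiedler_prod_carrier:
  "Ball (set \<beta>) legal \<Longrightarrow> fiedler_prod m n A \<beta> \<in> carrier_mat (m * n) (m * n)"
  unfolding fiedler_prod_def by (intro mat_prod_carrier) (auto intro: fiedler_carrier)

lemma fiedler_prod_state:
  assumes x: "x \<in> carrier_vec (m * n)" and "Ball (set \<beta>) legal" "fits m a b c (wire m n x) \<beta>"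
    "\<And>t. t \<in> set \<beta> \<Longrightarrow> port (num t) (a (num t)) (b (num t)) (c (num t))"
    and "1 \<le> k" "k \<le> m"
  shows "wire m n (fiedler_prod m n A \<beta> *\<^sub>v x) k = state a b c (wire m n x) \<beta> k"
  using assms(2-)
proof (induction \<beta> arbitrary: k)
  case Nil
  then show ?case using x by (simp add: fiedler_prod_def)
next
  case (Cons t \<beta>)
  let ?y = "fiedler_prod m n A \<beta> *\<^sub>v x"
  have l: "legal t" and lb: "Ball (set \<beta>) legal" using Cons.prems by auto
  have y: "?y \<in> carrier_vec (m * n)" using fiedler_prod_carrier[OF lb] x by auto
  have IH: "wire m n ?y k = state a b c (wire m n x) \<beta> k" if "1 \<le> k" "k \<le> m" for k
    using Cons that by simp
  have "num t \<le> m" using l by (simp add: legal_def)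
  then have "wire m n (fiedler_mat m n A t *\<^sub>v ?y) k =
    (if k = num t then low_out a b c t else if k = Suc (num t) then up_out a b c t else wire m n ?y k)"
    using Cons.prems IH by (intro fiedler_step[OF l y]) auto
  moreover have "fiedler_prod m n A (t # \<beta>) *\<^sub>v x = fiedler_mat m n A t *\<^sub>v ?y"
    unfolding fiedler_prod_Cons using fiedler_carrier[OF l] fiedler_prod_carrier[OF lb] x
    by (simp add: assoc_mult_mat_vec[of _ "m * n" "m * n" _ "m * n"])
  ultimately show ?case using IH Cons.prems by simp
qed

lemma fiedler_prod_ports_exist:
  assumes x: "x \<in> carrier_vec (m * n)" and "Ball (set \<beta>) legal" "distinct (map num \<beta>)"
  shows "\<exists>a b c. fits m a b c (wire m n x) \<beta> \<and>
    (\<forall>t \<in> set \<beta>. port (num t) (a (num t)) (b (num t)) (c (num t)))"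
  using assms(2-)
proof (induction \<beta>)
  case (Cons t \<beta>)
  then obtain a b c where abc: "fits m a b c (wire m n x) \<beta>"
    "\<forall>t \<in> set \<beta>. port (num t) (a (num t)) (b (num t)) (c (num t))" by auto
  let ?y = "fiedler_prod m n A \<beta> *\<^sub>v x"
  have l: "legal t" and lb: "Ball (set \<beta>) legal" using Cons.prems by auto
  have st: "wire m n ?y k = state a b c (wire m n x) \<beta> k" if "1 \<le> k" "k \<le> m" for k
    by (rule fiedler_prod_state[OF x lb abc(1)]) (use abc(2) that in auto)
  obtain p q r where pqr: "port (num t) p q r"
    "num t < m \<Longrightarrow> wire m n ?y (Suc (num t)) = up_in (\<lambda>_. p) (\<lambda>_. q) (\<lambda>_. r) t"
    "0 < num t \<Longrightarrow> wire m n ?y (num t) = low_in (\<lambda>_. p) (\<lambda>_. q) (\<lambda>_. r) t"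
    by (rule fiedler_ports_exist[OF l, of "wire m n ?y"]) auto
  define a' where "a' = a(num t := p)"
  define b' where "b' = b(num t := q)"
  define c' where "c' = c(num t := r)"
  have new: "num s \<noteq> num t" if "s \<in> set \<beta>" for s using Cons.prems that by (auto simp: image_iff)
  have eq: "state a b c (wire m n x) \<beta> = state a' b' c' (wire m n x) \<beta>"
    "fits m a b c (wire m n x) \<beta> = fits m a' b' c' (wire m n x) \<beta>"
    using state_fits_cong[of \<beta> a a' b b' c c' "wire m n x" m] new
    by (auto simp: a'_def b'_def c'_def)
  have t: "up_in (\<lambda>_. p) (\<lambda>_. q) (\<lambda>_. r) t = up_in a' b' c' t"
    "low_in (\<lambda>_. p) (\<lambda>_. q) (\<lambda>_. r) t = low_in a' b' c' t"
    by (cases t; simp add: a'_def b'_def c'_def)+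
  have "num t \<le> m" using l by (simp add: legal_def)
  then have "fits m a' b' c' (wire m n x) (t # \<beta>)"
    using pqr st eq abc(1) t by auto
  moreover have "\<forall>s \<in> set (t # \<beta>). port (num s) (a' (num s)) (b' (num s)) (c' (num s))"
    using pqr(1) abc(2) new by (auto simp: a'_def b'_def c'_def)
  ultimately show ?case by blast
qed simp

end


section \<open>The kernel of a generalized Fiedler pencil\<close>

lemma smult_mat_mult_vec:
  "M \<in> carrier_mat d e \<Longrightarrow> v \<in> carrier_vec e \<Longrightarrow> (z \<cdot>\<^sub>m M) *\<^sub>v v = z \<cdot>\<^sub>v (M *\<^sub>v v)"
  for M :: "complex mat"
  by (intro eq_vecI) (auto simp: scalar_prod_def sum_distrib_left mult.assoc)

lemma diff_eq_zero_vec_iff: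
  fixes v w :: "complex vec"
  assumes "v \<in> carrier_vec d" "w \<in> carrier_vec d" shows "v - w = 0\<^sub>v d \<longleftrightarrow> w = v"
  using assms by (auto simp: vec_eq_iff)

lemma subseq_pair_antisym:
  assumes "distinct \<beta>" "subseq [x, y] \<beta>" shows "\<not> subseq [y, x] \<beta>"
  using assms
proof (induction \<beta>)
  case (Cons t \<beta>)
  then show ?case by (auto simp: subseq_Cons2_iff subseq_singleton_left dest!: subseq_set split: if_splits)
qed simp

lemma subseq_pair_total:
  assumes "x \<in> set \<beta>" "y \<in> set \<beta>" "x \<noteq> y" shows "subseq [x, y] \<beta> \<or> subseq [y, x] \<beta>"
  using assms
proof (induction \<beta>)
  case (Cons t \<beta>)
  then show ?case by (auto simp: subseq_Cons2_iff subseq_singleton_left)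
qed simp

text \<open>The inner pencil of an EGFP: \<open>\<sigma>\<close> and \<open>-\<tau>\<close> partition the indices \<open>0, \<dots>, m\<close>.\<close>
locale fiedler_pencil = matrix_poly +
  fixes \<sigma> \<tau> :: "idx list"
  assumes distinct_\<sigma>: "distinct \<sigma>" and distinct_\<tau>: "distinct \<tau>"
    and \<sigma>: "set \<sigma> \<subseteq> Pos ` {..m}" and \<tau>: "set \<tau> \<subseteq> Neg ` {..m}"
    and split: "\<And>i. i \<le> m \<Longrightarrow> Neg i \<in> set \<tau> \<longleftrightarrow> Pos i \<notin> set \<sigma>"
    and Am: "Pos m \<in> set \<sigma> \<Longrightarrow> invertible_mat (A m)"
    and A0: "Neg 0 \<in> set \<tau> \<Longrightarrow> invertible_mat (A 0)"
begin

text \<open>The value \<open>c\<^sub>j\<close> is handed on unchanged to \<open>c\<^bsub>j+1\<^esub>\<close>: \<open>j\<close> and \<open>j + 1\<close> form a consecution of \<open>\<sigma>\<close> or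
  \<open>-(j + 1), -j\<close> come in this order in \<open>\<tau>\<close>, or \<open>j\<close> belongs to \<open>\<sigma>\<close> and \<open>j + 1\<close> does not. Otherwise it
  picks up the factor \<open>z\<close>.\<close>
definition stay :: "nat \<Rightarrow> bool" where
  "stay j \<longleftrightarrow> (if Pos j \<in> set \<sigma> then Pos (Suc j) \<in> set \<sigma> \<longrightarrow> subseq [Pos j, Pos (Suc j)] \<sigma>
     else Pos (Suc j) \<notin> set \<sigma> \<and> \<not> subseq [Neg j, Neg (Suc j)] \<tau>)"

definition link :: "complex \<Rightarrow> ports \<Rightarrow> ports \<Rightarrow> ports \<Rightarrow> nat \<Rightarrow> bool" where
  "link z a b c j \<longleftrightarrow> (if stay j then c (Suc j) = c j \<and> b j = z \<cdot>\<^sub>v a (Suc j)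
     else b j = a (Suc j) \<and> c (Suc j) = z \<cdot>\<^sub>v c j)"

text \<open>The input on wire \<open>j + 1\<close>, expressed by the ports of its two gates.\<close>
definition node :: "ports \<Rightarrow> ports \<Rightarrow> ports \<Rightarrow> nat \<Rightarrow> complex vec" where
  "node a b c j =
     (if Pos j \<in> set \<sigma> then if stay j \<and> Pos (Suc j) \<in> set \<sigma> then a (Suc j) else c j
      else if stay j then b j else if Pos (Suc j) \<in> set \<sigma> then a (Suc j) else c (Suc j))"

text \<open>The heart of the matter: of the equations that wire \<open>j + 1\<close> imposes, namely the compatibility of the
  two gates touching it within \<open>\<sigma>\<close> and within \<open>\<tau>\<close> and the kernel equation, there remain in each of
  the six possible positions of \<open>j\<close> and \<open>j + 1\<close> one of the two links and the value of the wire.\<close>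
lemma fits_states_iff:
  "fits m a b c u \<sigma> \<and> fits m a b c u \<tau> \<and>
     (\<forall>j<m. state a b c u \<sigma> (Suc j) = z \<cdot>\<^sub>v state a b c u \<tau> (Suc j))
   \<longleftrightarrow> (\<forall>j<m. link z a b c j \<and> u (Suc j) = node a b c j)"
proof -
  have s: "set \<sigma> \<subseteq> range Pos" "set \<tau> \<subseteq> range Neg" using \<sigma> \<tau> by auto
  have "(Pos j \<in> set \<sigma> \<longrightarrow> c j = (if subseq [Pos j, Pos (Suc j)] \<sigma> then c (Suc j) else u (Suc j))) \<and>
     (Pos (Suc j) \<in> set \<sigma> \<longrightarrow> a (Suc j) = (if subseq [Pos (Suc j), Pos j] \<sigma> then b j else u (Suc j))) \<and>
     (Neg j \<in> set \<tau> \<longrightarrow> b j = (if subseq [Neg j, Neg (Suc j)] \<tau> then a (Suc j) else u (Suc j))) \<and>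
     (Neg (Suc j) \<in> set \<tau> \<longrightarrow> c (Suc j) = (if subseq [Neg (Suc j), Neg j] \<tau> then c j else u (Suc j))) \<and>
     (if Pos j \<in> set \<sigma> \<and> \<not> subseq [Pos (Suc j), Pos j] \<sigma> then b j
      else if Pos (Suc j) \<in> set \<sigma> then c (Suc j) else u (Suc j)) =
     z \<cdot>\<^sub>v (if Neg j \<in> set \<tau> \<and> \<not> subseq [Neg (Suc j), Neg j] \<tau> then c j
      else if Neg (Suc j) \<in> set \<tau> then a (Suc j) else u (Suc j))
    \<longleftrightarrow> link z a b c j \<and> u (Suc j) = node a b c j" (is "?F j") if j: "j < m" for j
  proof -
    have p: "Pos i \<in> set \<sigma>" "Pos k \<in> set \<sigma>" if "subseq [Pos i, Pos k] \<sigma>" for i k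
      using subseq_set[OF that] by auto
    have q: "Neg i \<in> set \<tau>" "Neg k \<in> set \<tau>" if "subseq [Neg i, Neg k] \<tau>" for i k
      using subseq_set[OF that] by auto
    have N: "Neg j \<in> set \<tau> \<longleftrightarrow> Pos j \<notin> set \<sigma>" "Neg (Suc j) \<in> set \<tau> \<longleftrightarrow> Pos (Suc j) \<notin> set \<sigma>"
      using split j by auto
    \<comment> \<open>The names say in which of \<open>\<sigma>\<close> (s) and \<open>\<omega>\<close> (w) the indices lie, or that both lie in
      \<open>\<sigma>\<close> (\<open>cons\<close>, \<open>inv\<close>) or both in \<open>\<tau>\<close> (\<open>ncons\<close>, \<open>ninv\<close>).\<close>
    consider (cons) "Pos j \<in> set \<sigma>" "Pos (Suc j) \<in> set \<sigma>" "subseq [Pos j, Pos (Suc j)] \<sigma>" "\<not> subseq [Pos (Suc j), Pos j] \<sigma>"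
      | (inv) "Pos j \<in> set \<sigma>" "Pos (Suc j) \<in> set \<sigma>" "\<not> subseq [Pos j, Pos (Suc j)] \<sigma>" "subseq [Pos (Suc j), Pos j] \<sigma>"
      | (sw) "Pos j \<in> set \<sigma>" "Pos (Suc j) \<notin> set \<sigma>"
      | (ws) "Pos j \<notin> set \<sigma>" "Pos (Suc j) \<in> set \<sigma>"
      | (ncons) "Pos j \<notin> set \<sigma>" "Pos (Suc j) \<notin> set \<sigma>" "subseq [Neg j, Neg (Suc j)] \<tau>" "\<not> subseq [Neg (Suc j), Neg j] \<tau>"
      | (ninv) "Pos j \<notin> set \<sigma>" "Pos (Suc j) \<notin> set \<sigma>" "\<not> subseq [Neg j, Neg (Suc j)] \<tau>" "subseq [Neg (Suc j), Neg j] \<tau>"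
      using subseq_pair_total[of "Pos j" \<sigma> "Pos (Suc j)"] subseq_pair_antisym[OF distinct_\<sigma>]
        subseq_pair_total[of "Neg j" \<tau> "Neg (Suc j)"] subseq_pair_antisym[OF distinct_\<tau>] N
      by (metis idx.inject n_not_Suc_n)
    then show ?thesis
    proof cases
      case cons
      then show ?thesis using N by (auto simp: link_def node_def stay_def)
    next
      case inv
      then show ?thesis using N by (auto simp: link_def node_def stay_def)
    next
      case sw
      then show ?thesis using N p(2)[of j "Suc j"] p(1)[of "Suc j" j] q(1)[of j "Suc j"] q(2)[of "Suc j" j]
        by (auto simp: link_def node_def stay_def)
    next
      case ws
      then show ?thesis using N p(1)[of j "Suc j"] p(2)[of "Suc j" j] q(2)[of j "Suc j"] q(1)[of "Suc j" j]
        by (auto simp: link_def node_def stay_def)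
    next
      case ncons
      then show ?thesis using N by (auto simp: link_def node_def stay_def)
    next
      case ninv
      then show ?thesis using N by (auto simp: link_def node_def stay_def)
    qed
  qed
  then have F: "(\<forall>j<m. ?F j)" by blast
  have fs: "fits m a b c u \<sigma> \<longleftrightarrow> (\<forall>j<m.
     (Pos j \<in> set \<sigma> \<longrightarrow> c j = (if subseq [Pos j, Pos (Suc j)] \<sigma> then c (Suc j) else u (Suc j))) \<and>
     (Pos (Suc j) \<in> set \<sigma> \<longrightarrow> a (Suc j) = (if subseq [Pos (Suc j), Pos j] \<sigma> then b j else u (Suc j))))"
    using fits_iff[of Pos \<sigma> m a b c u] distinct_\<sigma> \<sigma> by simp
  have ft: "fits m a b c u \<tau> \<longleftrightarrow> (\<forall>j<m.
     (Neg j \<in> set \<tau> \<longrightarrow> b j = (if subseq [Neg j, Neg (Suc j)] \<tau> then a (Suc j) else u (Suc j))) \<and>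
     (Neg (Suc j) \<in> set \<tau> \<longrightarrow> c (Suc j) = (if subseq [Neg (Suc j), Neg j] \<tau> then c j else u (Suc j))))"
    using fits_iff[of Neg \<tau> m a b c u] distinct_\<tau> \<tau> by simp
  have ss: "state a b c u \<sigma> (Suc j) = (if Pos j \<in> set \<sigma> \<and> \<not> subseq [Pos (Suc j), Pos j] \<sigma> then b j
      else if Pos (Suc j) \<in> set \<sigma> then c (Suc j) else u (Suc j))" for j
    using state_cases[of Pos \<sigma> a b c u j] distinct_\<sigma> s by simp
  have st: "state a b c u \<tau> (Suc j) = (if Neg j \<in> set \<tau> \<and> \<not> subseq [Neg (Suc j), Neg j] \<tau> then c j
      else if Neg (Suc j) \<in> set \<tau> then a (Suc j) else u (Suc j))" for j
    using state_cases[of Neg \<tau> a b c u j] distinct_\<tau> s by simp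
  show ?thesis unfolding fs ft ss st using F by blast
qed

definition ports_of :: "complex \<Rightarrow> complex vec \<Rightarrow> ports \<Rightarrow> ports \<Rightarrow> ports \<Rightarrow> bool" where
  "ports_of z y a b c \<longleftrightarrow> (\<forall>i\<le>m. port i (a i) (b i) (c i)) \<and>
     (\<forall>j<m. link z a b c j \<and> wire m n y (Suc j) = node a b c j)"

lemma legal_\<sigma>: "Ball (set \<sigma>) legal"
  using \<sigma> Am unfolding legal_def by auto

lemma legal_\<tau>: "Ball (set \<tau>) legal"
  using \<tau> A0 unfolding legal_def by auto

abbreviation pencil :: "complex \<Rightarrow> complex mat" where
  "pencil z \<equiv> z \<cdot>\<^sub>m fiedler_prod m n A \<tau> - fiedler_prod m n A \<sigma>"

lemma pencil_mult_vec_eq_0: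
  assumes y: "y \<in> carrier_vec (m * n)"
  shows "pencil z *\<^sub>v y = 0\<^sub>v (m * n) \<longleftrightarrow>
    (\<forall>j<m. wire m n (fiedler_prod m n A \<sigma> *\<^sub>v y) (Suc j) = z \<cdot>\<^sub>v wire m n (fiedler_prod m n A \<tau> *\<^sub>v y) (Suc j))"
proof -
  let ?S = "fiedler_prod m n A \<sigma> *\<^sub>v y" and ?T = "fiedler_prod m n A \<tau> *\<^sub>v y"
  note c = fiedler_prod_carrier[OF legal_\<sigma>] fiedler_prod_carrier[OF legal_\<tau>]
  have ST: "?S \<in> carrier_vec (m * n)" "?T \<in> carrier_vec (m * n)" using c y by auto
  have "pencil z *\<^sub>v y = z \<cdot>\<^sub>v ?T - ?S"
    using c y minus_mult_distrib_mat_vec[of "z \<cdot>\<^sub>m fiedler_prod m n A \<tau>" "m * n" "m * n" "fiedler_prod m n A \<sigma>" y]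
    by (auto simp: smult_mat_mult_vec)
  moreover have "z \<cdot>\<^sub>v ?T - ?S = 0\<^sub>v (m * n) \<longleftrightarrow> ?S = z \<cdot>\<^sub>v ?T"
    using ST by (intro diff_eq_zero_vec_iff) auto
  moreover have "?S = z \<cdot>\<^sub>v ?T \<longleftrightarrow> (\<forall>j<m. wire m n ?S (Suc j) = z \<cdot>\<^sub>v wire m n ?T (Suc j))"
  proof
    assume "?S = z \<cdot>\<^sub>v ?T"
    then show "\<forall>j<m. wire m n ?S (Suc j) = z \<cdot>\<^sub>v wire m n ?T (Suc j)" using wire_smult[OF ST(2)] by auto
  next
    assume eq: "\<forall>j<m. wire m n ?S (Suc j) = z \<cdot>\<^sub>v wire m n ?T (Suc j)"
    show "?S = z \<cdot>\<^sub>v ?T"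
    proof (rule wire_eqI)
      fix k assume k: "1 \<le> k" "k \<le> m"
      then obtain j where "k = Suc j" by (cases k) auto
      then show "wire m n ?S k = wire m n (z \<cdot>\<^sub>v ?T) k" using eq k wire_smult[OF ST(2) k] by simp
    qed (use ST in auto)
  qed
  ultimately show ?thesis by simp
qed

text \<open>The ports of \<open>\<sigma>\<close> and \<open>\<tau>\<close> live on complementary index sets and can be merged into one family.\<close>
lemma pencil_kernel_iff:
  assumes y: "y \<in> carrier_vec (m * n)"
  shows "pencil z *\<^sub>v y = 0\<^sub>v (m * n) \<longleftrightarrow> (\<exists>a b c. ports_of z y a b c)"
proof
  assume k: "pencil z *\<^sub>v y = 0\<^sub>v (m * n)"
  have inj: "inj_on num (set \<sigma>)" "inj_on num (set \<tau>)"
    by (rule inj_on_subset[OF _ \<sigma>], force simp: inj_on_def)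
      (rule inj_on_subset[OF _ \<tau>], force simp: inj_on_def)
  obtain a b c where s: "fits m a b c (wire m n y) \<sigma>"
    "\<forall>t \<in> set \<sigma>. port (num t) (a (num t)) (b (num t)) (c (num t))"
    using fiedler_prod_ports_exist[OF y legal_\<sigma>] distinct_\<sigma> inj by (auto simp: distinct_map)
  obtain a' b' c' where t: "fits m a' b' c' (wire m n y) \<tau>"
    "\<forall>t \<in> set \<tau>. port (num t) (a' (num t)) (b' (num t)) (c' (num t))"
    using fiedler_prod_ports_exist[OF y legal_\<tau>] distinct_\<tau> inj by (auto simp: distinct_map)
  define d where "d f g = (\<lambda>i. if Pos i \<in> set \<sigma> then f i else g i)" for f g :: ports
  define a'' where "a'' = d a a'"
  define b'' where "b'' = d b b'"
  define c'' where "c'' = d c c'"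
  have ds: "d f g (num t) = f (num t)" if "t \<in> set \<sigma>" for f g t
    using that \<sigma> by (auto simp: d_def)
  have dt: "d f g (num t) = g (num t)" if "t \<in> set \<tau>" for f g t
    using that \<tau> split by (auto simp: d_def)
  have "fits m a'' b'' c'' (wire m n y) \<sigma>"
    using s(1) state_fits_cong[of \<sigma> a a'' b b'' c c'' "wire m n y" m] ds
    by (simp add: a''_def b''_def c''_def)
  moreover have "fits m a'' b'' c'' (wire m n y) \<tau>"
    using t(1) state_fits_cong[of \<tau> a' a'' b' b'' c' c'' "wire m n y" m] dt
    by (simp add: a''_def b''_def c''_def)
  moreover have ps: "port (num t) (a'' (num t)) (b'' (num t)) (c'' (num t))" if "t \<in> set \<sigma>" for t
    using s(2) ds that by (simp add: a''_def b''_def c''_def)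
  moreover have pt: "port (num t) (a'' (num t)) (b'' (num t)) (c'' (num t))" if "t \<in> set \<tau>" for t
    using t(2) dt that by (simp add: a''_def b''_def c''_def)
  moreover have "\<forall>j<m. state a'' b'' c'' (wire m n y) \<sigma> (Suc j) = z \<cdot>\<^sub>v state a'' b'' c'' (wire m n y) \<tau> (Suc j)"
    using k[unfolded pencil_mult_vec_eq_0[OF y]]
      fiedler_prod_state[OF y legal_\<sigma> calculation(1) ps] fiedler_prod_state[OF y legal_\<tau> calculation(2) pt]
    by auto
  moreover have "\<forall>i\<le>m. port i (a'' i) (b'' i) (c'' i)"
  proof (intro allI impI)
    fix i assume "i \<le> m"
    then show "port i (a'' i) (b'' i) (c'' i)"
      using ps[of "Pos i"] pt[of "Neg i"] split[of i] by auto
  qed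
  ultimately have "ports_of z y a'' b'' c''"
    unfolding ports_of_def using fits_states_iff[of a'' b'' c'' "wire m n y" z] by blast
  then show "\<exists>a b c. ports_of z y a b c" by blast
next
  assume "\<exists>a b c. ports_of z y a b c"
  then obtain a b c where p: "ports_of z y a b c" by blast
  then have f: "fits m a b c (wire m n y) \<sigma>" "fits m a b c (wire m n y) \<tau>"
    "\<forall>j<m. state a b c (wire m n y) \<sigma> (Suc j) = z \<cdot>\<^sub>v state a b c (wire m n y) \<tau> (Suc j)"
    using fits_states_iff[of a b c "wire m n y" z] unfolding ports_of_def by blast+
  have "port (num t) (a (num t)) (b (num t)) (c (num t))" if "t \<in> set \<sigma> \<union> set \<tau>" for t
    using p that \<sigma> \<tau> unfolding ports_of_def by auto
  then show "pencil z *\<^sub>v y = 0\<^sub>v (m * n)"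
    unfolding pencil_mult_vec_eq_0[OF y]
    using fiedler_prod_state[OF y legal_\<sigma> f(1)] fiedler_prod_state[OF y legal_\<tau> f(2)] f(3)
    by auto
qed

end


section \<open>From port values to the matrix polynomial\<close>

lemma matpoly_carrier [simp]: "matpoly k n A z \<in> carrier_mat n n"
  by (simp add: matpoly_def)

lemma matpoly_0_mult_vec:
  assumes "A 0 \<in> carrier_mat n n" "v \<in> carrier_vec n"
  shows "matpoly 0 n A z *\<^sub>v v = A 0 *\<^sub>v v"
  using assms by (intro eq_vecI) (auto simp: matpoly_def scalar_prod_def)

lemma matpoly_Suc_mult_vec:
  assumes "A (Suc k) \<in> carrier_mat n n" "v \<in> carrier_vec n"
  shows "matpoly (Suc k) n A z *\<^sub>v v = matpoly k n A z *\<^sub>v v + z ^ Suc k \<cdot>\<^sub>v (A (Suc k) *\<^sub>v v)"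
  using assms
  by (intro eq_vecI)
    (auto simp: matpoly_def scalar_prod_def sum_distrib_left sum_distrib_right sum.distrib algebra_simps)

context fiedler_pencil
begin

text \<open>The factors that \<open>c\<^sub>j\<close> has picked up from \<open>c\<^sub>0\<close>, and those that \<open>a\<^sub>j\<close> picks up on its way to \<open>a\<^sub>0\<close>.
  Each index below \<open>j\<close> contributes \<open>z\<close> to exactly one of them.\<close>
definition \<kappa> :: "complex \<Rightarrow> nat \<Rightarrow> complex" where
  "\<kappa> z j = (\<Prod>i<j. if stay i then 1 else z)"

definition \<rho> :: "complex \<Rightarrow> nat \<Rightarrow> complex" where
  "\<rho> z j = (\<Prod>i<j. if stay i then z else 1)"

lemma \<rho>_\<kappa>: "\<rho> z j * \<kappa> z j = z ^ j"
proof -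
  have "(if stay i then z else 1) * (if stay i then 1 else z) = z" for i by simp
  then show ?thesis unfolding \<rho>_def \<kappa>_def by (simp add: prod.distrib[symmetric])
qed

lemma ports_c:
  assumes "c 0 \<in> carrier_vec n" "\<And>i. i < j \<Longrightarrow> link z a b c i"
  shows "c j = \<kappa> z j \<cdot>\<^sub>v c 0"
  using assms(2)
proof (induction j)
  case (Suc j)
  then have "c j = \<kappa> z j \<cdot>\<^sub>v c 0" "link z a b c j" by auto
  then show ?case by (auto simp: link_def \<kappa>_def smult_smult_assoc mult.commute)
qed (use assms(1) in \<open>simp add: \<kappa>_def\<close>)

text \<open>Eliminating \<open>a\<^sub>1, \<dots>, a\<^sub>m\<close> is a Horner scheme: \<open>a\<^sub>j\<close> enters \<open>a\<^sub>0\<close> with the factor \<open>\<rho> z j\<close>, and its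
  summand \<open>A\<^sub>j c\<^sub>j\<close> contributes \<open>\<rho> z j \<cdot> \<kappa> z j = z\<^sup>j\<close> times \<open>A\<^sub>j c\<^sub>0\<close>. The lemma serves in
  both directions: \<open>a\<^sub>0 = 0\<close> gives \<open>P(z) c\<^sub>0 = 0\<close>, and \<open>P(z) c\<^sub>0 = 0\<close> gives \<open>a\<^sub>0 = 0\<close>.\<close>
lemma ports_telescope:
  assumes abc: "\<And>i. i \<le> m \<Longrightarrow> a i \<in> carrier_vec n" "\<And>i. i \<le> m \<Longrightarrow> b i \<in> carrier_vec n"
    "\<And>i. i \<le> m \<Longrightarrow> c i \<in> carrier_vec n"
    and port: "\<And>i. i \<le> m \<Longrightarrow> a i = b i + A i *\<^sub>v c i" and bm: "b m = 0\<^sub>v n"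
    and link: "\<And>i. i < m \<Longrightarrow> link z a b c i"
  shows "a 0 = matpoly m n A z *\<^sub>v c 0"
proof -
  have step: "\<rho> z j \<cdot>\<^sub>v (A j *\<^sub>v c j) = z ^ j \<cdot>\<^sub>v (A j *\<^sub>v c 0)" if "j \<le> m" for j
  proof -
    have "c j = \<kappa> z j \<cdot>\<^sub>v c 0"
      using ports_c[of c j z a b, OF abc(3)[OF le0] link] that by simp
    then show ?thesis
      using \<rho>_\<kappa>[of z j] A[OF that] abc(3)[of 0]
      by (simp add: mult_mat_vec[of _ n n] smult_smult_assoc)
  qed
  have "a 0 = matpoly j n A z *\<^sub>v c 0 + \<rho> z (Suc j) \<cdot>\<^sub>v a (Suc j)" if "j < m" for j
    using that
  proof (induction j)
    case 0
    have "b 0 = \<rho> z (Suc 0) \<cdot>\<^sub>v a (Suc 0)"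
      using link[of 0] 0 by (auto simp: link_def \<rho>_def)
    then show ?case using port[of 0] A[of 0] abc(2)[of 0] abc(3)[of 0]
      by (simp add: matpoly_0_mult_vec comm_add_vec[of _ n])
  next
    case (Suc j)
    have j: "Suc j \<le> m" using Suc by simp
    note A' = A[OF j]
    have 1: "\<rho> z (Suc j) \<cdot>\<^sub>v b (Suc j) = \<rho> z (Suc (Suc j)) \<cdot>\<^sub>v a (Suc (Suc j))"
      using link[of "Suc j"] Suc.prems by (auto simp: link_def \<rho>_def smult_smult_assoc)
    have "\<rho> z (Suc j) \<cdot>\<^sub>v a (Suc j) = \<rho> z (Suc j) \<cdot>\<^sub>v b (Suc j) + \<rho> z (Suc j) \<cdot>\<^sub>v (A (Suc j) *\<^sub>v c (Suc j))"
      using port[OF j] abc(2,3)[OF j] A' by (simp add: smult_add_distrib_vec[of _ n])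
    also have "\<dots> = z ^ Suc j \<cdot>\<^sub>v (A (Suc j) *\<^sub>v c 0) + \<rho> z (Suc (Suc j)) \<cdot>\<^sub>v a (Suc (Suc j))"
      unfolding 1 step[OF j] using abc(1)[of "Suc (Suc j)"] abc(3)[of 0] A' Suc.prems
      by (simp add: comm_add_vec[of _ n])
    finally have 2: "\<rho> z (Suc j) \<cdot>\<^sub>v a (Suc j) =
      z ^ Suc j \<cdot>\<^sub>v (A (Suc j) *\<^sub>v c 0) + \<rho> z (Suc (Suc j)) \<cdot>\<^sub>v a (Suc (Suc j))" .
    have c0: "c 0 \<in> carrier_vec n" using abc(3) by simp
    have "a 0 = matpoly j n A z *\<^sub>v c 0 + (z ^ Suc j \<cdot>\<^sub>v (A (Suc j) *\<^sub>v c 0) + \<rho> z (Suc (Suc j)) \<cdot>\<^sub>v a (Suc (Suc j)))"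
      using Suc 2 by simp
    also have "\<dots> = matpoly (Suc j) n A z *\<^sub>v c 0 + \<rho> z (Suc (Suc j)) \<cdot>\<^sub>v a (Suc (Suc j))"
      unfolding matpoly_Suc_mult_vec[of A j n "c 0" z, OF A' c0]
      by (rule assoc_add_vec[symmetric])
        (use c0 A' abc(1)[of "Suc (Suc j)"] Suc.prems mult_mat_vec_carrier[OF matpoly_carrier c0] in auto)
    finally show ?case .
  qed
  from this[of "m - 1"] have "a 0 = matpoly (m - 1) n A z *\<^sub>v c 0 + \<rho> z m \<cdot>\<^sub>v a m"
    using m2 by simp
  also have "\<rho> z m \<cdot>\<^sub>v a m = z ^ m \<cdot>\<^sub>v (A m *\<^sub>v c 0)"
    using step[of m] port[of m] bm abc(3)[of m] A[of m] by simp
  finally show ?thesis using matpoly_Suc_mult_vec[of A "m - 1" n "c 0" z] A[of m] abc(3)[of 0] m2 by simp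
qed

lemma ports_of_matpoly:
  assumes "ports_of z y a b c"
  shows "c 0 \<in> carrier_vec n" "matpoly m n A z *\<^sub>v c 0 = 0\<^sub>v n"
proof -
  have p: "port i (a i) (b i) (c i)" if "i \<le> m" for i using assms that unfolding ports_of_def by auto
  then show "c 0 \<in> carrier_vec n" unfolding port_def by auto
  have "a 0 = matpoly m n A z *\<^sub>v c 0"
    using p assms by (intro ports_telescope[of a b c z]) (auto simp: port_def ports_of_def)
  moreover have "a 0 = 0\<^sub>v n" using p[OF le0] unfolding port_def by blast
  ultimately show "matpoly m n A z *\<^sub>v c 0 = 0\<^sub>v n" by simp
qed

text \<open>From \<open>c\<^sub>0 = 0\<close> all \<open>c\<^sub>j\<close> vanish, going up; then all \<open>a\<^sub>j\<close> and \<open>b\<^sub>j\<close> vanish, going down from \<open>b\<^sub>m = 0\<close>.\<close>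
lemma ports_of_zero:
  assumes p: "ports_of z y a b c" and c0: "c 0 = 0\<^sub>v n" and y: "y \<in> carrier_vec (m * n)"
  shows "y = 0\<^sub>v (m * n)"
proof -
  have port: "port i (a i) (b i) (c i)" if "i \<le> m" for i using p that unfolding ports_of_def by auto
  have link: "link z a b c j" if "j < m" for j using p that unfolding ports_of_def by auto
  have c: "c j = 0\<^sub>v n" if "j \<le> m" for j
    using ports_c[of c j z a b] link c0 that by auto
  have Ac: "a j = b j" if "j \<le> m" for j
    using port[OF that] A[OF that] unfolding port_def c[OF that] by (auto simp: mult_zero_vec)
  have b: "b j = 0\<^sub>v n" if "j \<le> m" for j
    using that
  proof (induction j rule: inc_induct)
    case base
    then show ?case using port[of m] unfolding port_def by simp
  next
    case (step j)
    moreover have "z \<cdot>\<^sub>v 0\<^sub>v n = 0\<^sub>v n" by (intro eq_vecI) auto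
    ultimately show ?case using link[of j] Ac[of "Suc j"] by (simp add: link_def split: if_splits)
  qed
  show ?thesis
  proof (rule wire_eqI)
    fix k assume k: "1 \<le> k" "k \<le> m"
    then obtain j where j: "k = Suc j" by (cases k) auto
    have "wire m n y (Suc j) = node a b c j" using p j k unfolding ports_of_def by simp
    also have "\<dots> = 0\<^sub>v n" using b[of j] b[of "Suc j"] c[of j] c[of "Suc j"] Ac[of "Suc j"] j k
      by (simp add: node_def)
    finally show "wire m n y k = wire m n (0\<^sub>v (m * n)) k" using j k by (simp add: wire_zero)
  qed (use y in auto)
qed

text \<open>Conversely the \<open>c\<^sub>j\<close> can be computed upwards from \<open>v\<close> and then the \<open>a\<^sub>j, b\<^sub>j\<close> downwards from \<open>b\<^sub>m = 0\<close>; the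
  remaining condition \<open>a\<^sub>0 = 0\<close> is \<open>P(z) v = 0\<close>.\<close>
lemma ports_of_exists:
  assumes v: "v \<in> carrier_vec n" and ker: "matpoly m n A z *\<^sub>v v = 0\<^sub>v n"
  obtains y a b c where "y \<in> carrier_vec (m * n)" "ports_of z y a b c" "c 0 = v"
proof -
  define c where "c j = \<kappa> z j \<cdot>\<^sub>v v" for j
  \<comment> \<open>\<open>h d\<close> is \<open>a\<close> at \<open>m - d\<close>, so that the downward recursion becomes primitive recursion.\<close>
  define h where "h = rec_nat (A m *\<^sub>v c m) (\<lambda>d r. (if stay (m - Suc d) then z \<cdot>\<^sub>v r else r)
    + A (m - Suc d) *\<^sub>v c (m - Suc d))"
  define a where "a j = h (m - j)" for j
  define b where "b j = (if j = m then 0\<^sub>v n else if stay j then z \<cdot>\<^sub>v a (Suc j) else a (Suc j))" for j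
  have c: "c j \<in> carrier_vec n" for j using v by (simp add: c_def)
  have c0: "c 0 = v" by (simp add: c_def \<kappa>_def)
  have h: "h d \<in> carrier_vec n" if "d \<le> m" for d
    using that
  proof (induction d)
    case 0
    then show ?case using A[of m] c[of m] by (simp add: h_def)
  next
    case (Suc d)
    then have "h d \<in> carrier_vec n" by simp
    then show ?case using A[of "m - Suc d"] c by (simp add: h_def)
  qed
  have a: "a j \<in> carrier_vec n" for j unfolding a_def by (rule h) simp
  have b: "b j \<in> carrier_vec n" for j using a by (simp add: b_def)
  have bm: "b m = 0\<^sub>v n" by (simp add: b_def)
  have port: "a j = b j + A j *\<^sub>v c j" if "j \<le> m" for j
  proof (cases "j = m")
    case True
    then show ?thesis using A[of m] c[of m] by (simp add: a_def b_def h_def)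
  next
    case False
    then have "m - j = Suc (m - Suc j)" "m - Suc (m - Suc j) = j" using that by auto
    then show ?thesis using False unfolding b_def a_def by (simp add: h_def)
  qed
  have link: "link z a b c j" if "j < m" for j
  proof (cases "stay j")
    case True
    then have "\<kappa> z (Suc j) = \<kappa> z j" by (simp add: \<kappa>_def)
    then show ?thesis using True that by (simp add: link_def b_def c_def)
  next
    case False
    then have "\<kappa> z (Suc j) = z * \<kappa> z j" by (simp add: \<kappa>_def)
    then show ?thesis using False that by (simp add: link_def b_def c_def smult_smult_assoc)
  qed
  have "a 0 = matpoly m n A z *\<^sub>v c 0"
    by (intro ports_telescope[of a b c z] a b c bm link port)
  then have a0: "a 0 = 0\<^sub>v n" using ker c0 by simp
  define y where "y = of_wires m n (\<lambda>k. node a b c (k - 1))"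
  have "node a b c j \<in> carrier_vec n" for j using a b c by (simp add: node_def)
  then have "wire m n y (Suc j) = node a b c j" if "j < m" for j
    using that by (simp add: y_def wire_of_wires)
  moreover have "port i (a i) (b i) (c i)" if "i \<le> m" for i
  proof -
    have "i = 0 \<longrightarrow> a i = 0\<^sub>v n" "i = m \<longrightarrow> b i = 0\<^sub>v n" using a0 bm by simp_all
    then show ?thesis unfolding port_def using a b c port[OF that] by blast
  qed
  ultimately have "ports_of z y a b c" unfolding ports_of_def using link by blast
  then show thesis using that c0 by (metis of_wires_carrier y_def)
qed

text \<open>Along a consecution in \<open>\<sigma>\<close> the value \<open>c\<close> does not change. If the run ends below \<open>m\<close>, its last gate
  reads it directly from the input wire. If it ends at \<open>m\<close>, the top wire carries \<open>a\<^sub>m = A\<^sub>m c\<^sub>m\<close>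
  instead. The side condition excludes the run that consists of \<open>m\<close> alone when \<open>m - 1\<close> is in
  \<open>\<sigma>\<close> too: the top wire carries \<open>c\<^bsub>m-1\<^esub>\<close> if \<open>m - 1\<close> stands to the right of \<open>m\<close>.\<close>
lemma node_at_run_end:
  assumes p: "ports_of z y a b c" and k: "run_len (Pos r) \<sigma> = Suc s"
  shows "r + s < m \<Longrightarrow> wire m n y (Suc (r + s)) = c r"
    and "r + s = m \<Longrightarrow> 0 < s \<or> Pos (m - 1) \<notin> set \<sigma> \<Longrightarrow> wire m n y m = A m *\<^sub>v c r"
    and "r + s \<le> m"
proof -
  have mem: "Pos (r + j) \<in> set \<sigma>" if "j \<le> s" for j
    by (rule set_of_run_len_Pos) (use k that in simp)
  show le: "r + s \<le> m" using mem[of s] \<sigma> by auto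
  have sub: "subseq [Pos (r + j), Pos (Suc (r + j))] \<sigma>" if "j < s" for j
    by (rule subseq_of_run_len_Pos) (use k that in simp)
  have stay: "stay (r + j)" if "j < s" for j
    using sub[OF that] mem[of j] that by (simp add: stay_def)
  have link: "link z a b c j" if "j < m" for j using p that unfolding ports_of_def by auto
  have c: "c (r + j) = c r" if "j \<le> s" for j
    using that
  proof (induction j)
    case (Suc j)
    then show ?case using link[of "r + j"] stay[of j] le by (simp add: link_def)
  qed simp
  show "wire m n y (Suc (r + s)) = c r" if "r + s < m"
  proof -
    have "\<not> subseq [Pos (r + s), Pos (Suc (r + s))] \<sigma>"
      by (rule not_subseq_of_run_len_Pos[OF distinct_\<sigma> k])
    then have "node a b c (r + s) = c (r + s)" using mem[of s] by (simp add: node_def stay_def)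
    then show ?thesis using p c[of s] that unfolding ports_of_def by simp
  qed
  show "wire m n y m = A m *\<^sub>v c r" if "r + s = m" "0 < s \<or> Pos (m - 1) \<notin> set \<sigma>"
  proof -
    have m: "Suc (m - 1) = m" "m - 1 < m" using m2 by auto
    have "Pos m \<in> set \<sigma>" using mem[of s] that by simp
    moreover have "Pos (m - 1) \<notin> set \<sigma> \<or> stay (m - 1)"
    proof (cases s)
      case (Suc s')
      then have "r + s' = m - 1" using that by simp
      then show ?thesis using stay[of s'] Suc by simp
    qed (use that in simp)
    ultimately have "node a b c (m - 1) = a m" using m by (auto simp: node_def stay_def)
    moreover have "wire m n y (Suc (m - 1)) = node a b c (m - 1)"
      using p that(1) \<open>m - 1 < m\<close> unfolding ports_of_def by blast
    ultimately have "wire m n y m = a m" using m by simp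
    also have "a m = A m *\<^sub>v c m" using p A[of m] unfolding ports_of_def port_def by auto
    finally show ?thesis using c[of s] that by simp
  qed
qed

end


section \<open>Following a wire through the outer factors\<close>

lemma block_row_carrier [simp]: "block_row m n j \<in> carrier_mat n (m * n)"
  by (intro carrier_matI) (simp_all add: block_row_def kron_def)

lemma block_row_mult_vec:
  assumes x: "x \<in> carrier_vec (m * n)" and w: "1 \<le> w" "w \<le> m" and j: "j = int m - int w + 1"
  shows "block_row m n j *\<^sub>v x = wire m n x w"
proof (rule eq_vecI)
  fix r assume "r < dim_vec (wire m n x w)"
  then have r: "r < n" by (simp add: wire_def)
  define e where "e = (m - w) * n + r"
  have e: "e < m * n" "e div n = m - w" "e mod n = r"
    using wire_index_less[OF w r] r by (auto simp: e_def)
  have j': "nat (j - 1) = m - w" using j w by simp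
  have "row (block_row m n j) r = unit_vec (m * n) e"
  proof (rule eq_vecI)
    fix i assume "i < dim_vec (unit_vec (m * n) e :: complex vec)"
    then have i: "i < m * n" by simp
    then have n: "0 < n" by (cases n) auto
    have d: "i div n < m" "i mod n < n" using i n by (auto simp: div_less_iff_less_mult)
    have "i = e \<longleftrightarrow> i div n = m - w \<and> i mod n = r" using e by (metis div_mult_mod_eq)
    then show "row (block_row m n j) r $ i = unit_vec (m * n) e $ i"
      using i r d e(1) j' w by (simp add: block_row_def kron_def mat_of_row_def)
  qed (simp add: block_row_def kron_def)
  then have "(block_row m n j *\<^sub>v x) $ r = unit_vec (m * n) e \<bullet> x"
    using r by (simp add: block_row_def kron_def)
  also have "\<dots> = x $ e" using e(1) x by simp
  finally show "(block_row m n j *\<^sub>v x) $ r = wire m n x w $ r"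
    using r by (simp add: wire_def e_def)
qed (simp add: block_row_def kron_def wire_def)

lemma elem_prod_Cons: "elem_prod m n (t # \<rho>) (X # Xs) = elem_mat m n t X * elem_prod m n \<rho> Xs"
  by (simp add: elem_prod_def mat_prod_Cons)

lemma elem_prod_carrier:
  assumes "set \<rho> \<subseteq> Pos ` {0..<m} \<union> Neg ` {1..m}" "matrix_assignment n \<rho> X"
  shows "elem_prod m n \<rho> X \<in> carrier_mat (m * n) (m * n)"
  unfolding elem_prod_def
proof (rule mat_prod_carrier, rule subsetI)
  fix B assume "B \<in> set (map2 (elem_mat m n) \<rho> X)"
  then obtain t Y where "B = elem_mat m n t Y" "t \<in> set \<rho>" "Y \<in> set X"
    by (auto dest: set_zip_leftD set_zip_rightD)
  then show "B \<in> carrier_mat (m * n) (m * n)"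
    using assms elem_mat_carrier[of Y n t m] unfolding matrix_assignment_def by blast
qed

lemma elem_prod_Cons_mult_vec:
  assumes "set (t # \<rho>) \<subseteq> Pos ` {0..<m} \<union> Neg ` {1..m}" "matrix_assignment n (t # \<rho>) X"
    "x \<in> carrier_vec (m * n)"
  obtains Y Ys where "X = Y # Ys" "Y \<in> carrier_mat n n" "matrix_assignment n \<rho> Ys"
    "elem_prod m n (t # \<rho>) X *\<^sub>v x = elem_mat m n t Y *\<^sub>v (elem_prod m n \<rho> Ys *\<^sub>v x)"
    "elem_prod m n \<rho> Ys *\<^sub>v x \<in> carrier_vec (m * n)"
proof -
  obtain Y Ys where X: "X = Y # Ys" using assms(2) unfolding matrix_assignment_def by (cases X) auto
  then have Y: "Y \<in> carrier_mat n n" "matrix_assignment n \<rho> Ys"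
    using assms(2) unfolding matrix_assignment_def by auto
  have c: "elem_mat m n t Y \<in> carrier_mat (m * n) (m * n)" "elem_prod m n \<rho> Ys \<in> carrier_mat (m * n) (m * n)"
    using assms(1) Y elem_mat_carrier[of Y n t m] elem_prod_carrier[of \<rho> m n Ys] by auto
  then show thesis using that[OF X Y] assms(3) X
    by (simp add: elem_prod_Cons assoc_mult_mat_vec[of _ "m * n" "m * n" _ "m * n"])
qed

lemma wire_elem_untouched:
  assumes t: "t \<in> Pos ` {0..<m} \<union> Neg ` {1..m}" and x: "x \<in> carrier_vec (m * n)"
    and X: "X \<in> carrier_mat n n" and w: "1 \<le> w" "w \<le> m" and nw: "num t \<noteq> w" "Suc (num t) \<noteq> w"
  shows "wire m n (elem_mat m n t X *\<^sub>v x) w = wire m n x w"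
  using t
proof (cases rule: elem_index_cases)
  case 1
  then show ?thesis using wire_elem_Pos_0[OF x X w] nw by simp
next
  case (2 i)
  then show ?thesis using wire_elem_Pos[OF x X 2(2,3) w] nw by simp
next
  case 3
  then show ?thesis using wire_elem_Neg_m[OF x X w] nw by simp
next
  case (4 i)
  then show ?thesis using wire_elem_Neg[OF x X 4(2,3) w] nw by simp
qed

lemma wire_elem_prod_untouched:
  assumes "set \<rho> \<subseteq> Pos ` {0..<m} \<union> Neg ` {1..m}" "matrix_assignment n \<rho> X"
    and x: "x \<in> carrier_vec (m * n)" and w: "1 \<le> w" "w \<le> m"
    and "\<And>t. t \<in> set \<rho> \<Longrightarrow> num t \<noteq> w \<and> Suc (num t) \<noteq> w"
  shows "wire m n (elem_prod m n \<rho> X *\<^sub>v x) w = wire m n x w"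
  using assms(1,2,6)
proof (induction \<rho> arbitrary: X)
  case Nil
  then show ?case using x by (simp add: elem_prod_def)
next
  case (Cons t \<rho>)
  obtain Y Ys where Y: "Y \<in> carrier_mat n n" "matrix_assignment n \<rho> Ys"
    "elem_prod m n (t # \<rho>) X *\<^sub>v x = elem_mat m n t Y *\<^sub>v (elem_prod m n \<rho> Ys *\<^sub>v x)"
    "elem_prod m n \<rho> Ys *\<^sub>v x \<in> carrier_vec (m * n)"
    by (rule elem_prod_Cons_mult_vec[OF Cons.prems(1,2) x])
  have "wire m n (elem_mat m n t Y *\<^sub>v (elem_prod m n \<rho> Ys *\<^sub>v x)) w = wire m n (elem_prod m n \<rho> Ys *\<^sub>v x) w"
    by (rule wire_elem_untouched[OF _ Y(4,1) w]) (use Cons.prems in auto)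
  then show ?case using Cons.IH[OF _ Y(2)] Cons.prems Y(3) by simp
qed

text \<open>The last letter met by the value on wire \<open>k + 1\<close> was \<open>k\<close>. The next letter \<open>k + 1\<close> lifts it by one wire.
  Another \<open>k\<close> would add something to it, but by the successor infix property that cannot come
  before \<open>k + 1\<close>. All other letters leave the wire alone. The hypotheses keep track of the tuple
  \<open>\<gamma>\<close> passed since the last letter of the run.\<close>
lemma wire_elem_prod_Pos:
  assumes "SIP (Pos k # \<gamma> @ \<rho>)" "Pos (Suc k) \<notin> set \<gamma>" "set \<rho> \<subseteq> Pos ` {0..<m}"
    "matrix_assignment n \<rho> X" "k < m" and x: "x \<in> carrier_vec (m * n)"
  shows "wire m n (elem_prod m n \<rho> X *\<^sub>v x) (Suc k) = wire m n x (Suc k + run_len (Pos (Suc k)) \<rho>)"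
  using assms(1-5)
proof (induction \<rho> arbitrary: k \<gamma> X)
  case Nil
  then show ?case using x by (simp add: elem_prod_def)
next
  case (Cons t \<rho>)
  have sub: "set (t # \<rho>) \<subseteq> Pos ` {0..<m} \<union> Neg ` {1..m}" using Cons.prems by auto
  obtain i where i: "t = Pos i" "i < m" using Cons.prems by auto
  obtain Y Ys where Y: "Y \<in> carrier_mat n n" "matrix_assignment n \<rho> Ys"
    "elem_prod m n (t # \<rho>) X *\<^sub>v x = elem_mat m n t Y *\<^sub>v (elem_prod m n \<rho> Ys *\<^sub>v x)"
    "elem_prod m n \<rho> Ys *\<^sub>v x \<in> carrier_vec (m * n)"
    by (rule elem_prod_Cons_mult_vec[OF sub Cons.prems(4) x])
  have w: "1 \<le> Suc k" "Suc k \<le> m" using Cons.prems by auto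
  consider "i = k" | "i = Suc k" | "i \<noteq> k" "i \<noteq> Suc k" by blast
  then show ?case
  proof cases
    case 1
    then show ?thesis using SIP_between[of "Pos k" \<gamma> \<rho>] Cons.prems(1,2) i by (auto simp: is_succ_Pos)
  next
    case 2
    have "SIP (Pos (Suc k) # [] @ \<rho>)"
      using SIP_infix[of "Pos k # \<gamma>" "Pos (Suc k) # \<rho>" "[]"] Cons.prems(1) 2 i by simp
    then have "wire m n (elem_prod m n \<rho> Ys *\<^sub>v x) (Suc (Suc k)) = wire m n x (Suc (Suc k) + run_len (Pos (Suc (Suc k))) \<rho>)"
      using Cons.IH[of "Suc k" "[]" Ys] Y(2) Cons.prems(3) 2 i by simp
    moreover have "wire m n (elem_mat m n t Y *\<^sub>v (elem_prod m n \<rho> Ys *\<^sub>v x)) (Suc k) =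
      wire m n (elem_prod m n \<rho> Ys *\<^sub>v x) (Suc (Suc k))"
      using wire_elem_Pos[OF Y(4,1) _ _ w, of i] 2 i by simp
    ultimately show ?thesis using 2 i Y(3) by simp
  next
    case 3
    have "wire m n (elem_mat m n t Y *\<^sub>v (elem_prod m n \<rho> Ys *\<^sub>v x)) (Suc k) =
      wire m n (elem_prod m n \<rho> Ys *\<^sub>v x) (Suc k)"
      by (rule wire_elem_untouched[OF _ Y(4,1) w]) (use 3 i sub in auto)
    moreover have "wire m n (elem_prod m n \<rho> Ys *\<^sub>v x) (Suc k) = wire m n x (Suc k + run_len (Pos (Suc k)) \<rho>)"
      by (rule Cons.IH[of k "\<gamma> @ [t]" Ys]) (use Cons.prems 3 i Y(2) in auto)
    ultimately show ?thesis using 3 i Y(3) by simp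
  qed
qed

text \<open>The mirror image: on wire \<open>k + 1\<close>, after \<open>-(k + 1)\<close>, the letter \<open>-k\<close> lowers the value by one wire and
  another \<open>-(k + 1)\<close> is excluded until then. The letter \<open>-0\<close> is not available, so wire \<open>1\<close> is the lowest
  that can be reached.\<close>
lemma wire_elem_prod_Neg:
  assumes "SIP (Neg (Suc k) # \<gamma> @ \<rho>)" "Neg k \<notin> set \<gamma>" "set \<rho> \<subseteq> Neg ` {1..m}"
    "matrix_assignment n \<rho> X" "k < m" and x: "x \<in> carrier_vec (m * n)"
  shows "wire m n (elem_prod m n \<rho> X *\<^sub>v x) (Suc k) = wire m n x (Suc k - run_len (Neg k) \<rho>) \<and> run_len (Neg k) \<rho> \<le> k"
  using assms(1-5)
proof (induction \<rho> arbitrary: k \<gamma> X)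
  case Nil
  then show ?case using x by (simp add: elem_prod_def)
next
  case (Cons t \<rho>)
  have sub: "set (t # \<rho>) \<subseteq> Pos ` {0..<m} \<union> Neg ` {1..m}" using Cons.prems by auto
  obtain i where i: "t = Neg i" "1 \<le> i" "i \<le> m" using Cons.prems by auto
  obtain Y Ys where Y: "Y \<in> carrier_mat n n" "matrix_assignment n \<rho> Ys"
    "elem_prod m n (t # \<rho>) X *\<^sub>v x = elem_mat m n t Y *\<^sub>v (elem_prod m n \<rho> Ys *\<^sub>v x)"
    "elem_prod m n \<rho> Ys *\<^sub>v x \<in> carrier_vec (m * n)"
    by (rule elem_prod_Cons_mult_vec[OF sub Cons.prems(4) x])
  have w: "1 \<le> Suc k" "Suc k \<le> m" using Cons.prems by auto
  consider "i = Suc k" | "i = k" | "i \<noteq> k" "i \<noteq> Suc k" by blast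
  then show ?case
  proof cases
    case 1
    then show ?thesis using SIP_between[of "Neg (Suc k)" \<gamma> \<rho>] Cons.prems(1,2) i
      by (auto simp: is_succ_Neg)
  next
    case 2
    obtain l where l: "k = Suc l" using i 2 by (cases k) auto
    have "SIP (Neg (Suc l) # [] @ \<rho>)"
      using SIP_infix[of "Neg (Suc k) # \<gamma>" "Neg k # \<rho>" "[]"] Cons.prems(1) 2 i l by simp
    then have "wire m n (elem_prod m n \<rho> Ys *\<^sub>v x) (Suc l) = wire m n x (Suc l - run_len (Neg l) \<rho>) \<and> run_len (Neg l) \<rho> \<le> l"
      using Cons.IH[of l "[]" Ys] Y(2) Cons.prems(3,5) l by simp
    moreover have "wire m n (elem_mat m n t Y *\<^sub>v (elem_prod m n \<rho> Ys *\<^sub>v x)) (Suc k) =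
      wire m n (elem_prod m n \<rho> Ys *\<^sub>v x) k"
      using wire_elem_Neg[OF Y(4,1) _ _ w, of i] 2 i Cons.prems(5) by simp
    ultimately show ?thesis using 2 i Y(3) l by simp
  next
    case 3
    have "wire m n (elem_mat m n t Y *\<^sub>v (elem_prod m n \<rho> Ys *\<^sub>v x)) (Suc k) =
      wire m n (elem_prod m n \<rho> Ys *\<^sub>v x) (Suc k)"
      by (rule wire_elem_untouched[OF _ Y(4,1) w]) (use 3 i sub in auto)
    moreover have "wire m n (elem_prod m n \<rho> Ys *\<^sub>v x) (Suc k) = wire m n x (Suc k - run_len (Neg k) \<rho>) \<and> run_len (Neg k) \<rho> \<le> k"
      by (rule Cons.IH[of k "\<gamma> @ [t]" Ys]) (use Cons.prems 3 i Y(2) in auto)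
    moreover have "run_len (Neg k) (t # \<rho>) = run_len (Neg k) \<rho>" using 3 i by (cases k) auto
    ultimately show ?thesis using Y(3) by simp
  qed
qed


section \<open>The recovery matrix\<close>

text \<open>The matrix \<open>F\<close>, with its six defining cases merged into one expression. Its counterpart \<open>K\<close> is the
  same expression for the transposed data.\<close>
definition recovery_mat ::
  "nat \<Rightarrow> nat \<Rightarrow> (nat \<Rightarrow> complex mat) \<Rightarrow> idx list \<Rightarrow> idx list \<Rightarrow> idx list \<Rightarrow> idx list \<Rightarrow> complex mat" where
  "recovery_mat m n A \<sigma> \<omega> \<sigma>2 \<tau>2 =
    (if Pos 0 \<in> set \<sigma> then
       if consecutions (Pos 0) \<sigma> < int m
       then block_row m n (int m - consecutions (Pos 0) (\<sigma> @ \<sigma>2))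
       else mat_inv (A m) * block_row m n 1
     else let i = inversions (Pos 0) \<omega>; r = Pos (nat (i + 1)) in
       if i = int m then mat_inv (A 0) * block_row m n (int m)
       else if r \<notin> set \<sigma> then block_row m n (int m - (i - consecutions (Neg (nat i)) \<tau>2 - 1))
       else if i + consecutions r \<sigma> + 1 < int m
       then block_row m n (int m - (i + consecutions r (\<sigma> @ \<sigma>2) + 1))
       else mat_inv (A m) * block_row m n (consecutions (Neg (m - 1)) \<tau>2 + 2))"

text \<open>What the right null space depends on: the left outer factors of an EGFP are invertible and do not
  affect it.\<close>
locale egfp_right = fiedler_pencil +
  fixes \<omega> \<sigma>2 \<tau>2 :: "idx list" and X2 Y2 :: "complex mat list"
  assumes \<tau>_\<omega>: "\<tau> = map idx_neg \<omega>"
    and SIP_\<sigma>: "SIP (\<sigma> @ \<sigma>2)" and SIP_\<tau>: "SIP (\<tau> @ \<tau>2)"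
    and \<sigma>2: "set \<sigma>2 \<subseteq> set \<sigma> - {Pos (m - 1), Pos m}"
    and \<tau>2: "set \<tau>2 \<subseteq> set \<tau> - {Neg 1, Neg 0}"
    and X2: "nonsingular_assignment m n \<sigma>2 X2" and Y2: "nonsingular_assignment m n \<tau>2 Y2"
begin

lemma \<sigma>2_Pos: "set \<sigma>2 \<subseteq> Pos ` {0..<m}"
  using \<sigma>2 \<sigma> by force

lemma \<tau>2_Neg: "set \<tau>2 \<subseteq> Neg ` {1..m}"
proof
  fix t assume "t \<in> set \<tau>2"
  then have "t \<in> Neg ` {..m}" "t \<noteq> Neg 0" using \<tau>2 \<tau> by auto
  then obtain i where "t = Neg i" "i \<le> m" "i \<noteq> 0" by auto
  then show "t \<in> Neg ` {1..m}" by auto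
qed

abbreviation right_factor :: "complex mat" where
  "right_factor \<equiv> elem_prod m n \<sigma>2 X2 * elem_prod m n \<tau>2 Y2"

lemma has_inverse_factors:
  "has_inverse (m * n) (elem_prod m n \<sigma>2 X2)" "has_inverse (m * n) (elem_prod m n \<tau>2 Y2)"
  using \<sigma>2_Pos \<tau>2_Neg X2 Y2 by (auto intro!: has_inverse_elem_prod)

lemma has_inverse_right_factor: "has_inverse (m * n) right_factor"
  by (intro has_inverse_mult has_inverse_factors)

lemma assignments: "matrix_assignment n \<sigma>2 X2" "matrix_assignment n \<tau>2 Y2"
  using X2 Y2 unfolding nonsingular_assignment_def by auto

lemma right_factor_mult_vec:
  assumes x: "x \<in> carrier_vec (m * n)"
  shows "right_factor *\<^sub>v x = elem_prod m n \<sigma>2 X2 *\<^sub>v (elem_prod m n \<tau>2 Y2 *\<^sub>v x)"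
    and "elem_prod m n \<tau>2 Y2 *\<^sub>v x \<in> carrier_vec (m * n)"
  using has_inverse_factors x unfolding has_inverse_def
  by (auto simp: assoc_mult_mat_vec[of _ "m * n" "m * n" _ "m * n"])

lemma wire_\<sigma>2_untouched:
  assumes y: "y \<in> carrier_vec (m * n)" and w: "1 \<le> w" "w \<le> m"
    and "\<And>i. Pos i \<in> set \<sigma>2 \<Longrightarrow> i \<noteq> w \<and> Suc i \<noteq> w"
  shows "wire m n (elem_prod m n \<sigma>2 X2 *\<^sub>v y) w = wire m n y w"
proof (rule wire_elem_prod_untouched[OF _ assignments(1) y w])
  fix t assume t: "t \<in> set \<sigma>2"
  then obtain i where "t = Pos i" using \<sigma>2_Pos by auto
  then show "num t \<noteq> w \<and> Suc (num t) \<noteq> w" using t assms(4) by simp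
qed (use \<sigma>2_Pos in auto)

lemma wire_\<tau>2_untouched:
  assumes y: "y \<in> carrier_vec (m * n)" and w: "1 \<le> w" "w \<le> m"
    and "\<And>i. Neg i \<in> set \<tau>2 \<Longrightarrow> i \<noteq> w \<and> Suc i \<noteq> w"
  shows "wire m n (elem_prod m n \<tau>2 Y2 *\<^sub>v y) w = wire m n y w"
proof (rule wire_elem_prod_untouched[OF _ assignments(2) y w])
  fix t assume t: "t \<in> set \<tau>2"
  then obtain i where "t = Neg i" using \<tau>2_Neg by auto
  then show "num t \<noteq> w \<and> Suc (num t) \<noteq> w" using t assms(4) by simp
qed (use \<tau>2_Neg in auto)

text \<open>The value stands on wire \<open>r + s + 1\<close> of \<open>y\<close>, climbs in \<open>\<sigma>2\<close> to wire \<open>k' + 1\<close>, where \<open>k'\<close> is the index that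
  the run in \<open>(\<sigma>, \<sigma>2)\<close> attains, and is not touched by \<open>\<tau>2\<close>: since \<open>k'\<close> is in \<open>\<sigma>\<close>, the letter \<open>-k'\<close> is
  absent from \<open>\<tau>\<close> and so \<open>-(k' + 1)\<close> cannot be repeated.\<close>
lemma recover_inner:
  assumes x: "x \<in> carrier_vec (m * n)" and p: "ports_of z (right_factor *\<^sub>v x) a b c"
    and k: "run_len (Pos r) \<sigma> = Suc s" "r + s < m"
  shows "block_row m n (int m - (int r + consecutions (Pos r) (\<sigma> @ \<sigma>2))) *\<^sub>v x = c r"
proof -
  let ?y = "elem_prod m n \<tau>2 Y2 *\<^sub>v x"
  define k' where "k' = r + s + run_len (Pos (Suc (r + s))) \<sigma>2"
  note N = right_factor_mult_vec[OF x]
  have mem: "Pos (r + s) \<in> set \<sigma>" by (rule set_of_run_len_Pos) (use k in simp)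
  then obtain \<alpha> \<gamma> where \<sigma>_split: "\<sigma> = \<alpha> @ Pos (r + s) # \<gamma>" by (meson split_list)
  have "Pos (Suc (r + s)) \<notin> set \<gamma>"
  proof
    assume "Pos (Suc (r + s)) \<in> set \<gamma>"
    then have "subseq [Pos (r + s), Pos (Suc (r + s))] (Pos (r + s) # \<gamma>)"
      by (simp add: subseq_singleton_left)
    then have "subseq [Pos (r + s), Pos (Suc (r + s))] \<sigma>"
      unfolding \<sigma>_split by (rule subseq_drop_many)
    then show False using not_subseq_of_run_len_Pos[OF distinct_\<sigma> k(1)] by simp
  qed
  moreover have "SIP (Pos (r + s) # \<gamma> @ \<sigma>2)"
    using SIP_\<sigma> SIP_infix[of \<alpha> "Pos (r + s) # \<gamma> @ \<sigma>2" "[]"] \<sigma>_split by simp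
  ultimately have "wire m n (elem_prod m n \<sigma>2 X2 *\<^sub>v ?y) (Suc (r + s)) =
      wire m n ?y (Suc (r + s) + run_len (Pos (Suc (r + s))) \<sigma>2)"
    by (intro wire_elem_prod_Pos[OF _ _ \<sigma>2_Pos assignments(1) k(2) N(2)])
  then have 1: "wire m n ?y (Suc k') = c r"
    using node_at_run_end(1)[OF p k] N(1) by (simp add: k'_def)
  have k'_mem: "Pos k' \<in> set \<sigma>" "k' < m"
  proof -
    consider "run_len (Pos (Suc (r + s))) \<sigma>2 = 0" | i where "run_len (Pos (Suc (r + s))) \<sigma>2 = Suc i"
      by (cases "run_len (Pos (Suc (r + s))) \<sigma>2") auto
    then have "Pos k' \<in> set \<sigma> \<and> k' < m"
    proof cases
      case 1
      then show ?thesis using mem k(2) by (simp add: k'_def)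
    next
      case (2 i)
      then have "Pos (Suc (r + s) + i) \<in> set \<sigma>2" by (intro set_of_run_len_Pos) simp
      then have "Pos k' \<in> set \<sigma>2" using 2 by (simp add: k'_def)
      then show ?thesis using \<sigma>2 \<sigma>2_Pos by auto
    qed
    then show "Pos k' \<in> set \<sigma>" "k' < m" by auto
  qed
  have "Neg k' \<notin> set \<tau>" using split[of k'] k'_mem by simp
  then have "i \<noteq> Suc k' \<and> Suc i \<noteq> Suc k'" if "Neg i \<in> set \<tau>2" for i
    using that \<tau>2 SIP_later_needs_succ[OF SIP_\<tau>, of "Neg i"] by (auto simp: is_succ_Neg)
  then have 2: "wire m n ?y (Suc k') = wire m n x (Suc k')"
    using k'_mem by (intro wire_\<tau>2_untouched[OF x]) auto
  have "int r + consecutions (Pos r) (\<sigma> @ \<sigma>2) = int k'"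
    using k(1) by (simp add: consecutions_run_len run_len_Pos_append k'_def)
  then show ?thesis using 1 2 block_row_mult_vec[OF x, of "Suc k'"] k'_mem by simp
qed

lemma mat_inv_block_row_mult_vec:
  assumes "M \<in> carrier_mat n n" "invertible_mat M" "x \<in> carrier_vec (m * n)"
  shows "(mat_inv M * block_row m n j) *\<^sub>v x = mat_inv M *\<^sub>v (block_row m n j *\<^sub>v x)"
  using mat_inv_invertible[OF assms(1,2)] assms(3)
  by (intro assoc_mult_mat_vec[of _ n n _ "m * n"]) auto

text \<open>The run reaches \<open>m\<close>, so the top wire carries \<open>A\<^sub>m\<close> times the value. The indices \<open>m - 1\<close> and \<open>m\<close> do
  not occur in \<open>\<sigma>2\<close>, and in \<open>\<tau>2\<close> the value descends along the consecutions of \<open>-(m - 1)\<close>.\<close>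
lemma recover_top:
  assumes x: "x \<in> carrier_vec (m * n)" and p: "ports_of z (right_factor *\<^sub>v x) a b c"
    and k: "run_len (Pos r) \<sigma> = Suc s" "r + s = m" "0 < s \<or> Pos (m - 1) \<notin> set \<sigma>"
  shows "(mat_inv (A m) * block_row m n (consecutions (Neg (m - 1)) \<tau>2 + 2)) *\<^sub>v x = c r"
proof -
  let ?y = "elem_prod m n \<tau>2 Y2 *\<^sub>v x"
  note N = right_factor_mult_vec[OF x]
  have Am': "Pos m \<in> set \<sigma>" using set_of_run_len_Pos[of s r \<sigma>] k by simp
  have m: "Suc (m - 1) = m" using m2 by simp
  have "i \<noteq> m \<and> Suc i \<noteq> m" if "Pos i \<in> set \<sigma>2" for i
    using that \<sigma>2 by auto
  then have "wire m n (elem_prod m n \<sigma>2 X2 *\<^sub>v ?y) m = wire m n ?y m"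
    using m2 by (intro wire_\<sigma>2_untouched[OF N(2)]) auto
  then have 1: "wire m n ?y m = A m *\<^sub>v c r"
    using node_at_run_end(2)[OF p k(1,2,3)] N(1) by simp
  have "Neg m \<notin> set \<tau>2" using Am' split[of m] \<tau>2 by auto
  moreover have "SIP \<tau>2" using SIP_\<tau> SIP_infix[of \<tau> \<tau>2 "[]"] by simp
  \<comment> \<open>The absent letter \<open>-m\<close> may be put in front, as a start of the descent.\<close>
  ultimately have "SIP (Neg (Suc (m - 1)) # [] @ \<tau>2)" using SIP_fresh_Cons m by simp
  then have 2: "wire m n ?y m = wire m n x (m - run_len (Neg (m - 1)) \<tau>2)" "run_len (Neg (m - 1)) \<tau>2 < m"
    using wire_elem_prod_Neg[OF _ _ \<tau>2_Neg assignments(2) _ x, of "m - 1" "[]"] m m2 by auto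
  have cr: "c r \<in> carrier_vec n"
    using p k(2) unfolding ports_of_def port_def by auto
  have "consecutions (Neg (m - 1)) \<tau>2 + 2 = int m - int (m - run_len (Neg (m - 1)) \<tau>2) + 1"
    using 2(2) by (simp add: consecutions_run_len)
  from block_row_mult_vec[OF x _ _ this]
  have "block_row m n (consecutions (Neg (m - 1)) \<tau>2 + 2) *\<^sub>v x = A m *\<^sub>v c r"
    using 1 2 by simp
  then show ?thesis
    using mat_inv_block_row_mult_vec[OF A[OF order.refl] Am[OF Am'] x] mat_inv_mult_vec(1)[OF A[OF order.refl] Am[OF Am'] cr]
    by simp
qed

lemma subseq_\<omega>_\<tau>: "subseq [Pos i, Pos j] \<omega> \<longleftrightarrow> subseq [Neg i, Neg j] \<tau>"
proof
  assume "subseq [Pos i, Pos j] \<omega>"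
  from subseq_map[OF this, of idx_neg] show "subseq [Neg i, Neg j] \<tau>" by (simp add: \<tau>_\<omega>)
next
  have inv: "idx_neg (idx_neg t) = t" for t by (cases t) auto
  assume "subseq [Neg i, Neg j] \<tau>"
  from subseq_map[OF this, of idx_neg] show "subseq [Pos i, Pos j] \<omega>" by (simp add: \<tau>_\<omega> inv comp_def)
qed

lemma Pos_\<omega>_iff: "Pos i \<in> set \<omega> \<longleftrightarrow> Neg i \<in> set \<tau>"
proof -
  have "idx_neg t = Neg i \<longleftrightarrow> t = Pos i" for t by (cases t) auto
  moreover have "Neg i \<in> set \<tau> \<longleftrightarrow> (\<exists>t \<in> set \<omega>. idx_neg t = Neg i)" unfolding \<tau>_\<omega> by (simp add: image_iff eq_commute)
  ultimately show ?thesis by simp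
qed

text \<open>Along the inversions of \<open>0\<close> in \<open>\<omega>\<close>, which \<open>\<tau>\<close> inherits, the value \<open>c\<^sub>0\<close> does not change; the step out of
  this run multiplies it by \<open>z\<close>.\<close>
lemma inversion_run:
  assumes p: "ports_of z y a b c" and k: "run_len (Pos 0) (rev \<omega>) = Suc i"
  shows "i \<le> m" "c i = c 0" "\<And>j. j \<le> i \<Longrightarrow> Pos j \<notin> set \<sigma>"
    "i < m \<Longrightarrow> c (Suc i) = z \<cdot>\<^sub>v c 0"
    "i < m \<Longrightarrow> Pos (Suc i) \<notin> set \<sigma> \<Longrightarrow> wire m n y (Suc i) = c (Suc i)"
    "i = m \<Longrightarrow> wire m n y 1 = b 0"
    "\<not> subseq [Neg (Suc i), Neg i] \<tau>"
proof -
  have mem: "Neg j \<in> set \<tau>" if "j \<le> i" for j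
    using set_of_run_len_Pos[of j 0 "rev \<omega>"] k that Pos_\<omega>_iff by simp
  show im: "i \<le> m" using mem[of i] \<tau> by auto
  show n\<sigma>: "Pos j \<notin> set \<sigma>" if "j \<le> i" for j using mem[OF that] split[of j] im that by simp
  have sub: "subseq [Neg (Suc j), Neg j] \<tau>" if "j < i" for j
  proof -
    have "subseq [Pos j, Pos (Suc j)] (rev \<omega>)"
      using subseq_of_run_len_Pos[of j 0 "rev \<omega>"] k that by simp
    from subseq_rev[OF this] show ?thesis by (simp add: subseq_\<omega>_\<tau>)
  qed
  have stay: "stay j" if "j < i" for j
    using n\<sigma>[of j] n\<sigma>[of "Suc j"] subseq_pair_antisym[OF distinct_\<tau> sub[OF that]] that
    by (simp add: stay_def)
  have link: "link z a b c j" if "j < m" for j using p that unfolding ports_of_def by auto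
  have "c j = c 0" if "j \<le> i" for j
    using that
  proof (induction j)
    case (Suc j)
    then show ?case using link[of j] stay[of j] im by (simp add: link_def)
  qed simp
  then show ci: "c i = c 0" by blast
  have d\<omega>: "distinct (rev \<omega>)" using distinct_\<tau> by (simp add: \<tau>_\<omega> distinct_map)
  show nsub: "\<not> subseq [Neg (Suc i), Neg i] \<tau>"
  proof
    assume "subseq [Neg (Suc i), Neg i] \<tau>"
    then have "subseq [Pos i, Pos (Suc i)] (rev \<omega>)" using subseq_rev[of "[Pos (Suc i), Pos i]" \<omega>] by (simp add: subseq_\<omega>_\<tau>)
    then show False using not_subseq_of_run_len_Pos[OF d\<omega> k] by simp
  qed
  have leave: "\<not> stay i" if "i < m"
  proof (cases "Pos (Suc i) \<in> set \<sigma>")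
    case False
    then have "subseq [Neg i, Neg (Suc i)] \<tau>"
      using subseq_pair_total[of "Neg i" \<tau> "Neg (Suc i)"] nsub mem[of i] split[of "Suc i"] that by auto
    then show ?thesis using n\<sigma>[of i] by (simp add: stay_def)
  qed (use n\<sigma>[of i] in \<open>simp add: stay_def\<close>)
  show "c (Suc i) = z \<cdot>\<^sub>v c 0" if "i < m" using link[OF that] leave[OF that] ci by (simp add: link_def)
  show "wire m n y (Suc i) = c (Suc i)" if "i < m" "Pos (Suc i) \<notin> set \<sigma>"
    using p that leave[OF that(1)] n\<sigma>[of i] unfolding ports_of_def by (simp add: node_def)
  show "wire m n y 1 = b 0" if "i = m"
    using p that stay[of 0] n\<sigma>[of 0] m2 unfolding ports_of_def by (simp add: node_def)
qed

text \<open>The run in \<open>\<omega>\<close> ends because \<open>i + 1\<close> stands to the right of \<open>i\<close> in \<open>\<omega>\<close>. Wire \<open>i + 1\<close> then carries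
  \<open>c\<^bsub>i+1\<^esub>\<close>; the tuple \<open>\<sigma>2\<close> does not touch it, and in \<open>\<tau>2\<close> it descends along the consecutions of \<open>-i\<close>.\<close>
lemma recover_descent:
  assumes x: "x \<in> carrier_vec (m * n)" and p: "ports_of z (right_factor *\<^sub>v x) a b c"
    and k: "run_len (Pos 0) (rev \<omega>) = Suc i" "i < m" "Pos (Suc i) \<notin> set \<sigma>"
  shows "block_row m n (int m - (int i - consecutions (Neg i) \<tau>2 - 1)) *\<^sub>v x = c (Suc i)"
proof -
  let ?y = "elem_prod m n \<tau>2 Y2 *\<^sub>v x"
  note N = right_factor_mult_vec[OF x]
  note run = inversion_run[OF p k(1)]
  have "j \<noteq> Suc i \<and> Suc j \<noteq> Suc i" if "Pos j \<in> set \<sigma>2" for j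
    using that \<sigma>2 k(3) run(3)[of i] by auto
  then have "wire m n (elem_prod m n \<sigma>2 X2 *\<^sub>v ?y) (Suc i) = wire m n ?y (Suc i)"
    using k(2) by (intro wire_\<sigma>2_untouched[OF N(2)]) auto
  then have 1: "wire m n ?y (Suc i) = c (Suc i)" using run(5)[OF k(2,3)] N(1) by simp
  have "Neg (Suc i) \<in> set \<tau>" using split[of "Suc i"] k by simp
  then obtain \<alpha> \<gamma> where \<tau>_split: "\<tau> = \<alpha> @ Neg (Suc i) # \<gamma>" by (meson split_list)
  have "Neg i \<notin> set \<gamma>"
  proof
    assume "Neg i \<in> set \<gamma>"
    then have "subseq [Neg (Suc i), Neg i] (Neg (Suc i) # \<gamma>)" by (simp add: subseq_singleton_left)
    then have "subseq [Neg (Suc i), Neg i] \<tau>" unfolding \<tau>_split by (rule subseq_drop_many)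
    then show False using run(7) by simp
  qed
  moreover have "SIP (Neg (Suc i) # \<gamma> @ \<tau>2)"
    using SIP_\<tau> SIP_infix[of \<alpha> "Neg (Suc i) # \<gamma> @ \<tau>2" "[]"] \<tau>_split by simp
  ultimately have 2: "wire m n ?y (Suc i) = wire m n x (Suc i - run_len (Neg i) \<tau>2)" "run_len (Neg i) \<tau>2 \<le> i"
    using wire_elem_prod_Neg[OF _ _ \<tau>2_Neg assignments(2) k(2) x] by auto
  have "int m - (int i - consecutions (Neg i) \<tau>2 - 1) = int m - int (Suc i - run_len (Neg i) \<tau>2) + 1"
    using 2(2) by (simp add: consecutions_run_len)
  from block_row_mult_vec[OF x _ _ this] show ?thesis using 1 2 k(2) by simp
qed

text \<open>Here \<open>\<sigma>\<close> is empty and wire \<open>1\<close>, which no letter of \<open>\<tau>2\<close> touches, carries \<open>b\<^sub>0 = -A\<^sub>0 c\<^sub>0\<close>.\<close>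
lemma recover_bottom:
  assumes x: "x \<in> carrier_vec (m * n)" and p: "ports_of z (right_factor *\<^sub>v x) a b c"
    and k: "run_len (Pos 0) (rev \<omega>) = Suc m"
  shows "(mat_inv (A 0) * block_row m n (int m)) *\<^sub>v x = - c 0"
proof -
  let ?y = "elem_prod m n \<tau>2 Y2 *\<^sub>v x"
  note N = right_factor_mult_vec[OF x]
  note run = inversion_run[OF p k]
  have A0': "A 0 \<in> carrier_mat n n" "invertible_mat (A 0)"
    using A A0 split[of 0] run(3)[of 0] by auto
  have m1: "1 \<le> m" using m2 by simp
  have "j \<noteq> 1 \<and> Suc j \<noteq> 1" if "Pos j \<in> set \<sigma>2" for j
    using that \<sigma>2 run(3)[of j] m1 by auto
  then have "wire m n (elem_prod m n \<sigma>2 X2 *\<^sub>v ?y) 1 = wire m n ?y 1"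
    by (intro wire_\<sigma>2_untouched[OF N(2)] order.refl m1) auto
  moreover have "j \<noteq> 1 \<and> Suc j \<noteq> 1" if "Neg j \<in> set \<tau>2" for j
    using that \<tau>2 by auto
  then have "wire m n ?y 1 = wire m n x 1"
    by (intro wire_\<tau>2_untouched[OF x] order.refl m1) auto
  ultimately have 1: "wire m n x 1 = b 0" using run(6) N(1) by simp
  have c: "c 0 \<in> carrier_vec n" "b 0 \<in> carrier_vec n" "b 0 + A 0 *\<^sub>v c 0 = 0\<^sub>v n"
    using p unfolding ports_of_def port_def by (metis le0)+
  have b: "b 0 = A 0 *\<^sub>v (- c 0)"
  proof -
    have "A 0 *\<^sub>v (- c 0) = - (A 0 *\<^sub>v c 0)" using mult_uminus_vec[OF A0'(1) c(1)] .
    also have "\<dots> = (b 0 + A 0 *\<^sub>v c 0) + - (A 0 *\<^sub>v c 0)" unfolding c(3) using A0' c by simp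
    also have "\<dots> = b 0" using A0' c(1,2) by (intro eq_vecI) auto
    finally show ?thesis by simp
  qed
  have "block_row m n (int m) *\<^sub>v x = A 0 *\<^sub>v (- c 0)"
    using block_row_mult_vec[OF x order.refl m1, of "int m"] 1 b by simp
  then show ?thesis
    using mat_inv_block_row_mult_vec[OF A0' x] mat_inv_mult_vec(1)[OF A0', of "- c 0"] c(1) by simp
qed

lemma matpoly_at_0: "v \<in> carrier_vec n \<Longrightarrow> k \<le> m \<Longrightarrow> matpoly k n A 0 *\<^sub>v v = A 0 *\<^sub>v v"
proof (induction k)
  case (Suc k)
  have "matpoly (Suc k) n A 0 *\<^sub>v v = A 0 *\<^sub>v v + 0 \<cdot>\<^sub>v (A (Suc k) *\<^sub>v v)"
    using matpoly_Suc_mult_vec[of A k n v 0] A[of "Suc k"] Suc by simp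
  then show ?case using A[of "Suc k"] A[of 0] Suc.prems by (auto intro!: eq_vecI)
qed (use matpoly_0_mult_vec A[of 0] in simp)

text \<open>The factor is \<open>1\<close> if \<open>0 \<in> \<sigma>\<close>, and otherwise \<open>-1\<close> or \<open>z\<close>. If \<open>z = 0\<close> in the last case, then \<open>A\<^sub>0 c\<^sub>0 = 0\<close> with
  \<open>A\<^sub>0\<close> invertible, so that \<open>c\<^sub>0 = 0\<close> and any factor will do.\<close>
lemma recovery_mat_scales:
  "\<exists>\<epsilon>. \<epsilon> \<noteq> 0 \<and> (\<forall>x a b c. x \<in> carrier_vec (m * n) \<longrightarrow> ports_of z (right_factor *\<^sub>v x) a b c \<longrightarrow>
     recovery_mat m n A \<sigma> \<omega> \<sigma>2 \<tau>2 *\<^sub>v x = \<epsilon> \<cdot>\<^sub>v c 0)"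
proof (cases "Pos 0 \<in> set \<sigma>")
  case True
  then obtain s where s: "run_len (Pos 0) \<sigma> = Suc s"
    using run_len_eq_0_iff by (cases "run_len (Pos 0) \<sigma>") auto
  have cs: "consecutions (Pos 0) \<sigma> = int s" using s by (simp add: consecutions_run_len)
  have "recovery_mat m n A \<sigma> \<omega> \<sigma>2 \<tau>2 *\<^sub>v x = 1 \<cdot>\<^sub>v c 0"
    if x: "x \<in> carrier_vec (m * n)" and p: "ports_of z (right_factor *\<^sub>v x) a b c" for x a b c
  proof (cases "s < m")
    case True
    then show ?thesis using recover_inner[OF x p s] \<open>Pos 0 \<in> set \<sigma>\<close> cs by (simp add: recovery_mat_def)
  next
    case False
    then have sm: "s = m" using node_at_run_end(3)[OF p s] by simp
    have "Pos (m - 1) \<in> set \<sigma>" using set_of_run_len_Pos[of "m - 1" 0 \<sigma>] s sm by simp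
    then have "Neg (m - 1) \<notin> set \<tau>2" using split[of "m - 1"] \<tau>2 by auto
    then have "consecutions (Neg (m - 1)) \<tau>2 = -1" by (simp add: consecutions_def)
    then show ?thesis using recover_top[OF x p s] sm m2 \<open>Pos 0 \<in> set \<sigma>\<close> cs
      by (simp add: recovery_mat_def)
  qed
  then show ?thesis by (intro exI[of _ 1]) auto
next
  case False
  then have "Pos 0 \<in> set (rev \<omega>)" using split[of 0] Pos_\<omega>_iff by simp
  then obtain i where i: "run_len (Pos 0) (rev \<omega>) = Suc i"
    using run_len_eq_0_iff by (cases "run_len (Pos 0) (rev \<omega>)") auto
  have ci: "inversions (Pos 0) \<omega> = int i" using i by (simp add: consecutions_run_len inversions_rev)
  have A0': "A 0 \<in> carrier_mat n n" "invertible_mat (A 0)" using A A0 split[of 0] False by auto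
  define \<epsilon> where "\<epsilon> = (if i = m then - 1 else if z = 0 then 1 else z)"
  have "recovery_mat m n A \<sigma> \<omega> \<sigma>2 \<tau>2 *\<^sub>v x = \<epsilon> \<cdot>\<^sub>v c 0"
    if x: "x \<in> carrier_vec (m * n)" and p: "ports_of z (right_factor *\<^sub>v x) a b c" for x a b c
  proof -
    note run = inversion_run[OF p i]
    note c0 = ports_of_matpoly[OF p]
    show ?thesis
    proof (cases "i = m")
      case True
      then have "recovery_mat m n A \<sigma> \<omega> \<sigma>2 \<tau>2 *\<^sub>v x = - c 0"
        using recover_bottom[OF x p] i False ci by (simp add: recovery_mat_def)
      then show ?thesis using True c0(1) by (auto simp: \<epsilon>_def intro!: eq_vecI)
    next
      case im: False
      then have im': "i < m" using run(1) by simp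
      have "z \<cdot>\<^sub>v c 0 = \<epsilon> \<cdot>\<^sub>v c 0"
      proof (cases "z = 0")
        case True
        then have "A 0 *\<^sub>v c 0 = 0\<^sub>v n" using c0 matpoly_at_0[of "c 0" m] by simp
        then have "c 0 = 0\<^sub>v n" using mat_inv_mult_vec(1)[OF A0' c0(1)] mat_inv_invertible(1)[OF A0']
          by (simp add: mult_zero_vec)
        then show ?thesis by (auto intro!: eq_vecI)
      qed (simp add: \<epsilon>_def im)
      then have c: "c (Suc i) = \<epsilon> \<cdot>\<^sub>v c 0" using run(4)[OF im'] by simp
      have nat: "nat (int i + 1) = Suc i" by simp
      show ?thesis
      proof (cases "Pos (Suc i) \<in> set \<sigma>")
        case False
        then show ?thesis using recover_descent[OF x p i im' False] \<open>Pos 0 \<notin> set \<sigma>\<close> ci c im nat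
          by (simp add: recovery_mat_def Let_def del: of_nat_Suc)
      next
        case True
        then obtain s where s: "run_len (Pos (Suc i)) \<sigma> = Suc s"
          using run_len_eq_0_iff by (cases "run_len (Pos (Suc i)) \<sigma>") auto
        have cs: "consecutions (Pos (Suc i)) \<sigma> = int s" using s by (simp add: consecutions_run_len)
        show ?thesis
        proof (cases "Suc i + s < m")
          case True
          have eq: "int (Suc i) + consecutions (Pos (Suc i)) (\<sigma> @ \<sigma>2) = int i + consecutions (Pos (Suc i)) (\<sigma> @ \<sigma>2) + 1"
            by simp
          then show ?thesis
            using recover_inner[OF x p s True, unfolded eq] \<open>Pos 0 \<notin> set \<sigma>\<close> \<open>Pos (Suc i) \<in> set \<sigma>\<close> ci c cs im nat True
            by (simp add: recovery_mat_def Let_def del: of_nat_Suc)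
        next
          case False
          then have sm: "Suc i + s = m" using node_at_run_end(3)[OF p s] by simp
          then have "0 < s \<or> Pos (m - 1) \<notin> set \<sigma>" using run(3)[of i] by (cases s) auto
          then show ?thesis
            using recover_top[OF x p s sm] \<open>Pos 0 \<notin> set \<sigma>\<close> \<open>Pos (Suc i) \<in> set \<sigma>\<close> ci c cs im nat False
            by (simp add: recovery_mat_def Let_def del: of_nat_Suc)
        qed
      qed
    qed
  qed
  then show ?thesis by (intro exI[of _ \<epsilon>]) (auto simp: \<epsilon>_def)
qed

end


section \<open>Isomorphisms of null spaces\<close>

lemma right_null_space_vectorspace: "vectorspace class_ring (right_null_space B)"
proof -
  interpret kernel "dim_row B" "dim_col B" B by unfold_locales auto
  show ?thesis unfolding right_null_space_def by (rule Ker.vectorspace_axioms)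
qed

lemma linear_iso_mult_vec:
  assumes F: "F \<in> carrier_mat (dim_col C) (dim_col B)"
    and bij: "bij_betw (\<lambda>x. F *\<^sub>v x) (mat_kernel B) (mat_kernel C)"
  shows "linear_iso (right_null_space B) (right_null_space C) (\<lambda>x. F *\<^sub>v x)"
proof -
  have ker: "mat_kernel B \<subseteq> carrier_vec (dim_col B)" by (auto simp: mat_kernel_def)
  interpret V: vectorspace class_ring "right_null_space B" by (rule right_null_space_vectorspace)
  interpret W: vectorspace class_ring "right_null_space C" by (rule right_null_space_vectorspace)
  have "(\<lambda>x. F *\<^sub>v x) \<in> LinearCombinations.module_hom class_ring (right_null_space B) (right_null_space C)"
    unfolding LinearCombinations.module_hom_def
    using bij_betw_imp_funcset[OF bij] ker F
    by (auto simp: right_null_space_def module_vec_simps mult_add_distrib_mat_vec[OF F] mult_mat_vec[OF F] subset_iff)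
  then have "linear_map class_ring (right_null_space B) (right_null_space C) (\<lambda>x. F *\<^sub>v x)"
    by (intro linear_map.intro mod_hom.intro mod_hom_axioms.intro) unfold_locales
  then show ?thesis unfolding linear_iso_def using bij by (simp add: right_null_space_def)
qed

lemma columns_form_basis_image:
  assumes iso: "linear_iso V W (\<lambda>x. F *\<^sub>v x)" and Z: "Z \<in> carrier_mat d p" and F: "F \<in> carrier_mat e d"
    and basis: "columns_form_basis Z V"
  shows "columns_form_basis (F * Z) W"
proof -
  interpret linear_map class_ring V W "\<lambda>x. F *\<^sub>v x" using iso unfolding linear_iso_def by simp
  have bij: "inj_on (\<lambda>x. F *\<^sub>v x) (carrier V)" "(\<lambda>x. F *\<^sub>v x) ` carrier V = carrier W"
    using iso unfolding linear_iso_def by (auto simp: bij_betw_def)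
  have b: "V.basis (set (cols Z))" "distinct (cols Z)" using basis unfolding columns_form_basis_def by auto
  have cols: "cols (F * Z) = map (\<lambda>x. F *\<^sub>v x) (cols Z)"
    using F Z by (intro nth_equalityI) (auto simp: col_mult2[OF F Z])
  have sub: "set (cols Z) \<subseteq> carrier V" using b(1) unfolding V.basis_def by simp
  have "V.fin_dim" unfolding V.fin_dim_def using b(1) unfolding V.basis_def by auto
  from linear_inj_image_is_basis[OF bij b(1) this]
  have "W.basis (set (cols (F * Z)))" unfolding cols by simp
  moreover have "distinct (cols (F * Z))"
    unfolding cols using b(2) inj_on_subset[OF bij(1) sub] by (simp add: distinct_map)
  ultimately show ?thesis unfolding columns_form_basis_def by simp
qed

context egfp_right
begin

lemma run_top: "run_len (Pos r) \<sigma> = Suc s \<Longrightarrow> r + s \<le> m \<and> Pos (r + s) \<in> set \<sigma>"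
  using set_of_run_len_Pos[of s r \<sigma>] \<sigma> by auto

lemma consecutions_top: "int r + consecutions (Pos r) \<sigma> \<ge> int m \<Longrightarrow> r \<le> m \<Longrightarrow> Pos r \<in> set \<sigma> \<Longrightarrow> Pos m \<in> set \<sigma>"
proof -
  assume le: "int r + consecutions (Pos r) \<sigma> \<ge> int m" and "r \<le> m" and r: "Pos r \<in> set \<sigma>"
  obtain s where s: "run_len (Pos r) \<sigma> = Suc s" using r run_len_eq_0_iff by (cases "run_len (Pos r) \<sigma>") auto
  then have "r + s = m" using run_top[OF s] le by (simp add: consecutions_run_len)
  then show ?thesis using run_top[OF s] by simp
qed

lemma recovery_mat_carrier: "recovery_mat m n A \<sigma> \<omega> \<sigma>2 \<tau>2 \<in> carrier_mat n (m * n)"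
proof -
  have inv_m: "mat_inv (A m) \<in> carrier_mat n n" if "Pos m \<in> set \<sigma>"
    by (rule mat_inv_invertible(1)[OF A[OF order.refl] Am[OF that]])
  have inv_0: "mat_inv (A 0) \<in> carrier_mat n n" if "Pos 0 \<notin> set \<sigma>"
    by (rule mat_inv_invertible(1)[OF A[OF le0] A0]) (use split[of 0] that in simp)
  show ?thesis
  proof (cases "Pos 0 \<in> set \<sigma>")
    case True
    then show ?thesis using inv_m consecutions_top[of 0] unfolding recovery_mat_def
      by (auto intro!: mult_carrier_mat[of _ n n])
  next
    case False
    then have "Pos 0 \<in> set (rev \<omega>)" using split[of 0] Pos_\<omega>_iff by simp
    then obtain i where i: "run_len (Pos 0) (rev \<omega>) = Suc i"
      using run_len_eq_0_iff by (cases "run_len (Pos 0) (rev \<omega>)") auto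
    have ci: "inversions (Pos 0) \<omega> = int i" using i by (simp add: consecutions_run_len inversions_rev)
    have nat: "nat (int i + 1) = Suc i" by simp
    have "Neg i \<in> set \<tau>" using set_of_run_len_Pos[of i 0 "rev \<omega>"] i Pos_\<omega>_iff by simp
    then have "i \<le> m" using \<tau> by auto
    then have "Pos m \<in> set \<sigma>" if "Pos (Suc i) \<in> set \<sigma>" "\<not> int i + consecutions (Pos (Suc i)) \<sigma> + 1 < int m"
      using consecutions_top[of "Suc i"] that \<sigma> by auto
    then show ?thesis using False inv_0 inv_m unfolding recovery_mat_def Let_def ci nat
      by (auto intro!: mult_carrier_mat[of _ n n])
  qed
qed

text \<open>Every \<open>x\<close> in the kernel is sent to a nonzero multiple of the \<open>c\<^sub>0\<close> that belongs to it, with a factor that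
  depends only on the pencil. So injectivity and surjectivity are those of \<open>y \<mapsto> c\<^sub>0\<close>.\<close>
lemma linear_iso_recovery_mat:
  assumes W: "has_inverse (m * n) T1" "has_inverse (m * n) S1"
  shows "linear_iso (right_null_space (T1 * S1 * pencil z * elem_prod m n \<sigma>2 X2 * elem_prod m n \<tau>2 Y2))
    (right_null_space (matpoly m n A z)) (\<lambda>x. recovery_mat m n A \<sigma> \<omega> \<sigma>2 \<tau>2 *\<^sub>v x)"
proof -
  define R where "R = recovery_mat m n A \<sigma> \<omega> \<sigma>2 \<tau>2"
  define L where "L = T1 * S1 * pencil z * elem_prod m n \<sigma>2 X2 * elem_prod m n \<tau>2 Y2"
  obtain \<epsilon> where \<epsilon>: "\<epsilon> \<noteq> 0"
    "\<And>x a b c. x \<in> carrier_vec (m * n) \<Longrightarrow> ports_of z (right_factor *\<^sub>v x) a b c \<Longrightarrow> R *\<^sub>v x = \<epsilon> \<cdot>\<^sub>v c 0"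
    using recovery_mat_scales[of z] unfolding R_def by auto
  have W': "has_inverse (m * n) (T1 * S1)" by (rule has_inverse_mult[OF W])
  have c: "T1 * S1 \<in> carrier_mat (m * n) (m * n)" "pencil z \<in> carrier_mat (m * n) (m * n)"
    "elem_prod m n \<sigma>2 X2 \<in> carrier_mat (m * n) (m * n)" "elem_prod m n \<tau>2 Y2 \<in> carrier_mat (m * n) (m * n)"
    using W' has_inverse_factors fiedler_prod_carrier[OF legal_\<sigma>] fiedler_prod_carrier[OF legal_\<tau>]
    unfolding has_inverse_def by auto
  have L: "L \<in> carrier_mat (m * n) (m * n)" unfolding L_def
    by (rule mult_carrier_mat[OF mult_carrier_mat[OF mult_carrier_mat[OF c(1,2)] c(3)] c(4)])
  have N: "right_factor \<in> carrier_mat (m * n) (m * n)"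
    using has_inverse_right_factor unfolding has_inverse_def by simp
  have ker: "x \<in> mat_kernel L \<longleftrightarrow> x \<in> carrier_vec (m * n) \<and> (\<exists>a b c. ports_of z (right_factor *\<^sub>v x) a b c)" for x
  proof -
    have "L *\<^sub>v x = (T1 * S1) *\<^sub>v (pencil z *\<^sub>v (right_factor *\<^sub>v x))" "right_factor *\<^sub>v x \<in> carrier_vec (m * n)"
      "pencil z *\<^sub>v (right_factor *\<^sub>v x) \<in> carrier_vec (m * n)" if x: "x \<in> carrier_vec (m * n)"
    proof -
      have "L = (T1 * S1) * (pencil z * right_factor)"
        unfolding L_def using c assoc_mult_mat[of "T1 * S1" "m * n" "m * n" "pencil z" "m * n" "elem_prod m n \<sigma>2 X2" "m * n"]
          assoc_mult_mat[of "T1 * S1" "m * n" "m * n" "pencil z * elem_prod m n \<sigma>2 X2" "m * n" "elem_prod m n \<tau>2 Y2" "m * n"]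
          assoc_mult_mat[of "pencil z" "m * n" "m * n" "elem_prod m n \<sigma>2 X2" "m * n" "elem_prod m n \<tau>2 Y2" "m * n"]
        by (simp only: mult_carrier_mat[OF c(2,3)])
      then show "L *\<^sub>v x = (T1 * S1) *\<^sub>v (pencil z *\<^sub>v (right_factor *\<^sub>v x))"
        using assoc_mult_mat_vec[OF c(1) mult_carrier_mat[OF c(2) N] x] assoc_mult_mat_vec[OF c(2) N x] by simp
      show "right_factor *\<^sub>v x \<in> carrier_vec (m * n)" using N x by (rule mult_mat_vec_carrier)
      with c(2) show "pencil z *\<^sub>v (right_factor *\<^sub>v x) \<in> carrier_vec (m * n)" by (rule mult_mat_vec_carrier)
    qed
    note L_x = this
    have "L *\<^sub>v x = 0\<^sub>v (m * n) \<longleftrightarrow> (\<exists>a b c. ports_of z (right_factor *\<^sub>v x) a b c)"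
      if x: "x \<in> carrier_vec (m * n)"
      unfolding L_x(1)[OF x] has_inverse_mult_vec_eq_0[OF W' L_x(3)[OF x]]
      by (rule pencil_kernel_iff[OF L_x(2)[OF x]])
    then show ?thesis unfolding mat_kernel[OF L] by blast
  qed
  have R: "R \<in> carrier_mat n (m * n)" unfolding R_def by (rule recovery_mat_carrier)
  have kerP: "v \<in> mat_kernel (matpoly m n A z) \<longleftrightarrow> v \<in> carrier_vec n \<and> matpoly m n A z *\<^sub>v v = 0\<^sub>v n" for v
    by (simp add: mat_kernel[OF matpoly_carrier])
  have inv: "inverse \<epsilon> \<cdot>\<^sub>v (\<epsilon> \<cdot>\<^sub>v v) = v" "\<epsilon> \<cdot>\<^sub>v (inverse \<epsilon> \<cdot>\<^sub>v v) = v" for v :: "complex vec"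
    using \<epsilon>(1) by (auto simp: smult_smult_assoc)
  have scale: "s \<cdot>\<^sub>v v \<in> mat_kernel (matpoly m n A z)" if "v \<in> mat_kernel (matpoly m n A z)" for s v
    by (rule mat_kernel_smult[OF matpoly_carrier that])
  have "bij_betw (\<lambda>x. R *\<^sub>v x) (mat_kernel L) (mat_kernel (matpoly m n A z))"
  proof (intro bij_betw_imageI inj_onI equalityI subsetI)
    fix x x' assume x: "x \<in> mat_kernel L" and x': "x' \<in> mat_kernel L" and eq: "R *\<^sub>v x = R *\<^sub>v x'"
    have cx: "x \<in> carrier_vec (m * n)" "x' \<in> carrier_vec (m * n)" using x x' ker by auto
    define d where "d = x + - x'"
    have d: "d \<in> carrier_vec (m * n)" using cx by (simp add: d_def)
    have zero: "M *\<^sub>v d = 0\<^sub>v k" if M: "M \<in> carrier_mat k (m * n)" and e: "M *\<^sub>v x = M *\<^sub>v x'" for M :: "complex mat" and k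
    proof -
      have "M *\<^sub>v d = M *\<^sub>v x + M *\<^sub>v (- x')" unfolding d_def using mult_add_distrib_mat_vec[OF M] cx by simp
      also have "M *\<^sub>v (- x') = - (M *\<^sub>v x')"
        using M cx by (intro eq_vecI) auto
      finally show ?thesis unfolding e using M cx by (auto intro!: eq_vecI)
    qed
    have "L *\<^sub>v x = 0\<^sub>v (m * n)" "L *\<^sub>v x' = 0\<^sub>v (m * n)" using x x' unfolding mat_kernel[OF L] by auto
    then have "d \<in> mat_kernel L" using zero[OF L] d unfolding mat_kernel[OF L] by auto
    then obtain a b c where p: "ports_of z (right_factor *\<^sub>v d) a b c" using ker by auto
    have "\<epsilon> \<cdot>\<^sub>v c 0 = 0\<^sub>v n" using zero[OF R eq] \<epsilon>(2)[OF d p] by simp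
    then have "c 0 = inverse \<epsilon> \<cdot>\<^sub>v 0\<^sub>v n" using inv(1)[of "c 0"] by simp
    then have "c 0 = 0\<^sub>v n" by (auto intro!: eq_vecI)
    from ports_of_zero[OF p this] have "d = 0\<^sub>v (m * n)"
      using N d has_inverse_mult_vec_eq_0[OF has_inverse_right_factor d] by auto
    then have "x' + d = x'" using cx by simp
    then show "x = x'" unfolding d_def using vec_cancel(3)[OF cx(1,2)] by simp
  next
    fix v assume "v \<in> (\<lambda>x. R *\<^sub>v x) ` mat_kernel L"
    then obtain x where x: "x \<in> mat_kernel L" "v = R *\<^sub>v x" by auto
    then obtain a b c where p: "ports_of z (right_factor *\<^sub>v x) a b c" "x \<in> carrier_vec (m * n)" using ker by auto
    then show "v \<in> mat_kernel (matpoly m n A z)"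
      using \<epsilon>(2)[OF p(2,1)] ports_of_matpoly[OF p(1)] scale kerP x(2) by simp
  next
    fix v assume v: "v \<in> mat_kernel (matpoly m n A z)"
    then have "inverse \<epsilon> \<cdot>\<^sub>v v \<in> carrier_vec n" "matpoly m n A z *\<^sub>v (inverse \<epsilon> \<cdot>\<^sub>v v) = 0\<^sub>v n"
      using scale kerP by auto
    then obtain y a b c where y: "y \<in> carrier_vec (m * n)" "ports_of z y a b c" "c 0 = inverse \<epsilon> \<cdot>\<^sub>v v"
      by (rule ports_of_exists)
    obtain x where x: "x \<in> carrier_vec (m * n)" "right_factor *\<^sub>v x = y"
      using has_inverse_mult_vec_surj[OF has_inverse_right_factor y(1)] by auto
    have "x \<in> mat_kernel L" using x y(2) ker by auto
    moreover have "R *\<^sub>v x = v" using \<epsilon>(2)[OF x(1)] x(2) y(2,3) inv(2) by simp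
    ultimately show "v \<in> (\<lambda>x. R *\<^sub>v x) ` mat_kernel L" by auto
  qed
  then show ?thesis using linear_iso_mult_vec[of R "matpoly m n A z" L] L R
    unfolding L_def[symmetric] R_def[symmetric] by (auto simp: matpoly_def)
qed

end

lemma right_recovery:
  assumes m: "2 \<le> m" and A: "\<forall>i\<le>m. A i \<in> carrier_mat n n"
    and data: "egfp_data m n A \<sigma> \<omega> \<tau> \<sigma>1 \<sigma>2 \<tau>1 \<tau>2 X1 X2 Y1 Y2"
  shows "egfp_right m n A \<sigma> \<tau> \<omega> \<sigma>2 \<tau>2 X2 Y2"
    and "linear_iso (right_null_space (egfp m n A \<sigma> \<tau> \<sigma>1 \<sigma>2 \<tau>1 \<tau>2 X1 X2 Y1 Y2 z))
      (right_null_space (matpoly m n A z)) (\<lambda>x. recovery_mat m n A \<sigma> \<omega> \<sigma>2 \<tau>2 *\<^sub>v x)"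
proof -
  note d = data[unfolded egfp_data_def]
  have \<tau>: "\<tau> = map idx_neg \<omega>" and dist: "distinct (\<sigma> @ \<omega>)" and set: "set (\<sigma> @ \<omega>) = Pos ` {0..m}"
    using d by auto
  have \<sigma>_sub: "set \<sigma> \<subseteq> Pos ` {..m}" and \<omega>_sub: "set \<omega> \<subseteq> Pos ` {..m}"
    using set unfolding atLeast0AtMost by auto
  have \<tau>_sub: "set \<tau> \<subseteq> Neg ` {..m}" using \<omega>_sub unfolding \<tau> by auto
  have inj: "inj_on idx_neg (set \<omega>)"
  proof (rule inj_onI)
    fix s t assume "idx_neg s = idx_neg t"
    then show "s = t" by (cases s; cases t) auto
  qed
  have mem: "Neg i \<in> set \<tau> \<longleftrightarrow> Pos i \<in> set \<omega>" for i
  proof -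
    have "Neg i \<in> idx_neg ` set \<omega> \<longleftrightarrow> idx_neg (Pos i) \<in> idx_neg ` set \<omega>" by simp
    also have "\<dots> \<longleftrightarrow> Pos i \<in> set \<omega>"
    proof
      assume "idx_neg (Pos i) \<in> idx_neg ` set \<omega>"
      then obtain t where "t \<in> set \<omega>" "Neg i = idx_neg t" by auto
      from this(2) have "t = Pos i" by (cases t) auto
      then show "Pos i \<in> set \<omega>" using \<open>t \<in> set \<omega>\<close> by simp
    qed (rule imageI)
    finally show ?thesis unfolding \<tau> by simp
  qed
  have split: "Neg i \<in> set \<tau> \<longleftrightarrow> Pos i \<notin> set \<sigma>" if "i \<le> m" for i
  proof -
    have "Pos i \<in> set \<sigma> \<or> Pos i \<in> set \<omega>" using set that by auto
    then show ?thesis unfolding mem using dist by auto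
  qed
  have SIP: "SIP (\<sigma> @ \<sigma>2)" "SIP (\<tau> @ \<tau>2)"
    using d SIP_infix[of \<sigma>1 "\<sigma> @ \<sigma>2" "[]"] SIP_infix[of \<tau>1 "\<tau> @ \<tau>2" "[]"] by auto
  show right: "egfp_right m n A \<sigma> \<tau> \<omega> \<sigma>2 \<tau>2 X2 Y2"
  proof
    show "distinct \<tau>" unfolding \<tau> using dist inj by (simp add: distinct_map)
    show "Neg i \<in> set \<tau> \<longleftrightarrow> Pos i \<notin> set \<sigma>" if "i \<le> m" for i by (rule split[OF that])
  qed (use m A d dist SIP \<sigma>_sub \<tau>_sub in auto)
  interpret egfp_right m n A \<sigma> \<tau> \<omega> \<sigma>2 \<tau>2 X2 Y2 by (rule right)
  have sub1: "set \<sigma>1 \<subseteq> set \<sigma> - {Pos (m - 1), Pos m}" "set \<tau>1 \<subseteq> set \<tau> - {Neg 1, Neg 0}"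
    and na1: "nonsingular_assignment m n \<sigma>1 X1" "nonsingular_assignment m n \<tau>1 Y1"
    using d by blast+
  have "set \<sigma>1 \<subseteq> Pos ` {0..<m}"
  proof
    fix t assume "t \<in> set \<sigma>1"
    then have "t \<in> Pos ` {..m}" "t \<noteq> Pos m" using sub1(1) \<sigma>_sub by blast+
    then obtain i where "t = Pos i" "i \<le> m" "i \<noteq> m" by auto
    then show "t \<in> Pos ` {0..<m}" by auto
  qed
  moreover have "set \<tau>1 \<subseteq> Neg ` {1..m}"
  proof
    fix t assume "t \<in> set \<tau>1"
    then have "t \<in> Neg ` {..m}" "t \<noteq> Neg 0" using sub1(2) \<tau>_sub by blast+
    then obtain i where "t = Neg i" "i \<le> m" "i \<noteq> 0" by auto
    then show "t \<in> Neg ` {1..m}" by auto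
  qed
  ultimately have "has_inverse (m * n) (elem_prod m n \<tau>1 Y1)" "has_inverse (m * n) (elem_prod m n \<sigma>1 X1)"
    using na1 by (auto intro!: has_inverse_elem_prod)
  from linear_iso_recovery_mat[OF this, of z]
  show "linear_iso (right_null_space (egfp m n A \<sigma> \<tau> \<sigma>1 \<sigma>2 \<tau>1 \<tau>2 X1 X2 Y1 Y2 z))
      (right_null_space (matpoly m n A z)) (\<lambda>x. recovery_mat m n A \<sigma> \<omega> \<sigma>2 \<tau>2 *\<^sub>v x)"
    unfolding egfp_def .
qed


section \<open>Transposition and the left null space\<close>

lemma transpose_diag_block_mat:
  "transpose_mat (diag_block_mat Bs) = diag_block_mat (map transpose_mat Bs)"
proof (induction Bs)
  case (Cons B Bs)
  define D where "D = diag_block_mat Bs"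
  have "diag_block_mat (B # Bs) = four_block_mat B (0\<^sub>m (dim_row B) (dim_col D)) (0\<^sub>m (dim_row D) (dim_col B)) D"
    by (simp only: diag_block_mat.simps Let_def D_def)
  moreover have "transpose_mat \<dots> = four_block_mat (transpose_mat B) (0\<^sub>m (dim_col B) (dim_row D))
      (0\<^sub>m (dim_col D) (dim_row B)) (transpose_mat D)"
    by (intro eq_matI) auto
  moreover have "diag_block_mat (map transpose_mat (B # Bs)) = four_block_mat (transpose_mat B)
      (0\<^sub>m (dim_col B) (dim_row D)) (0\<^sub>m (dim_col D) (dim_row B)) (transpose_mat D)"
    by (simp only: list.map diag_block_mat.simps Let_def Cons.IH[symmetric] D_def[symmetric]
        index_transpose_mat)
  ultimately show ?case by (simp only:)
qed (simp add: diag_block_mat.simps)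

lemma transpose_elem_mat:
  assumes "X \<in> carrier_mat n n"
  shows "transpose_mat (elem_mat m n t X) = elem_mat m n t (transpose_mat X)"
  using assms transpose_four_block_mat[of X n n "1\<^sub>m n" n "1\<^sub>m n" n "0\<^sub>m n n"]
    transpose_four_block_mat[of "0\<^sub>m n n" n n "1\<^sub>m n" n "1\<^sub>m n" n X]
  by (cases t) (simp_all add: elem_mat.simps transpose_diag_block_mat)

lemma invertible_transpose_mat:
  assumes "M \<in> carrier_mat d d" "invertible_mat (M :: complex mat)"
  shows "invertible_mat (transpose_mat M)" "mat_inv (transpose_mat M) = transpose_mat (mat_inv M)"
proof -
  note i = mat_inv_invertible[OF assms]
  have t: "transpose_mat M * transpose_mat (mat_inv M) = 1\<^sub>m d" "transpose_mat (mat_inv M) * transpose_mat M = 1\<^sub>m d"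
    using i assms(1) by (simp_all add: transpose_mult[symmetric, of _ d d _ d])
  then show "invertible_mat (transpose_mat M)"
    using assms(1) i(1) unfolding invertible_mat_def inverts_mat_def
    by (auto intro!: exI[of _ "transpose_mat (mat_inv M)"])
  show "mat_inv (transpose_mat M) = transpose_mat (mat_inv M)"
    using assms(1) i(1) t by (intro mat_inv_eqI[of _ d]) auto
qed

lemma mat_prod_append:
  assumes "set Bs \<subseteq> carrier_mat d d" "set Cs \<subseteq> carrier_mat d d"
  shows "mat_prod d (Bs @ Cs) = mat_prod d Bs * mat_prod d Cs"
  using assms
proof (induction Bs)
  case Nil
  then show ?case using mat_prod_carrier[of Cs d] by simp
next
  case (Cons B Bs)
  then show ?case using mat_prod_carrier[of Cs d] mat_prod_carrier[of Bs d]
    by (simp add: mat_prod_Cons assoc_mult_mat[of _ d d _ d _ d])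
qed

lemma transpose_mat_prod:
  assumes "set Bs \<subseteq> carrier_mat d d"
  shows "transpose_mat (mat_prod d Bs) = mat_prod d (rev (map transpose_mat Bs))"
  using assms
proof (induction Bs)
  case (Cons B Bs)
  have Bs: "transpose_mat ` set Bs \<subseteq> carrier_mat d d" using Cons.prems by auto
  have "transpose_mat (mat_prod d (B # Bs)) = transpose_mat (mat_prod d Bs) * transpose_mat B"
    using Cons.prems mat_prod_carrier[of Bs d] by (simp add: mat_prod_Cons transpose_mult[of _ d d _ d])
  also have "\<dots> = mat_prod d (rev (map transpose_mat (B # Bs)))"
    using Bs Cons mat_prod_append[of "rev (map transpose_mat Bs)" d "[transpose_mat B]"]
    by (auto simp: mat_prod_Cons)
  finally show ?case .
qed simp

lemma transpose_elem_prod: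
  assumes t: "set t \<subseteq> Pos ` {0..<m} \<union> Neg ` {1..m}" and X: "matrix_assignment n t X"
  shows "transpose_mat (elem_prod m n t X) = elem_prod m n (rev t) (rev (map transpose_mat X))"
proof -
  have len: "length t = length X" and XC: "set X \<subseteq> carrier_mat n n"
    using X unfolding matrix_assignment_def by auto
  have c: "B \<in> carrier_mat n n" if "(s, B) \<in> set (zip t X)" for s B
    using that XC by (auto dest: set_zip_rightD)
  have "set (map2 (elem_mat m n) t X) \<subseteq> carrier_mat (m * n) (m * n)"
    using c t by (auto dest: set_zip_leftD intro!: elem_mat_carrier)
  from transpose_mat_prod[OF this]
  have "transpose_mat (elem_prod m n t X) = mat_prod (m * n) (rev (map transpose_mat (map2 (elem_mat m n) t X)))"
    unfolding elem_prod_def .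
  also have "map transpose_mat (map2 (elem_mat m n) t X) = map2 (elem_mat m n) t (map transpose_mat X)"
    using c by (auto simp: zip_map2 transpose_elem_mat)
  also have "rev \<dots> = map2 (elem_mat m n) (rev t) (rev (map transpose_mat X))"
    using zip_rev[of t "map transpose_mat X"] len by (simp only: rev_map length_map)
  finally show ?thesis unfolding elem_prod_def .
qed

lemma transpose_matpoly:
  assumes "\<And>i. i \<le> m \<Longrightarrow> A i \<in> carrier_mat n n"
  shows "transpose_mat (matpoly m n A z) = matpoly m n (\<lambda>i. transpose_mat (A i)) z"
proof -
  have "transpose_mat (A k) $$ (i, j) = A k $$ (j, i)" if "k \<le> m" "i < n" "j < n" for k i j
    using assms[OF that(1)] that by auto
  then show ?thesis by (intro eq_matI) (auto simp: matpoly_def)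
qed

context matrix_poly
begin

lemma transpose_fiedler_mat:
  assumes t: "legal t"
  shows "transpose_mat (fiedler_mat m n A t) = fiedler_mat m n (\<lambda>i. transpose_mat (A i)) t"
proof -
  interpret T: matrix_poly m n "\<lambda>i. transpose_mat (A i)"
    by unfold_locales (use m2 A in auto)
  have uminus: "transpose_mat (- B) = - transpose_mat B" if "B \<in> carrier_mat n n" for B :: "complex mat"
    using that by (intro eq_matI) auto
  show ?thesis using t
  proof (cases rule: legal_cases)
    case 1
    then show ?thesis using A[of 0] m2 by (simp add: transpose_elem_mat uminus)
  next
    case 2
    then show ?thesis
      using invertible_transpose_mat[OF A[OF order.refl] 2(2)] mat_inv_invertible(1)[OF A[OF order.refl] 2(2)]
      by (simp add: fiedler_Pos_m T.fiedler_Pos_m transpose_elem_mat)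
  next
    case (3 i)
    then show ?thesis using A[of i] by (simp add: transpose_elem_mat uminus)
  next
    case 4
    then show ?thesis using A[of m] m2 by (simp add: transpose_elem_mat)
  next
    case 5
    then show ?thesis
      using invertible_transpose_mat[OF A[OF le0] 5(2)] mat_inv_invertible(1)[OF A[OF le0] 5(2)]
      by (simp add: fiedler_Neg_0 T.fiedler_Neg_0 transpose_elem_mat uminus)
  next
    case (6 i)
    then show ?thesis using A[of i] by (simp add: transpose_elem_mat)
  qed
qed

lemma transpose_fiedler_prod:
  assumes "Ball (set t) legal"
  shows "transpose_mat (fiedler_prod m n A t) = fiedler_prod m n (\<lambda>i. transpose_mat (A i)) (rev t)"
proof -
  have "set (map (fiedler_mat m n A) t) \<subseteq> carrier_mat (m * n) (m * n)"
    using assms fiedler_carrier by auto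
  from transpose_mat_prod[OF this]
  have "transpose_mat (fiedler_prod m n A t) = mat_prod (m * n) (rev (map transpose_mat (map (fiedler_mat m n A) t)))"
    unfolding fiedler_prod_def .
  also have "map transpose_mat (map (fiedler_mat m n A) t) = map (fiedler_mat m n (\<lambda>i. transpose_mat (A i))) t"
    using assms transpose_fiedler_mat by simp
  finally show ?thesis unfolding fiedler_prod_def by (simp add: rev_map)
qed

end

text \<open>Reversal preserves the successor infix property, so the transposed data are again those of an EGFP,
  with left and right outer factors exchanged.\<close>
lemma egfp_data_transpose:
  assumes A: "\<forall>i\<le>m. A i \<in> carrier_mat n n"
    and "egfp_data m n A \<sigma> \<omega> \<tau> \<sigma>1 \<sigma>2 \<tau>1 \<tau>2 X1 X2 Y1 Y2"
  shows "egfp_data m n (\<lambda>i. transpose_mat (A i)) (rev \<sigma>) (rev \<omega>) (rev \<tau>) (rev \<sigma>2) (rev \<sigma>1) (rev \<tau>2) (rev \<tau>1)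
    (rev (map transpose_mat X2)) (rev (map transpose_mat X1)) (rev (map transpose_mat Y2)) (rev (map transpose_mat Y1))"
proof -
  note d = assms(2)[unfolded egfp_data_def]
  have na: "nonsingular_assignment m n (rev t) (rev (map transpose_mat X))"
    if n: "nonsingular_assignment m n t X" for t X
  proof -
    have len: "length X = length t" and XC: "set X \<subseteq> carrier_mat n n"
      and inv: "\<And>k. k < length t \<Longrightarrow> t ! k \<in> {Pos 0, Neg 0, Pos m, Neg m} \<Longrightarrow> invertible_mat (X ! k)"
      using n unfolding nonsingular_assignment_def matrix_assignment_def by auto
    have "invertible_mat (rev (map transpose_mat X) ! k)"
      if k: "k < length (rev t)" "rev t ! k \<in> {Pos 0, Neg 0, Pos m, Neg m}" for k
    proof -
      let ?k = "length t - Suc k"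
      have k': "?k < length t" "?k < length X" using k(1) len by auto
      have "t ! ?k \<in> {Pos 0, Neg 0, Pos m, Neg m}" using k by (simp add: rev_nth)
      then have "invertible_mat (X ! ?k)" using inv k' by blast
      moreover have "X ! ?k \<in> carrier_mat n n" using XC k' by auto
      ultimately have "invertible_mat (transpose_mat (X ! ?k))" by (rule invertible_transpose_mat(1)[rotated])
      then show ?thesis using k(1) k' len by (simp add: rev_nth)
    qed
    then show ?thesis unfolding nonsingular_assignment_def matrix_assignment_def using len XC by auto
  qed
  have SIP: "SIP (rev \<sigma>2 @ rev \<sigma> @ rev \<sigma>1)" "SIP (rev \<tau>2 @ rev \<tau> @ rev \<tau>1)"
    using d SIP_rev[of "\<sigma>1 @ \<sigma> @ \<sigma>2"] SIP_rev[of "\<tau>1 @ \<tau> @ \<tau>2"] by auto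
  have "invertible_mat (transpose_mat (A m))" if "Pos m \<in> set \<sigma>"
    using that d A by (intro invertible_transpose_mat(1)[of _ n]) auto
  moreover have "invertible_mat (transpose_mat (A 0))" if "Neg 0 \<in> set \<tau>"
    using that d A by (intro invertible_transpose_mat(1)[of _ n]) auto
  ultimately show ?thesis unfolding egfp_data_def using d na SIP
    by (auto simp: rev_map)
qed

lemma transpose_egfp:
  assumes m: "2 \<le> m" and AC: "\<forall>i\<le>m. A i \<in> carrier_mat n n"
    and data: "egfp_data m n A \<sigma> \<omega> \<tau> \<sigma>1 \<sigma>2 \<tau>1 \<tau>2 X1 X2 Y1 Y2"
  shows "transpose_mat (egfp m n A \<sigma> \<tau> \<sigma>1 \<sigma>2 \<tau>1 \<tau>2 X1 X2 Y1 Y2 z) =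
    egfp m n (\<lambda>i. transpose_mat (A i)) (rev \<sigma>) (rev \<tau>) (rev \<sigma>2) (rev \<sigma>1) (rev \<tau>2) (rev \<tau>1)
      (rev (map transpose_mat X2)) (rev (map transpose_mat X1)) (rev (map transpose_mat Y2)) (rev (map transpose_mat Y1)) z"
proof -
  interpret egfp_right m n A \<sigma> \<tau> \<omega> \<sigma>2 \<tau>2 X2 Y2 by (rule right_recovery(1)[OF m AC data])
  note d = data[unfolded egfp_data_def]
  have AC': "\<forall>i\<le>m. transpose_mat (A i) \<in> carrier_mat n n" using AC by auto
  interpret T: egfp_right m n "\<lambda>i. transpose_mat (A i)" "rev \<sigma>" "rev \<tau>" "rev \<omega>" "rev \<sigma>1" "rev \<tau>1"
    "rev (map transpose_mat X1)" "rev (map transpose_mat Y1)"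
    by (rule right_recovery(1)[OF m AC' egfp_data_transpose[OF AC data]])
  have \<sigma>1: "set \<sigma>1 \<subseteq> Pos ` {0..<m} \<union> Neg ` {1..m}" and \<tau>1: "set \<tau>1 \<subseteq> Pos ` {0..<m} \<union> Neg ` {1..m}"
    using T.\<sigma>2_Pos T.\<tau>2_Neg by auto
  have \<sigma>2': "set \<sigma>2 \<subseteq> Pos ` {0..<m} \<union> Neg ` {1..m}" and \<tau>2': "set \<tau>2 \<subseteq> Pos ` {0..<m} \<union> Neg ` {1..m}"
    using \<sigma>2_Pos \<tau>2_Neg by auto
  have ma: "matrix_assignment n \<sigma>1 X1" "matrix_assignment n \<tau>1 Y1"
    using d unfolding nonsingular_assignment_def by auto
  let ?T1 = "elem_prod m n \<tau>1 Y1" and ?S1 = "elem_prod m n \<sigma>1 X1"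
    and ?S2 = "elem_prod m n \<sigma>2 X2" and ?T2 = "elem_prod m n \<tau>2 Y2" and ?d = "m * n"
  note c = elem_prod_carrier[OF \<tau>1 ma(2)] elem_prod_carrier[OF \<sigma>1 ma(1)]
    elem_prod_carrier[OF \<sigma>2' assignments(1)] elem_prod_carrier[OF \<tau>2' assignments(2)]
  note f = fiedler_prod_carrier[OF legal_\<tau>] fiedler_prod_carrier[OF legal_\<sigma>]
  have P: "pencil z \<in> carrier_mat ?d ?d" using f by auto
  have tP: "transpose_mat (pencil z) = z \<cdot>\<^sub>m transpose_mat (fiedler_prod m n A \<tau>) - transpose_mat (fiedler_prod m n A \<sigma>)"
    using f by (intro eq_matI) auto
  have tr: "transpose_mat (B * C) = transpose_mat C * transpose_mat B"
    if "B \<in> carrier_mat ?d ?d" "C \<in> carrier_mat ?d ?d" for B C :: "complex mat"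
    using that by (rule transpose_mult)
  have as: "B * (C * D) = B * C * D"
    if "B \<in> carrier_mat ?d ?d" "C \<in> carrier_mat ?d ?d" "D \<in> carrier_mat ?d ?d" for B C D :: "complex mat"
    using that by (intro assoc_mult_mat[symmetric])
  have t: "transpose_mat B \<in> carrier_mat ?d ?d" if "B \<in> carrier_mat ?d ?d" for B :: "complex mat"
    using that by simp
  note mc = mult_carrier_mat[of _ ?d ?d _ ?d]
  have "transpose_mat (?T1 * ?S1 * pencil z * ?S2 * ?T2) =
    transpose_mat ?T2 * (transpose_mat ?S2 * (transpose_mat (pencil z) * (transpose_mat ?S1 * transpose_mat ?T1)))"
    using c P by (simp only: tr mc)
  also have "\<dots> = transpose_mat ?T2 * transpose_mat ?S2 * transpose_mat (pencil z) * transpose_mat ?S1 * transpose_mat ?T1"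
    using c P by (simp only: as mc t)
  finally show ?thesis unfolding egfp_def
    unfolding tP transpose_elem_prod[OF \<tau>1 ma(2)] transpose_elem_prod[OF \<sigma>1 ma(1)]
      transpose_elem_prod[OF \<sigma>2' assignments(1)] transpose_elem_prod[OF \<tau>2' assignments(2)]
      transpose_fiedler_prod[OF legal_\<tau>] transpose_fiedler_prod[OF legal_\<sigma>] .
qed

lemma left_null_space_transpose: "left_null_space B = right_null_space (transpose_mat B)"
proof -
  have "mat_of_row x * B = 0\<^sub>m 1 (dim_col B) \<longleftrightarrow> transpose_mat B *\<^sub>v x = 0\<^sub>v (dim_col B)"
    if "x \<in> carrier_vec (dim_row B)" for x
  proof
    assume eq: "mat_of_row x * B = 0\<^sub>m 1 (dim_col B)"
    show "transpose_mat B *\<^sub>v x = 0\<^sub>v (dim_col B)"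
    proof (rule eq_vecI)
      fix j assume "j < dim_vec (0\<^sub>v (dim_col B) :: complex vec)"
      then have j: "j < dim_col B" by simp
      have "(mat_of_row x * B) $$ (0, j) = 0" using eq j by simp
      then show "(transpose_mat B *\<^sub>v x) $ j = 0\<^sub>v (dim_col B) $ j"
        using j that by (simp add: comm_scalar_prod[of x "dim_row B"])
    qed simp
  next
    assume eq: "transpose_mat B *\<^sub>v x = 0\<^sub>v (dim_col B)"
    show "mat_of_row x * B = 0\<^sub>m 1 (dim_col B)"
    proof (rule eq_matI)
      fix i j assume "i < dim_row (0\<^sub>m 1 (dim_col B) :: complex mat)" "j < dim_col (0\<^sub>m 1 (dim_col B) :: complex mat)"
      then have j: "i = 0" "j < dim_col B" by auto
      have "(transpose_mat B *\<^sub>v x) $ j = 0" using eq j by simp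
      then show "(mat_of_row x * B) $$ (i, j) = 0\<^sub>m 1 (dim_col B) $$ (i, j)"
        using j that by (simp add: comm_scalar_prod[of x "dim_row B"])
    qed auto
  qed
  then have "left_kernel B = mat_kernel (transpose_mat B)"
    unfolding left_kernel_def mat_kernel_def by auto
  then show ?thesis unfolding left_null_space_def right_null_space_def by simp
qed

text \<open>The six cases are exhaustive. The matrices \<open>Bm\<close> and \<open>Bz\<close> stand for the inverses of \<open>A\<^sub>m\<close> and \<open>A\<^sub>0\<close>; they are
  kept apart from \<open>mat_inv\<close> because transposition commutes with it only on invertible matrices,
  which \<open>A\<^sub>m\<close> and \<open>A\<^sub>0\<close> are in the cases that use them.\<close>
lemma recovery_matI:
  assumes \<sigma>: "set \<sigma> \<subseteq> Pos ` {..m}" and \<omega>: "set \<omega> \<subseteq> Pos ` {..m}"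
    and zero: "Pos 0 \<in> set \<sigma> \<longleftrightarrow> Pos 0 \<notin> set \<omega>"
    and Bm: "Pos m \<in> set \<sigma> \<Longrightarrow> Bm = mat_inv (A m)" and Bz: "Pos 0 \<in> set \<omega> \<Longrightarrow> Bz = mat_inv (A 0)"
    and F1: "Pos 0 \<in> set \<sigma> \<Longrightarrow> consecutions (Pos 0) \<sigma> < int m \<Longrightarrow>
      F = block_row m n (int m - consecutions (Pos 0) (\<sigma> @ \<sigma>2))"
    and F2: "Pos 0 \<in> set \<sigma> \<Longrightarrow> consecutions (Pos 0) \<sigma> = int m \<Longrightarrow> F = Bm * block_row m n 1"
    and F3: "\<And>i q. i = inversions (Pos 0) \<omega> \<Longrightarrow> Pos 0 \<in> set \<omega> \<Longrightarrow> Pos (nat (i + 1)) \<in> set \<sigma> \<Longrightarrow>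
      i + consecutions (Pos (nat (i + 1))) \<sigma> + 1 < int m \<Longrightarrow>
      q = i + consecutions (Pos (nat (i + 1))) (\<sigma> @ \<sigma>2) + 1 \<Longrightarrow> F = block_row m n (int m - q)"
    and F4: "\<And>i q. i = inversions (Pos 0) \<omega> \<Longrightarrow> Pos 0 \<in> set \<omega> \<Longrightarrow> Pos (nat (i + 1)) \<in> set \<sigma> \<Longrightarrow>
      i + consecutions (Pos (nat (i + 1))) \<sigma> + 1 = int m \<Longrightarrow>
      q = consecutions (Neg (m - 1)) \<tau>2 + 2 \<Longrightarrow> F = Bm * block_row m n q"
    and F5: "\<And>i q. i = inversions (Pos 0) \<omega> \<Longrightarrow> Pos 0 \<in> set \<omega> \<Longrightarrow> i < int m \<Longrightarrow> Pos (nat (i + 1)) \<notin> set \<sigma> \<Longrightarrow>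
      q = i - consecutions (Neg (nat i)) \<tau>2 - 1 \<Longrightarrow> F = block_row m n (int m - q)"
    and F6: "Pos 0 \<in> set \<omega> \<Longrightarrow> inversions (Pos 0) \<omega> = int m \<Longrightarrow> F = Bz * block_row m n (int m)"
  shows "F = recovery_mat m n A \<sigma> \<omega> \<sigma>2 \<tau>2"
proof -
  have run: "\<exists>s. consecutions (Pos r) \<alpha> = int s \<and> r + s \<le> m \<and> Pos (r + s) \<in> set \<alpha>"
    if r: "Pos r \<in> set \<alpha>" "set \<alpha> \<subseteq> Pos ` {..m}" for r \<alpha>
  proof -
    obtain s where s: "run_len (Pos r) \<alpha> = Suc s" using r(1) run_len_eq_0_iff by (cases "run_len (Pos r) \<alpha>") auto
    then have "Pos (r + s) \<in> set \<alpha>" by (intro set_of_run_len_Pos) simp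
    then show ?thesis using s r(2) by (intro exI[of _ s]) (auto simp: consecutions_run_len)
  qed
  show ?thesis
  proof (cases "Pos 0 \<in> set \<sigma>")
    case True
    from run[OF True \<sigma>] obtain s where s: "consecutions (Pos 0) \<sigma> = int s" "s \<le> m" "Pos s \<in> set \<sigma>" by auto
    show ?thesis
    proof (cases "s < m")
      case less: True
      then show ?thesis using F1 True s by (simp add: recovery_mat_def)
    next
      case False
      then have "s = m" using s(2) by simp
      then show ?thesis using F2 Bm True s by (simp add: recovery_mat_def)
    qed
  next
    case False
    then have z: "Pos 0 \<in> set \<omega>" using zero by simp
    from run[of 0 "rev \<omega>"] z \<omega> obtain i where i: "inversions (Pos 0) \<omega> = int i" "i \<le> m"
      by (auto simp: inversions_rev)
    have nat: "nat (int i + 1) = Suc i" by simp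
    show ?thesis
    proof (cases "i = m")
      case True
      then show ?thesis using F6[OF z] Bz[OF z] False i by (simp add: recovery_mat_def)
    next
      case im: False
      show ?thesis
      proof (cases "Pos (Suc i) \<in> set \<sigma>")
        case out: False
        then show ?thesis using F5[OF refl z] False i im nat
          by (simp add: recovery_mat_def Let_def del: of_nat_Suc)
      next
        case True
        from run[OF True \<sigma>] obtain s where s: "consecutions (Pos (Suc i)) \<sigma> = int s" "Suc i + s \<le> m"
          "Pos (Suc i + s) \<in> set \<sigma>" by auto
        show ?thesis
        proof (cases "Suc i + s < m")
          case less: True
          then show ?thesis using F3[OF refl z] False i im nat True s
            by (simp add: recovery_mat_def Let_def del: of_nat_Suc)
        next
          case eq: False
          then have sm: "Suc i + s = m" using s(2) by simp
          then have "F = Bm * block_row m n (consecutions (Neg (m - 1)) \<tau>2 + 2)"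
            using F4[OF refl z] i nat True s(1) by (simp del: of_nat_Suc)
          moreover have "Bm = mat_inv (A m)" using Bm s(3) sm by simp
          ultimately show ?thesis using False i im nat True s(1) sm
            by (simp add: recovery_mat_def Let_def del: of_nat_Suc)
        qed
      qed
    qed
  qed
qed


theorem theorem5p7:
  fixes m n p :: nat
    and A :: "nat \<Rightarrow> complex mat"
    and \<mu> :: complex
    and \<sigma> \<omega> \<tau> \<sigma>1 \<sigma>2 \<tau>1 \<tau>2 :: "idx list"
    and X1 X2 Y1 Y2 :: "complex mat list"
    and L P :: "complex \<Rightarrow> complex mat"
    and Z F K :: "complex mat"
  assumes m: "m \<ge> 2"
    and A: "\<forall>i\<le>m. A i \<in> carrier_mat n n"
    and Am: "A m \<noteq> 0\<^sub>m n n"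
    and P: "P = matpoly m n A"
    and regular: "regular_matpoly m n A"
    and eigenvalue: "matpoly_eigenvalue m n A \<mu>"
    and data: "egfp_data m n A \<sigma> \<omega> \<tau> \<sigma>1 \<sigma>2 \<tau>1 \<tau>2 X1 X2 Y1 Y2"
    and L: "L = egfp m n A \<sigma> \<tau> \<sigma>1 \<sigma>2 \<tau>1 \<tau>2 X1 X2 Y1 Y2"
    and Z: "Z \<in> carrier_mat (m * n) p"
    and rank_Z: "vec_space.rank (m * n) Z = p"
    and F1: "Pos 0 \<in> set \<sigma> \<Longrightarrow> consecutions (Pos 0) \<sigma> < int m \<Longrightarrow>
      F = block_row m n (int m - consecutions (Pos 0) (\<sigma> @ \<sigma>2))"
    and F2: "Pos 0 \<in> set \<sigma> \<Longrightarrow> consecutions (Pos 0) \<sigma> = int m \<Longrightarrow>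
      F = mat_inv (A m) * block_row m n 1"
    and F3: "\<And>i q. i = inversions (Pos 0) \<omega> \<Longrightarrow>
      Pos 0 \<in> set \<omega> \<Longrightarrow> Pos (nat (i + 1)) \<in> set \<sigma> \<Longrightarrow>
      i + consecutions (Pos (nat (i + 1))) \<sigma> + 1 < int m \<Longrightarrow>
      q = i + consecutions (Pos (nat (i + 1))) (\<sigma> @ \<sigma>2) + 1 \<Longrightarrow>
      F = block_row m n (int m - q)"
    and F4: "\<And>i q. i = inversions (Pos 0) \<omega> \<Longrightarrow>
      Pos 0 \<in> set \<omega> \<Longrightarrow> Pos (nat (i + 1)) \<in> set \<sigma> \<Longrightarrow>
      i + consecutions (Pos (nat (i + 1))) \<sigma> + 1 = int m \<Longrightarrow>
      q = consecutions (Neg (m - 1)) \<tau>2 + 2 \<Longrightarrow>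
      F = mat_inv (A m) * block_row m n q"
    and F5: "\<And>i q. i = inversions (Pos 0) \<omega> \<Longrightarrow>
      Pos 0 \<in> set \<omega> \<Longrightarrow> i < int m \<Longrightarrow> Pos (nat (i + 1)) \<notin> set \<sigma> \<Longrightarrow>
      q = i - consecutions (Neg (nat i)) \<tau>2 - 1 \<Longrightarrow>
      F = block_row m n (int m - q)"
    and F6: "Pos 0 \<in> set \<omega> \<Longrightarrow> inversions (Pos 0) \<omega> = int m \<Longrightarrow>
      F = mat_inv (A 0) * block_row m n (int m)"
    and K1: "Pos 0 \<in> set \<sigma> \<Longrightarrow> inversions (Pos 0) \<sigma> < int m \<Longrightarrow>
      K = block_row m n (int m - inversions (Pos 0) (\<sigma>1 @ \<sigma>))"
    and K2: "Pos 0 \<in> set \<sigma> \<Longrightarrow> inversions (Pos 0) \<sigma> = int m \<Longrightarrow>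
      K = transpose_mat (mat_inv (A m)) * block_row m n 1"
    and K3: "\<And>c q. c = consecutions (Pos 0) \<omega> \<Longrightarrow>
      Pos 0 \<in> set \<omega> \<Longrightarrow> Pos (nat (c + 1)) \<in> set \<sigma> \<Longrightarrow>
      c + inversions (Pos (nat (c + 1))) \<sigma> + 1 < int m \<Longrightarrow>
      q = c + inversions (Pos (nat (c + 1))) (\<sigma>1 @ \<sigma>) + 1 \<Longrightarrow>
      K = block_row m n (int m - q)"
    and K4: "\<And>c q. c = consecutions (Pos 0) \<omega> \<Longrightarrow>
      Pos 0 \<in> set \<omega> \<Longrightarrow> Pos (nat (c + 1)) \<in> set \<sigma> \<Longrightarrow>
      c + inversions (Pos (nat (c + 1))) \<sigma> + 1 = int m \<Longrightarrow>
      q = inversions (Neg (m - 1)) \<tau>1 + 2 \<Longrightarrow>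
      K = transpose_mat (mat_inv (A m)) * block_row m n q"
    and K5: "\<And>c q. c = consecutions (Pos 0) \<omega> \<Longrightarrow>
      Pos 0 \<in> set \<omega> \<Longrightarrow> c < int m \<Longrightarrow> Pos (nat (c + 1)) \<notin> set \<sigma> \<Longrightarrow>
      q = c - inversions (Neg (nat c)) \<tau>1 - 1 \<Longrightarrow>
      K = block_row m n (int m - q)"
    and K6: "Pos 0 \<in> set \<omega> \<Longrightarrow> consecutions (Pos 0) \<omega> = int m \<Longrightarrow>
      K = transpose_mat (mat_inv (A 0)) * block_row m n (int m)"
  shows "linear_iso (right_null_space (L \<mu>)) (right_null_space (P \<mu>)) (\<lambda>x. F *\<^sub>v x) \<and>
    linear_iso (left_null_space (L \<mu>)) (left_null_space (P \<mu>)) (\<lambda>y. K *\<^sub>v y) \<and>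
    (columns_form_basis Z (right_null_space (L \<mu>)) \<longrightarrow>
       columns_form_basis (F * Z) (right_null_space (P \<mu>))) \<and>
    (columns_form_basis Z (left_null_space (L \<mu>)) \<longrightarrow>
       columns_form_basis (K * Z) (left_null_space (P \<mu>)))"
proof -
  note d = data[unfolded egfp_data_def]
  have sub: "set \<sigma> \<subseteq> Pos ` {..m}" "set \<omega> \<subseteq> Pos ` {..m}" "Pos 0 \<in> set \<sigma> \<longleftrightarrow> Pos 0 \<notin> set \<omega>"
  proof -
    have set: "set \<sigma> \<union> set \<omega> = Pos ` {..m}" using d unfolding atLeast0AtMost set_append by blast
    then show "set \<sigma> \<subseteq> Pos ` {..m}" "set \<omega> \<subseteq> Pos ` {..m}" by auto
    have "set \<sigma> \<inter> set \<omega> = {}" using d unfolding distinct_append by blast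
    moreover have "Pos 0 \<in> set \<sigma> \<union> set \<omega>" unfolding set by auto
    ultimately show "Pos 0 \<in> set \<sigma> \<longleftrightarrow> Pos 0 \<notin> set \<omega>" by auto
  qed
  have F: "F = recovery_mat m n A \<sigma> \<omega> \<sigma>2 \<tau>2"
    by (rule recovery_matI[OF sub refl refl F1 F2 F3 F4 F5 F6])
  have A0: "A 0 \<in> carrier_mat n n" and Am': "A m \<in> carrier_mat n n" using A by auto
  have inv: "invertible_mat (A m)" if "Pos m \<in> set (rev \<sigma>)"
    using that d by simp
  have inv0: "invertible_mat (A 0)" if "Pos 0 \<in> set (rev \<omega>)"
  proof -
    have "idx_neg (Pos 0) \<in> set \<tau>" using that d by (metis imageI set_map set_rev)
    then show ?thesis using d by simp
  qed
  let ?A = "\<lambda>i. transpose_mat (A i)"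
  have c: "consecutions t (rev \<alpha>) = inversions t \<alpha>" "inversions t (rev \<alpha>) = consecutions t \<alpha>"
    "consecutions t (rev \<alpha> @ rev \<beta>) = inversions t (\<beta> @ \<alpha>)" for t \<alpha> \<beta>
    by (simp_all add: inversions_rev)
  have K: "K = recovery_mat m n ?A (rev \<sigma>) (rev \<omega>) (rev \<sigma>1) (rev \<tau>1)"
  proof (rule recovery_matI[where Bm = "transpose_mat (mat_inv (A m))" and Bz = "transpose_mat (mat_inv (A 0))"])
    show "transpose_mat (mat_inv (A m)) = mat_inv (transpose_mat (A m))" if "Pos m \<in> set (rev \<sigma>)"
      by (rule invertible_transpose_mat(2)[OF Am' inv[OF that], symmetric])
    show "transpose_mat (mat_inv (A 0)) = mat_inv (transpose_mat (A 0))" if "Pos 0 \<in> set (rev \<omega>)"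
      by (rule invertible_transpose_mat(2)[OF A0 inv0[OF that], symmetric])
  qed (unfold c set_rev, (fact sub K1 K2 K3 K4 K5 K6)+)
  have R: "linear_iso (right_null_space (L \<mu>)) (right_null_space (P \<mu>)) (\<lambda>x. F *\<^sub>v x)"
    unfolding L P F by (rule right_recovery(2)[OF m A data])
  have AT: "\<forall>i\<le>m. ?A i \<in> carrier_mat n n" using A by auto
  have "linear_iso (right_null_space (transpose_mat (L \<mu>))) (right_null_space (transpose_mat (P \<mu>))) (\<lambda>y. K *\<^sub>v y)"
    unfolding L P K transpose_egfp[OF m A data]
    using right_recovery(2)[OF m AT egfp_data_transpose[OF A data], of \<mu>] transpose_matpoly[of m A n \<mu>] A by simp
  then have Lf: "linear_iso (left_null_space (L \<mu>)) (left_null_space (P \<mu>)) (\<lambda>y. K *\<^sub>v y)"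
    unfolding left_null_space_transpose .
  have "F \<in> carrier_mat n (m * n)"
    unfolding F by (rule egfp_right.recovery_mat_carrier[OF right_recovery(1)[OF m A data]])
  moreover have "K \<in> carrier_mat n (m * n)"
    unfolding K by (rule egfp_right.recovery_mat_carrier[OF right_recovery(1)[OF m AT egfp_data_transpose[OF A data]]])
  ultimately show ?thesis
    using R Lf columns_form_basis_image[OF R Z] columns_form_basis_image[OF Lf Z] by blast
qed


end
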